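(* Let $X$ be a Euclidean space, let $M \subset X$ be a set that is a $C^2$-smooth manifold around a point $\bar x \in M$, and let $f : X \to \mathbf{R}$ be a locally Lipschitz function that grows robustly relative to $M$ at $\bar x$ and has tempered growth at $\bar x$ relative to $M$. Then $f$ has the Goldstein property at $\bar x$, and indeed, given any constant $\gamma \in (0,1)$, the interval $[\beta\gamma,\beta]$ is a proportionality bracket for all sufficiently small $\beta > 0$. Consequently (for any $\gamma \in (0,1)$ and all sufficiently small $\beta>0$), any sequence of points $(x_r)$ generated iteratively from an initial point near $\bar x$ by updating iterates $x \ne \bar x$ according to the rule $$x \leftarrow x - \epsilon \frac{g}{|g|} \quad \text{for any } \epsilon \text{ satisfying } \gamma \le \frac{\epsilon}{\beta|x-\bar x|} \le 1, \text{ and } g = g_\epsilon(x),$$ converges nearly linearly to $\bar x$, in the sense that there exist constants $a,b>0$ such that $|x_r - \bar x| \le a e^{-b\sqrt r}$ for all $r$.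
   Context: $X$ is a finite-dimensional Euclidean space with inner product $\langle\cdot,\cdot\rangle$, norm $|\cdot|$ and closed unit ball $B$. For a locally Lipschitz $f : X \to \mathbf{R}$, the Clarke subdifferential $\partial f(x)$ is the closed convex hull of all limits $\lim_r \nabla f(x_r)$ arising from sequences $x_r \to x$ of points of differentiability. For $\epsilon \ge 0$, $\partial_\epsilon f(x) = \mathrm{conv}\big(\bigcup_{y \in x + \epsilon B} \partial f(y)\big)$, and the Goldstein subgradient $g_\epsilon(x)$ is the shortest vector in $\partial_\epsilon f(x)$. The function $f$ is subdifferentially regular at $x$ when $\lim_{t \downarrow 0} \frac1t (f(x+ty)-f(x)) = \max_{v \in \partial f(x)} \langle v,y\rangle$ for all $y \in X$. For $x$ near $\bar x$, $P_M(x)$ is the unique nearest point to $x$ in $M$, and $d_M(x)$ is the distance from $x$ to $M$. Robust growth: $f$ grows robustly relative to $M$ at $\bar x$ when: (1) there is $\delta > 0$ with $f(x) - f(\bar x) \ge \frac{\delta}{2}|x - \bar x|^2$ for all $x$ near $\bar x$; (2) $f$ is subdifferentially regular at every point of $M$; (3) the restriction $f_M : M \to \mathbf{R}$ is $C^2$-smooth; (4) there is $K > 0$ such that all $x,y$ near $\bar x$ with $x \in M$ satisfy $\partial f(y) \subset \partial f(x) + K|x-y|B$; (5) there is $\mu > 0$ such that all $x \in X$ near $\bar x$ and all $v \in \partial f(x)$ satisfy $\langle v, x - P_M(x)\rangle \ge \mu\, d_M(x)$. Tempered growth: assuming $f_M$ is $C^2$-smooth, let $\nabla f_M(x)$ (for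 $x \in M$ near $\bar x$) be its Riemannian gradient, viewed as a vector in the tangent space $T_M(x) \subset X$. $f$ has tempered growth at $\bar x$ relative to $M$ if, given any angle $\theta > 0$, for any sufficiently small $\beta > 0$ and any sequences of points $\bar x \ne x_r \to \bar x$ and radii $0 \le \epsilon_r \le \beta|x_r - \bar x|$ whose Goldstein subgradients $g_{\epsilon_r}(x_r)$ converge to zero, the vectors $g_{\epsilon_r}(x_r)$ and $\nabla f_M(P_M(x_r))$ are, for all large $r$, nonzero and subtend an angle less than $\theta$. Goldstein property: a locally Lipschitz $f$ has the Goldstein property at $\bar x$ if there exist constants $\nu > \mu > 0$ and $\theta \in (0,1)$ such that, for any point $x \ne \bar x$ near $\bar x$ and any $\epsilon$ with $\mu \le \frac{\epsilon}{|x-\bar x|} \le \nu$, the Goldstein subgradient $g = g_\epsilon(x)$ is nonzero and the point $x^+ = x - \epsilon\frac{g}{|g|}$ satisfies either $f(x^+) - f(\bar x) \le \theta(f(x) - f(\bar x))$ or $|x^+ - \bar x| \le \theta|x - \bar x|$. In that case the interval $[\mu,\nu]$ is called a proportionality bracket. If an iterate equals $\bar x$, no further updates are made. *)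

theory Defs
  imports "HOL-Analysis.Analysis"
begin

section \<open>Clarke and Goldstein subdifferentials\<close>

definition locally_lipschitz :: "('a::metric_space \<Rightarrow> 'b::metric_space) \<Rightarrow> bool" where
  "locally_lipschitz f \<longleftrightarrow> (\<forall>x. \<exists>r>0. \<exists>L. L-lipschitz_on (ball x r) f)"

definition clarke_subdiff :: "('a::euclidean_space \<Rightarrow> real) \<Rightarrow> 'a \<Rightarrow> 'a set" where
  "clarke_subdiff f x =
     closure (convex hull {v. \<exists>xs D. xs \<longlonglongrightarrow> x \<and> (\<forall>r. GDERIV f (xs r) :> D r) \<and> D \<longlonglongrightarrow> v})"

definition goldstein_subdiff :: "('a::euclidean_space \<Rightarrow> real) \<Rightarrow> real \<Rightarrow> 'a \<Rightarrow> 'a set" where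
  "goldstein_subdiff f \<epsilon> x = convex hull (\<Union>y\<in>cball x \<epsilon>. clarke_subdiff f y)"

definition goldstein_subgrad :: "('a::euclidean_space \<Rightarrow> real) \<Rightarrow> real \<Rightarrow> 'a \<Rightarrow> 'a" where
  "goldstein_subgrad f \<epsilon> x = closest_point (goldstein_subdiff f \<epsilon> x) 0"

text \<open>The vector \<open>v\<close> below is a maximizer of \<open>\<langle>\<cdot>, y\<rangle>\<close> over the Clarke subdifferential.\<close>

definition subdiff_regular :: "('a::euclidean_space \<Rightarrow> real) \<Rightarrow> 'a \<Rightarrow> bool" where
  "subdiff_regular f x \<longleftrightarrow>
     (\<forall>y. \<exists>v\<in>clarke_subdiff f x. (\<forall>w\<in>clarke_subdiff f x. w \<bullet> y \<le> v \<bullet> y) \<and>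
        ((\<lambda>t. (f (x + t *\<^sub>R y) - f x) / t) \<longlongrightarrow> v \<bullet> y) (at_right 0))"

section \<open>Twice continuously differentiable maps and embedded manifolds\<close>

text \<open>Intended for open \<open>S\<close>: \<open>D\<close> is the first and \<open>D2\<close> the second derivative of \<open>g\<close>.\<close>

definition C2_on :: "'a::real_normed_vector set \<Rightarrow> ('a \<Rightarrow> 'b::real_normed_vector) \<Rightarrow> bool" where
  "C2_on S g \<longleftrightarrow>
     (\<exists>(D :: 'a \<Rightarrow> 'a \<Rightarrow>\<^sub>L 'b) (D2 :: 'a \<Rightarrow> 'a \<Rightarrow>\<^sub>L 'a \<Rightarrow>\<^sub>L 'b).
        (\<forall>x\<in>S. (g has_derivative blinfun_apply (D x)) (at x)) \<and>
        (\<forall>x\<in>S. (D has_derivative blinfun_apply (D2 x)) (at x)) \<and>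
        continuous_on S D2)"

text \<open>Some \<open>C\<^sup>2\<close> diffeomorphism \<open>\<Phi>\<close> of an open neighbourhood \<open>U\<close> of \<open>p\<close> onto an open set, with
  inverse \<open>\<Psi>\<close>, carries \<open>M \<inter> U\<close> to a linear subspace \<open>V\<close> intersected with \<open>\<Phi> ` U\<close>.
  The dimension of \<open>M\<close> around \<open>p\<close> is \<open>dim V\<close>, which may be anything from \<open>0\<close> to \<open>DIM('a)\<close>.\<close>

definition C2_manifold_around :: "'a::euclidean_space set \<Rightarrow> 'a \<Rightarrow> bool" where
  "C2_manifold_around M p \<longleftrightarrow> p \<in> M \<and>
     (\<exists>U (\<Phi> :: 'a \<Rightarrow> 'a) (\<Psi> :: 'a \<Rightarrow> 'a) V. open U \<and> p \<in> U \<and> open (\<Phi> ` U) \<and>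
        C2_on U \<Phi> \<and> C2_on (\<Phi> ` U) \<Psi> \<and> (\<forall>x\<in>U. \<Psi> (\<Phi> x) = x) \<and>
        subspace V \<and> \<Phi> ` (M \<inter> U) = V \<inter> \<Phi> ` U)"

text \<open>Smoothness of the restriction of \<open>f\<close> to \<open>M\<close>. As \<open>M\<close> is only assumed to be a manifold around
  \<open>p\<close>, this is a local notion: \<open>f\<close> agrees on \<open>M\<close>, near \<open>p\<close>, with a \<open>C\<^sup>2\<close> function on an open
  set of the ambient space.\<close>

definition C2_restriction_around :: "('a::euclidean_space \<Rightarrow> real) \<Rightarrow> 'a set \<Rightarrow> 'a \<Rightarrow> bool" where
  "C2_restriction_around f M p \<longleftrightarrow>
     (\<exists>U h. open U \<and> p \<in> U \<and> C2_on U h \<and> (\<forall>x\<in>M \<inter> U. h x = f x))"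

definition C1_curve_in :: "'a::euclidean_space set \<Rightarrow> 'a \<Rightarrow> 'a \<Rightarrow> (real \<Rightarrow> 'a) \<Rightarrow> bool" where
  "C1_curve_in M x w c \<longleftrightarrow>
     (\<exists>\<eta>>0. c C1_differentiable_on {-\<eta><..<\<eta>} \<and> c ` {-\<eta><..<\<eta>} \<subseteq> M) \<and>
     c 0 = x \<and> (c has_vector_derivative w) (at 0)"

definition tangent_space :: "'a::euclidean_space set \<Rightarrow> 'a \<Rightarrow> 'a set" where
  "tangent_space M x = {w. \<exists>c. C1_curve_in M x w c}"

text \<open>The tangent vector representing the differential of the restriction of \<open>f\<close> to \<open>M\<close>, the
  differential being computed along curves in \<open>M\<close>. It exists and is unique when \<open>M\<close> is a manifold
  around \<open>x\<close> and the restriction is smooth there.\<close>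

definition riemannian_grad :: "'a::euclidean_space set \<Rightarrow> ('a \<Rightarrow> real) \<Rightarrow> 'a \<Rightarrow> 'a" where
  "riemannian_grad M f x = (THE v. v \<in> tangent_space M x \<and>
     (\<forall>w c. C1_curve_in M x w c \<longrightarrow> ((\<lambda>t. f (c t)) has_real_derivative v \<bullet> w) (at 0)))"

section \<open>Growth conditions\<close>

text \<open>The nearest-point projection onto \<open>M\<close> is \<^const>\<open>closest_point\<close>, and the distance to \<open>M\<close> is
  \<^const>\<open>infdist\<close>. A set that is a manifold around \<open>p\<close> need not be closed, but points near \<open>p\<close> do
  have a unique nearest point in it.\<close>

definition grows_robustly :: "('a::euclidean_space \<Rightarrow> real) \<Rightarrow> 'a set \<Rightarrow> 'a \<Rightarrow> bool" where
  "grows_robustly f M p \<longleftrightarrow>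
     (\<exists>\<delta>>0. \<forall>\<^sub>F x in nhds p. f x - f p \<ge> \<delta> / 2 * (norm (x - p))\<^sup>2) \<and>
     (\<forall>x\<in>M. subdiff_regular f x) \<and>
     C2_restriction_around f M p \<and>
     (\<exists>K>0. \<exists>r>0. \<forall>x\<in>M \<inter> ball p r. \<forall>y\<in>ball p r.
        clarke_subdiff f y \<subseteq>
          {v + (K * norm (x - y)) *\<^sub>R b |v b. v \<in> clarke_subdiff f x \<and> b \<in> cball 0 1}) \<and>
     (\<exists>\<mu>>0. \<forall>\<^sub>F x in nhds p. \<forall>v\<in>clarke_subdiff f x.
        v \<bullet> (x - closest_point M x) \<ge> \<mu> * infdist x M)"

definition vec_angle :: "'a::real_inner \<Rightarrow> 'a \<Rightarrow> real" where
  "vec_angle u v = arccos (u \<bullet> v / (norm u * norm v))"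

definition tempered_growth :: "('a::euclidean_space \<Rightarrow> real) \<Rightarrow> 'a set \<Rightarrow> 'a \<Rightarrow> bool" where
  "tempered_growth f M p \<longleftrightarrow>
     (\<forall>\<theta>>0. \<forall>\<^sub>F \<beta> in at_right 0. \<forall>(xs :: nat \<Rightarrow> 'a) (\<epsilon> :: nat \<Rightarrow> real).
        (\<forall>r. xs r \<noteq> p) \<and> xs \<longlonglongrightarrow> p \<and>
        (\<forall>r. 0 \<le> \<epsilon> r \<and> \<epsilon> r \<le> \<beta> * norm (xs r - p)) \<and>
        (\<lambda>r. goldstein_subgrad f (\<epsilon> r) (xs r)) \<longlonglongrightarrow> 0 \<longrightarrow>
        (\<forall>\<^sub>F r in sequentially.
           goldstein_subgrad f (\<epsilon> r) (xs r) \<noteq> 0 \<and>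
           riemannian_grad M f (closest_point M (xs r)) \<noteq> 0 \<and>
           vec_angle (goldstein_subgrad f (\<epsilon> r) (xs r))
                     (riemannian_grad M f (closest_point M (xs r))) < \<theta>))"

section \<open>The Goldstein property and the subgradient iteration\<close>

definition goldstein_step :: "('a::euclidean_space \<Rightarrow> real) \<Rightarrow> real \<Rightarrow> 'a \<Rightarrow> 'a" where
  "goldstein_step f \<epsilon> x =
     x - (\<epsilon> / norm (goldstein_subgrad f \<epsilon> x)) *\<^sub>R goldstein_subgrad f \<epsilon> x"

definition proportionality_bracket ::
    "('a::euclidean_space \<Rightarrow> real) \<Rightarrow> 'a \<Rightarrow> real \<Rightarrow> real \<Rightarrow> bool" where
  "proportionality_bracket f p \<mu> \<nu> \<longleftrightarrow> 0 < \<mu> \<and> \<mu> < \<nu> \<and>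
     (\<exists>\<theta>. 0 < \<theta> \<and> \<theta> < 1 \<and>
        (\<forall>\<^sub>F x in at p. \<forall>\<epsilon>. \<mu> \<le> \<epsilon> / norm (x - p) \<and> \<epsilon> / norm (x - p) \<le> \<nu> \<longrightarrow>
           goldstein_subgrad f \<epsilon> x \<noteq> 0 \<and>
           (f (goldstein_step f \<epsilon> x) - f p \<le> \<theta> * (f x - f p) \<or>
            norm (goldstein_step f \<epsilon> x - p) \<le> \<theta> * norm (x - p))))"

definition goldstein_property :: "('a::euclidean_space \<Rightarrow> real) \<Rightarrow> 'a \<Rightarrow> bool" where
  "goldstein_property f p \<longleftrightarrow>
     locally_lipschitz f \<and> (\<exists>\<mu> \<nu>. proportionality_bracket f p \<mu> \<nu>)"

text \<open>The step size may be chosen afresh at each iteration. A run that has reached \<open>p\<close> is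
  represented by a sequence that stays there.\<close>

definition goldstein_iterates ::
    "('a::euclidean_space \<Rightarrow> real) \<Rightarrow> 'a \<Rightarrow> real \<Rightarrow> real \<Rightarrow> (nat \<Rightarrow> 'a) \<Rightarrow> bool" where
  "goldstein_iterates f p \<gamma> \<beta> xs \<longleftrightarrow>
     (\<forall>r. if xs r = p then xs (Suc r) = p
          else \<exists>\<epsilon>. \<gamma> \<le> \<epsilon> / (\<beta> * norm (xs r - p)) \<and> \<epsilon> / (\<beta> * norm (xs r - p)) \<le> 1 \<and>
                   xs (Suc r) = goldstein_step f \<epsilon> (xs r))"

definition nearly_linear_convergence :: "(nat \<Rightarrow> 'a::real_normed_vector) \<Rightarrow> 'a \<Rightarrow> bool" where
  "nearly_linear_convergence xs p \<longleftrightarrow>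
     (\<exists>a>0. \<exists>b>0. \<forall>r. norm (xs r - p) \<le> a * exp (- b * sqrt (real r)))"

end

theory Submission
  imports Defs
begin

text \<open>The Goldstein subgradient \<open>g\<close> of radius \<open>\<epsilon>\<close> at \<open>x\<close> satisfies
  \<open>f (x - \<epsilon> g / |g|) \<le> f x - \<epsilon> |g|\<close>, by the mean value theorem for the Clarke subdifferential (which,
  being built from limits of gradients, rests on Rademacher's theorem). With \<open>\<epsilon>\<close> proportional to
  \<open>|x - xbar|\<close> and \<open>f x - f xbar \<le> L |x - xbar|\<close>, this is a proportional decrease of the function gap
  as long as \<open>|g|\<close> is bounded away from \<open>0\<close>. If instead \<open>g\<close> is small, the growth of \<open>f\<close> away from
  \<open>M\<close> forces \<open>x\<close> to be much closer to \<open>M\<close> than to \<open>xbar\<close>, and tempered growth makes \<open>g\<close> almost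
  parallel to the Riemannian gradient at the nearest point \<open>y\<close> of \<open>M\<close>. That gradient is normal to
  \<open>x - y\<close> and, by quadratic growth on \<open>M\<close>, makes an angle bounded away from \<open>\<pi> / 2\<close> with \<open>y - xbar\<close>;
  hence a step along \<open>- g\<close> contracts the distance to \<open>xbar\<close>.\<close>

section \<open>Rademacher's theorem\<close>

text \<open>Two merit functions compete. The gap \<open>f x - f xbar\<close> never grows along the
  iteration, but a step that lowers it may increase the distance to \<open>xbar\<close>. The gap is
  bounded linearly by the distance, whereas quadratic growth bounds the distance only by the square
  root of the gap. Progress in one quantity therefore does not pass to the other without loss; this
  is the source of the rate in \<open>sqrt r\<close>.

  The order of choices matters. The geometry of \<open>f\<close> on \<open>M\<close> fixes the angle
  tolerance \<open>c0\<close>; tempered growth at this tolerance admits small \<beta>; the threshold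
  between large and small \<open>g\<close>, the factor \<theta> and the neighbourhood all depend on
  \<beta>.

  That a small \<open>g\<close> means nearness to \<open>M\<close> rests on the nearest-point map
  being Lipschitz near \<open>xbar\<close>. Over a ball of radius \<epsilon> the normal direction
  \<open>x - P x\<close>, with \<open>P\<close> that map, changes by at most a multiple of
  \<epsilon>, so one half-space contains all subgradients of the ball and hence their convex
  hull.\<close>

lemma lipschitz_real_increments:
  fixes g :: "real \<Rightarrow> real"
  assumes "L-lipschitz_on UNIV g" "x \<le> y"
  shows "g y - g x \<le> L * (y - x)" "g x - g y \<le> L * (y - x)"
  using lipschitz_onD[OF assms(1), of x y] assms(2) by (auto simp: dist_real_def)

text \<open>The density \<open>h\<close> is the Radon-Nikodym derivative of the image of Lebesgue measure under the
  inverse of \<open>G\<close>.\<close>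

lemma lipschitz_increasing_density:
  fixes G :: "real \<Rightarrow> real"
  assumes lip: "L-lipschitz_on UNIV G" and grow: "\<And>x y. x \<le> y \<Longrightarrow> y - x \<le> G y - G x"
  obtains h where "\<And>a b. a \<le> b \<Longrightarrow> (h has_integral (G b - G a)) {a..b}"
proof -
  have contG: "continuous_on S G" for S
    using lipschitz_on_continuous_on[OF lip] continuous_on_subset by blast
  have mono: "G x \<le> G y \<longleftrightarrow> x \<le> y" for x y
    using grow[of x y] grow[of y x] by (cases "x \<le> y") auto
  have inj: "inj G"
    by (rule injI) (metis mono order_antisym order_refl)
  have "\<exists>x. G x = y" for y
  proof -
    define r where "r = \<bar>y - G 0\<bar>"
    have "G (- r) \<le> y" "y \<le> G r"
      using grow[of "-r" 0] grow[of 0 r] by (auto simp: r_def)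
    then show ?thesis
      using IVT'[of G "-r" y r] contG[of "{-r..r}"] by (auto simp: r_def)
  qed
  then have surj: "surj G" by (metis surjI)
  define H where "H = inv G"
  have GH: "G (H y) = y" for y
    unfolding H_def by (simp add: surj surj_f_inv_f)
  have HG: "H (G x) = x" for x
    unfolding H_def by (simp add: inj)
  have "1-lipschitz_on UNIV H"
  proof (rule lipschitz_onI)
    fix x y
    show "dist (H x) (H y) \<le> 1 * dist x y"
      using grow[of "H x" "H y"] grow[of "H y" "H x"] by (cases "H x \<le> H y") (auto simp: GH dist_real_def)
  qed simp
  then have "continuous_on UNIV H"
    using lipschitz_on_continuous_on by blast
  then have Hm[measurable]: "H \<in> borel_measurable borel"
    by (rule borel_measurable_continuous_onI)
  define \<nu> where "\<nu> = distr lborel borel H"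
  have sets_nu: "sets \<nu> = sets (lborel :: real measure)"
    by (simp add: \<nu>_def)
  \<comment> \<open>The preimage of \<open>A\<close> under \<open>H\<close> is the image of
    \<open>A\<close> under the Lipschitz map \<open>G\<close>, and Lipschitz images of null sets are
    null.\<close>
  have "absolutely_continuous lborel \<nu>"
    unfolding absolutely_continuous_def
  proof
    fix A :: "real set" assume A: "A \<in> null_sets lborel"
    then have Ab: "A \<in> sets borel" by (auto simp: null_sets_def)
    have "A \<in> null_sets lebesgue"
      using A by (rule null_sets_completionI)
    then have "negligible A"
      by (simp add: negligible_iff_null_sets)
    then have "negligible (G ` A)"
    proof (rule negligible_locally_Lipschitz_image[OF order_refl])
      fix x assume "x \<in> A"
      show "\<exists>T B. open T \<and> x \<in> T \<and> (\<forall>y\<in>A \<inter> T. norm (G y - G x) \<le> B * norm (y - x))"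
        using lipschitz_onD[OF lip] by (intro exI[of _ UNIV] exI[of _ L]) (auto simp: dist_norm)
    qed
    moreover have "G ` A = H -` A"
      by (force simp: GH HG image_iff)
    ultimately have "H -` A \<in> null_sets lebesgue"
      by (simp add: negligible_iff_null_sets)
    moreover have "H -` A \<in> sets borel"
      using measurable_sets[OF Hm Ab] by simp
    ultimately have "emeasure lborel (H -` A) = 0"
      by (simp add: null_sets_def)
    then show "A \<in> null_sets \<nu>"
      using Ab by (auto simp: null_sets_def \<nu>_def emeasure_distr)
  qed
  then obtain k where k[measurable]: "k \<in> borel_measurable borel" and dk: "density lborel k = \<nu>"
    using sigma_finite_measure.Radon_Nikodym[OF sigma_finite_lborel _ sets_nu] by auto
  have intk: "(\<integral>\<^sup>+x. k x * indicator {a..b} x \<partial>lborel) = ennreal (G b - G a)" if "a \<le> b" for a b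
  proof -
    have "H -` {a..b} = {G a..G b}"
    proof (rule set_eqI)
      fix y show "y \<in> H -` {a..b} \<longleftrightarrow> y \<in> {G a..G b}"
        using mono[of a "H y"] mono[of "H y" b] by (simp add: GH)
    qed
    then have "emeasure \<nu> {a..b} = ennreal (G b - G a)"
      using mono[of a b] that by (simp add: \<nu>_def emeasure_distr)
    then show ?thesis
      by (simp add: dk[symmetric] emeasure_density)
  qed
  \<comment> \<open>\<open>k\<close> takes extended real values. Its integral over every bounded
    interval is finite, so it is finite almost everywhere and \<open>enn2real\<close> loses
    nothing.\<close>
  have "AE x in lborel. k x * indicator {-real n..real n} x \<noteq> \<infinity>" for n
    by (rule nn_integral_noteq_infinite) (auto simp: intk)
  then have "AE x in lborel. \<forall>n. k x * indicator {-real n..real n} x \<noteq> \<infinity>"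
    by (simp add: AE_all_countable)
  then have fin: "AE x in lborel. k x \<noteq> \<infinity>"
  proof eventually_elim
    case (elim x)
    obtain n where "\<bar>x\<bar> \<le> real n" using real_arch_simple by blast
    then show ?case using elim[rule_format, of n] by (auto simp: indicator_def abs_le_iff)
  qed
  define h where "h = (\<lambda>x. enn2real (k x))"
  have hm[measurable]: "h \<in> borel_measurable borel"
    unfolding h_def by measurable
  have "(h has_integral (G b - G a)) {a..b}" if "a \<le> b" for a b
  proof -
    let ?f = "\<lambda>x. indicator {a..b} x * h x"
    have "(\<integral>\<^sup>+x. ennreal (?f x) \<partial>lborel) = (\<integral>\<^sup>+x. k x * indicator {a..b} x \<partial>lborel)"
    proof (rule nn_integral_cong_AE, use fin in eventually_elim)
      case (elim x)
      then show ?case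
        by (auto simp: indicator_def h_def less_top[symmetric])
    qed
    also have "\<dots> = ennreal (G b - G a)" using intk that by simp
    finally have "(?f has_integral (G b - G a)) UNIV"
      using grow[OF that] that by (intro nn_integral_has_integral) (auto simp: h_def)
    then show ?thesis
      by (subst has_integral_restrict_UNIV[symmetric])
         (auto simp: indicator_def of_bool_def if_distrib if_distribR mult.commute cong: if_cong)
  qed
  then show ?thesis using that by blast
qed

text \<open>A steep linear term makes \<open>g\<close> increasing; the density of the sum, less the
  slope of that term, represents \<open>g\<close> as an integral. Lebesgue differentiation then
  turns the integrand into the derivative off a null set.\<close>

lemma lipschitz_real_derivative_integral:
  fixes g :: "real \<Rightarrow> real"
  assumes lip: "L-lipschitz_on UNIV g"
  obtains h N where "negligible N" "\<And>x. x \<notin> N \<Longrightarrow> (g has_real_derivative h x) (at x)"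
    "\<And>a b. a \<le> b \<Longrightarrow> (h has_integral (g b - g a)) {a..b}"
proof -
  \<comment> \<open>\<open>L\<close> offsets the steepest possible descent of \<open>g\<close>; the
    extra 1 makes \<open>G\<close> expanding, as the density lemma requires.\<close>
  define G where "G = (\<lambda>x. g x + (L + 1) * x)"
  have L0: "L \<ge> 0" using lip by (rule lipschitz_on_nonneg)
  have "(L + \<bar>L + 1\<bar> * 1)-lipschitz_on UNIV G"
    unfolding G_def by (intro lipschitz_on_add lip lipschitz_on_cmult_real lipschitz_on_id)
  moreover have "y - x \<le> G y - G x" if "x \<le> y" for x y
    using lipschitz_real_increments[OF lip that] by (simp add: G_def algebra_simps)
  ultimately obtain h0 where h0: "\<And>a b. a \<le> b \<Longrightarrow> (h0 has_integral (G b - G a)) {a..b}"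
    using lipschitz_increasing_density by blast
  define h where "h = (\<lambda>x. h0 x - (L + 1))"
  have h: "(h has_integral (g b - g a)) {a..b}" if "a \<le> b" for a b
    using has_integral_diff[OF h0[OF that] has_integral_const_real[of "L+1" a b]] that
    by (simp add: h_def G_def algebra_simps)
  have int1: "h integrable_on cbox a b" for a b
    using h[of a b] by (cases "a \<le> b") (auto simp: integrable_on_def)
  \<comment> \<open>The differentiation theorem averages over \<open>[x, x + t]\<close> only.
    Applied to the reflected integrand at \<open>- x\<close>, it controls the increments to the left
    of \<open>x\<close>.\<close>
  have int2: "(\<lambda>x. h (- x)) integrable_on cbox a b" for a b
    using int1[of "-b" "-a"] integrable_reflect[of h "-a" "-b"] by simp
  obtain N1 where N1: "negligible N1" "\<And>x e. x \<notin> N1 \<Longrightarrow> 0 < e \<Longrightarrow>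
       \<exists>d>0. \<forall>t. 0 < t \<and> t < d \<longrightarrow> norm (integral (cbox x (x + t *\<^sub>R One)) h /\<^sub>R t ^ DIM(real) - h x) < e"
    using integrable_ccontinuous_explicit[of h, OF int1] by blast
  obtain N2 where N2: "negligible N2" "\<And>x e. x \<notin> N2 \<Longrightarrow> 0 < e \<Longrightarrow>
       \<exists>d>0. \<forall>t. 0 < t \<and> t < d \<longrightarrow>
         norm (integral (cbox x (x + t *\<^sub>R One)) (\<lambda>x. h (- x)) /\<^sub>R t ^ DIM(real) - h (- x)) < e"
    using integrable_ccontinuous_explicit[of "\<lambda>x. h (- x)", OF int2] by blast
  define N where "N = N1 \<union> uminus ` N2"
  have "negligible (uminus ` N2)"
    using N2(1) by (intro negligible_differentiable_image_negligible) (auto simp: differentiable_on_def)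
  then have "negligible N" using N1(1) by (simp add: N_def)
  moreover have "(g has_real_derivative h x) (at x)" if "x \<notin> N" for x
  proof -
    have x1: "x \<notin> N1" and x2: "- x \<notin> N2" using that by (force simp: N_def)+
    have i1: "integral (cbox x (x + t *\<^sub>R One)) h = g (x + t) - g x" if "t > 0" for t
      using h[of x "x+t"] that by (auto simp: integral_unique)
    have i2: "integral (cbox (-x) (-x + t *\<^sub>R One)) (\<lambda>x. h (- x)) = g x - g (x - t)" if "t > 0" for t
    proof -
      have "integral {-x..-(x-t)} (\<lambda>s. h (- s)) = integral {x-t..x} h"
        by (rule Henstock_Kurzweil_Integration.integral_reflect_real)
      also have "\<dots> = g x - g (x - t)"
        using h[of "x-t" x] that by (auto simp: integral_unique)
      finally show ?thesis by (simp add: algebra_simps)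
    qed
    show ?thesis
      unfolding DERIV_def LIM_eq
    proof (intro allI impI)
      fix e :: real assume e: "0 < e"
      obtain d1 where d1: "d1 > 0" "\<And>t. 0 < t \<Longrightarrow> t < d1 \<Longrightarrow> \<bar>(g (x + t) - g x) / t - h x\<bar> < e"
        using N1(2)[OF x1 e] i1 by (auto simp: divide_inverse mult.commute)
      obtain d2 where d2: "d2 > 0" "\<And>t. 0 < t \<Longrightarrow> t < d2 \<Longrightarrow> \<bar>(g x - g (x - t)) / t - h x\<bar> < e"
        using N2(2)[OF x2 e] i2 by (auto simp: divide_inverse mult.commute)
      have "norm ((g (x + t) - g x) / t - h x) < e" if "t \<noteq> 0" "norm (t - 0) < min d1 d2" for t
      proof (cases "t > 0")
        case False
        have "(g (x + t) - g x) / t = (g x - g (x - (- t))) / (- t)"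
          using that by (simp add: field_simps)
        then show ?thesis using False that d2(2)[of "-t"] by auto
      qed (use that d1 in auto)
      then show "\<exists>s>0. \<forall>t. t \<noteq> 0 \<and> norm (t - 0) < s \<longrightarrow> norm ((g (x + t) - g x) / t - h x) < e"
        using d1 d2 by (intro exI[of _ "min d1 d2"]) auto
    qed
  qed
  ultimately show ?thesis using h that by blast
qed

section \<open>Null sets and parallel lines\<close>

lemma negligible_imp_AE_lborel:
  assumes "negligible N"
  shows "AE x in lborel. x \<notin> N"
proof -
  have "AE x in lebesgue. x \<notin> N"
    using assms by (auto simp: eventually_ae_filter_negligible)
  then show ?thesis by (simp add: AE_completion_iff)
qed

lemma AE_lborel_translate:
  fixes a :: "'a::euclidean_space"
  assumes "AE x in lborel. P x"
  shows "AE x in lborel. P (x + a)"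
proof -
  obtain N where N: "N \<in> null_sets lborel" "{x. \<not> P x} \<subseteq> N"
    using assms by (auto simp: eventually_ae_filter)
  have "{x. x - (- a) \<in> N} \<in> null_sets lborel"
    using N(1) by (rule null_sets_translation)
  moreover have "{x. \<not> P (x + a)} \<subseteq> {x. x - (- a) \<in> N}"
    using N(2) by auto
  ultimately show ?thesis
    unfolding eventually_ae_filter by auto
qed

lemma AE_lborel_lines_iff:
  fixes v :: "'a::euclidean_space"
  assumes [measurable]: "N \<in> sets borel"
  shows "(AE x in lborel. AE t in lborel. x + t *\<^sub>R v \<notin> N) \<longleftrightarrow> (AE t in lborel. AE x in lborel. x + t *\<^sub>R v \<notin> N)"
  by (rule lborel_pair.AE_commute[of "\<lambda>x t. x + t *\<^sub>R v \<notin> N"]) measurable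

text \<open>A Borel null set containing the exceptions has null translates, so for every
  \<open>t\<close> almost every \<open>x\<close> is good; Fubini exchanges the quantifiers.\<close>

lemma AE_lborel_imp_AE_lines:
  fixes v :: "'a::euclidean_space"
  assumes "AE x in lborel. P x"
  shows "AE x in lborel. AE t in lborel. P (x + t *\<^sub>R v)"
proof -
  obtain N where N: "N \<in> null_sets lborel" "{x. \<not> P x} \<subseteq> N"
    using assms by (auto simp: eventually_ae_filter)
  have "AE x in lborel. x \<notin> N" using N(1) by (rule AE_not_in)
  then have "AE t in lborel. AE x in lborel. x + t *\<^sub>R v \<notin> N"
    by (auto intro!: AE_I2 AE_lborel_translate[where P = "\<lambda>x. x \<notin> N"])
  then have "AE x in lborel. AE t in lborel. x + t *\<^sub>R v \<notin> N"
    using N(1) by (subst AE_lborel_lines_iff) (auto simp: null_sets_def)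
  then show ?thesis
    by eventually_elim (use N(2) in \<open>auto elim!: eventually_mono\<close>)
qed

text \<open>The hypothesis concerns each line separately and supplies no null superset, so Fubini is
  applied to the set itself, which must be Borel. After the exchange one good \<open>t\<close> is
  enough: a translation removes it.\<close>

lemma AE_lines_imp_AE_lborel:
  fixes v :: "'a::euclidean_space"
  assumes P: "{x. P x} \<in> sets borel" and "\<And>x. AE t in lborel. P (x + t *\<^sub>R v)"
  shows "AE x in lborel. P x"
proof -
  have "- {x. P x} \<in> sets borel" using P by (simp add: borel_comp)
  then have "AE t in lborel. AE x in lborel. x + t *\<^sub>R v \<notin> - {x. P x}"
    using assms(2) by (subst AE_lborel_lines_iff[symmetric]) auto
  then have AE: "AE t in lborel. AE x in lborel. P (x + t *\<^sub>R v)" by simp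
  have "\<exists>t. AE x in lborel. P (x + t *\<^sub>R v)"
  proof (rule ccontr)
    assume "\<nexists>t. AE x in lborel. P (x + t *\<^sub>R v)"
    then have "AE t::real in lborel. False" using AE by simp
    then show False
      by (simp add: AE_iff_measurable[OF _ refl] emeasure_lborel_UNIV)
  qed
  then obtain t where "AE x in lborel. P (x + t *\<^sub>R v)" ..
  from AE_lborel_translate[OF this, of "- (t *\<^sub>R v)"] show ?thesis by simp
qed

section \<open>Differentiability almost everywhere in one direction\<close>

lemma has_real_derivative_line_shift:
  fixes f :: "'a::real_vector \<Rightarrow> real"
  shows "((\<lambda>s. f (x + t *\<^sub>R v + s *\<^sub>R v)) has_real_derivative d) (at 0) \<longleftrightarrow>
   ((\<lambda>s. f (x + s *\<^sub>R v)) has_real_derivative d) (at t)"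
  using DERIV_shift[of "\<lambda>s. f (x + s *\<^sub>R v)" d 0 t]
  by (simp add: scaleR_add_left add.assoc add.left_commute add.commute[of "_ *\<^sub>R v" "t *\<^sub>R v"])

text \<open>A Cauchy criterion avoids naming the derivative. Its outer quantifiers range over
  natural numbers and its inequality is not strict, the form from which measurability of the set of
  differentiability points can be read off.\<close>

lemma exists_real_derivative_iff_Cauchy:
  fixes g :: "real \<Rightarrow> real"
  shows "(\<exists>d. (g has_real_derivative d) (at 0)) \<longleftrightarrow>
    (\<forall>n. \<exists>m. \<forall>s t. 0 < \<bar>s\<bar> \<and> \<bar>s\<bar> < 1 / Suc m \<and> 0 < \<bar>t\<bar> \<and> \<bar>t\<bar> < 1 / Suc m \<longrightarrow>
       \<bar>(g s - g 0) / s - (g t - g 0) / t\<bar> \<le> 1 / Suc n)" (is "?L \<longleftrightarrow> ?R")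
proof
  define q where "q = (\<lambda>t. (g t - g 0) / t)"
  have abs_close: "\<bar>a - b\<bar> \<le> c" if "\<bar>a - d\<bar> < c / 2" "\<bar>b - d\<bar> < c / 2" for a b c d :: real
    using that by linarith
  assume ?L
  then obtain d where d: "q \<midarrow>0\<rightarrow> d" by (auto simp: DERIV_def q_def)
  show ?R
  proof
    fix n
    obtain \<delta> where \<delta>: "\<delta> > 0" "\<And>t. t \<noteq> 0 \<Longrightarrow> \<bar>t\<bar> < \<delta> \<Longrightarrow> \<bar>q t - d\<bar> < 1 / Suc n / 2"
      using LIM_D[OF d, of "1 / Suc n / 2"] by auto
    obtain m where m: "1 / Suc m < \<delta>" by (rule nat_approx_posE[OF \<delta>(1)])
    show "\<exists>m. \<forall>s t. 0 < \<bar>s\<bar> \<and> \<bar>s\<bar> < 1 / Suc m \<and> 0 < \<bar>t\<bar> \<and> \<bar>t\<bar> < 1 / Suc m \<longrightarrow>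
       \<bar>(g s - g 0) / s - (g t - g 0) / t\<bar> \<le> 1 / Suc n"
    proof (intro exI allI impI)
      fix s t assume "0 < \<bar>s\<bar> \<and> \<bar>s\<bar> < 1 / Suc m \<and> 0 < \<bar>t\<bar> \<and> \<bar>t\<bar> < 1 / Suc m"
      then have "\<bar>q s - d\<bar> < 1 / Suc n / 2" "\<bar>q t - d\<bar> < 1 / Suc n / 2"
        using m \<delta>(2)[of s] \<delta>(2)[of t] by auto
      then have "\<bar>q s - q t\<bar> \<le> 1 / Suc n"
        using abs_close[of "q s" d "1 / Suc n" "q t"] by auto
      then show "\<bar>(g s - g 0) / s - (g t - g 0) / t\<bar> \<le> 1 / Suc n"
        by (simp add: q_def)
    qed
  qed
next
  define q where "q = (\<lambda>t. (g t - g 0) / t)"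
  assume R: ?R
  define u where "u k = 1 / real (Suc k)" for k
  have C: "\<exists>m. \<forall>s t. 0 < \<bar>s\<bar> \<and> \<bar>s\<bar> < 1 / Suc m \<and> 0 < \<bar>t\<bar> \<and> \<bar>t\<bar> < 1 / Suc m \<longrightarrow> \<bar>q s - q t\<bar> < e"
    if "e > 0" for e
  proof -
    obtain n where "1 / Suc n < e" by (rule nat_approx_posE[OF \<open>e > 0\<close>])
    moreover obtain m where "\<And>s t. 0 < \<bar>s\<bar> \<and> \<bar>s\<bar> < 1 / Suc m \<and> 0 < \<bar>t\<bar> \<and> \<bar>t\<bar> < 1 / Suc m \<Longrightarrow> \<bar>q s - q t\<bar> \<le> 1 / Suc n"
      using R[rule_format, of n] unfolding q_def by blast
    ultimately show ?thesis
      by (intro exI[of _ m] allI impI) (rule order_le_less_trans)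
  qed
  have usm: "\<bar>u k\<bar> < 1 / Suc m" "0 < \<bar>u k\<bar>" if "k \<ge> Suc m" for k m
    using that by (auto simp: u_def divide_simps)
  have "Cauchy (\<lambda>k. q (u k))"
  proof (rule metric_CauchyI)
    fix e :: real assume "e > 0"
    then obtain m where "\<And>s t. 0 < \<bar>s\<bar> \<and> \<bar>s\<bar> < 1 / Suc m \<and> 0 < \<bar>t\<bar> \<and> \<bar>t\<bar> < 1 / Suc m \<Longrightarrow> \<bar>q s - q t\<bar> < e"
      using C[of e] by auto
    then show "\<exists>M. \<forall>m\<ge>M. \<forall>n\<ge>M. dist (q (u m)) (q (u n)) < e"
      using usm by (intro exI[of _ "Suc m"] allI impI) (simp add: dist_real_def)
  qed
  then obtain d where d: "(\<lambda>k. q (u k)) \<longlonglongrightarrow> d"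
    using real_Cauchy_convergent convergent_def by blast
  have "q \<midarrow>0\<rightarrow> d"
  proof (rule LIM_I)
    fix e :: real assume "e > 0"
    then obtain m where m: "\<And>s t. 0 < \<bar>s\<bar> \<and> \<bar>s\<bar> < 1 / Suc m \<and> 0 < \<bar>t\<bar> \<and> \<bar>t\<bar> < 1 / Suc m \<Longrightarrow> \<bar>q s - q t\<bar> < e / 2"
      using C[of "e/2"] by auto
    have "\<bar>q s - d\<bar> < e" if "s \<noteq> 0" "\<bar>s\<bar> < 1 / Suc m" for s
    proof -
      have "eventually (\<lambda>k. \<bar>q s - q (u k)\<bar> \<le> e / 2) sequentially"
        using eventually_ge_at_top[of "Suc m"]
        by eventually_elim (use m usm that in \<open>auto intro!: less_imp_le\<close>)
      moreover have "(\<lambda>k. \<bar>q s - q (u k)\<bar>) \<longlonglongrightarrow> \<bar>q s - d\<bar>"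
        by (intro tendsto_intros d)
      ultimately have "\<bar>q s - d\<bar> \<le> e / 2"
        by (intro tendsto_upperbound[OF _ _ sequentially_bot])
      then show ?thesis using \<open>e > 0\<close> by linarith
    qed
    then show "\<exists>s>0. \<forall>x. x \<noteq> 0 \<and> norm (x - 0) < s \<longrightarrow> norm (q x - d) < e"
      by (intro exI[of _ "1 / Suc m"]) auto
  qed
  then show ?L by (auto simp: DERIV_def q_def)
qed

lemma borel_directionally_differentiable:
  fixes f :: "'a::euclidean_space \<Rightarrow> real"
  assumes "continuous_on UNIV f"
  shows "{x. \<exists>d. ((\<lambda>t. f (x + t *\<^sub>R v)) has_real_derivative d) (at 0)} \<in> sets borel"
proof -
  define C where "C n m s t = {x. \<bar>(f (x + s *\<^sub>R v) - f x) / s - (f (x + t *\<^sub>R v) - f x) / t\<bar> \<le> 1 / real (Suc n)}"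
    for n m :: nat and s t :: real
  define I where "I m = {(s,t). 0 < \<bar>s\<bar> \<and> \<bar>s\<bar> < 1 / Suc m \<and> 0 < \<bar>t\<bar> \<and> \<bar>t\<bar> < 1 / real (Suc m)}" for m
  have cf: "continuous_on UNIV (\<lambda>x. f (x + a))" for a
    by (rule continuous_on_compose2[OF assms]) (auto intro!: continuous_intros)
  have "closed (C n m s t)" for n m s t
    unfolding C_def divide_inverse
    by (intro closed_Collect_le continuous_intros cf assms)
  \<comment> \<open>The pairs \<open>(s,t)\<close> are uncountably many, but closed sets survive any
    intersection; only the operations over \<open>n\<close> and \<open>m\<close> have to be
    countable.\<close>
  then have "closed (\<Inter>(s,t)\<in>I m. C n m s t)" for n m
    by (intro closed_INT) auto
  then have "(\<Inter>n. \<Union>m. \<Inter>(s,t)\<in>I m. C n m s t) \<in> sets borel"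
    by (intro sets.countable_INT sets.countable_UN) (auto intro: borel_closed)
  also have "(\<Inter>n. \<Union>m. \<Inter>(s,t)\<in>I m. C n m s t) = {x. \<exists>d. ((\<lambda>t. f (x + t *\<^sub>R v)) has_real_derivative d) (at 0)}"
    unfolding exists_real_derivative_iff_Cauchy C_def I_def by auto
  finally show ?thesis .
qed

lemma lipschitz_on_line:
  fixes f :: "'a::real_normed_vector \<Rightarrow> real"
  assumes "L-lipschitz_on UNIV f"
  shows "(L * norm v)-lipschitz_on UNIV (\<lambda>t. f (x + t *\<^sub>R v))"
proof (rule lipschitz_onI)
  fix s t
  have "dist (f (x + s *\<^sub>R v)) (f (x + t *\<^sub>R v)) \<le> L * norm ((s - t) *\<^sub>R v)"
    using lipschitz_onD[OF assms, of "x + s *\<^sub>R v" "x + t *\<^sub>R v"] by (simp add: dist_norm scaleR_diff_left)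
  then show "dist (f (x + s *\<^sub>R v)) (f (x + t *\<^sub>R v)) \<le> L * norm v * dist s t"
    by (simp add: dist_real_def mult.assoc mult.left_commute mult.commute)
qed (use lipschitz_on_nonneg[OF assms] in simp)

lemma AE_directionally_differentiable:
  fixes f :: "'a::euclidean_space \<Rightarrow> real"
  assumes lip: "L-lipschitz_on UNIV f"
  shows "AE x in lborel. \<exists>d. ((\<lambda>t. f (x + t *\<^sub>R v)) has_real_derivative d) (at 0)"
proof (rule AE_lines_imp_AE_lborel[where v = v])
  show "{x. \<exists>d. ((\<lambda>t. f (x + t *\<^sub>R v)) has_real_derivative d) (at 0)} \<in> sets borel"
    using lip by (intro borel_directionally_differentiable lipschitz_on_continuous_on)
  fix x
  obtain N h where N: "negligible N"
    and h: "\<And>t. t \<notin> N \<Longrightarrow> ((\<lambda>t. f (x + t *\<^sub>R v)) has_real_derivative h t) (at t)"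
    by (rule lipschitz_real_derivative_integral[OF lipschitz_on_line[OF lip, of v x]]) (rule that, assumption+)
  from N have "AE t in lborel. t \<notin> N" by (intro negligible_imp_AE_lborel)
  then show "AE t in lborel. \<exists>d. ((\<lambda>s. f (x + t *\<^sub>R v + s *\<^sub>R v)) has_real_derivative d) (at 0)"
    by eventually_elim (use h in \<open>auto simp: has_real_derivative_line_shift\<close>)
qed

section \<open>Additivity of directional derivatives\<close>

lemma lborel_integral_translate:
  fixes g :: "'a::euclidean_space \<Rightarrow> real"
  assumes "g \<in> borel_measurable borel"
  shows "(\<integral>x. g (x + a) \<partial>lborel) = (\<integral>x. g x \<partial>lborel)"
proof -
  have "(\<integral>x. g x \<partial>lborel) = (\<integral>x. g x \<partial>distr lborel borel ((+) a))"
    by (simp only: lborel_distr_plus)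
  also have "\<dots> = (\<integral>x. g (a + x) \<partial>lborel)"
    using assms by (intro integral_distr) auto
  finally show ?thesis by (simp add: add.commute)
qed

definition diff_quot :: "('a::real_normed_vector \<Rightarrow> real) \<Rightarrow> 'a \<Rightarrow> nat \<Rightarrow> 'a \<Rightarrow> real" where
  "diff_quot f v n x = (f (x + (1 / real (Suc n)) *\<^sub>R v) - f x) * real (Suc n)"

text \<open>The limit runs along the steps \<open>1 / Suc n\<close> so that the function is Borel
  measurable on the whole space. Where the two-sided derivative exists the two agree.\<close>

definition dir_deriv :: "('a::real_normed_vector \<Rightarrow> real) \<Rightarrow> 'a \<Rightarrow> 'a \<Rightarrow> real" where
  "dir_deriv f v x = lim (\<lambda>n. diff_quot f v n x)"

lemma diff_quot_tendsto:
  assumes "((\<lambda>t. f (x + t *\<^sub>R v)) has_real_derivative d) (at 0)"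
  shows "(\<lambda>n. diff_quot f v n x) \<longlonglongrightarrow> d"
proof -
  have "(\<lambda>t. (f (x + t *\<^sub>R v) - f x) / t) \<midarrow>0\<rightarrow> d"
    using assms by (simp add: DERIV_def)
  moreover have "filterlim (\<lambda>n. 1 / real (Suc n)) (at 0) sequentially"
    using LIMSEQ_inverse_real_of_nat unfolding filterlim_at by (auto simp: divide_inverse)
  ultimately have "(\<lambda>n. (f (x + (1 / real (Suc n)) *\<^sub>R v) - f x) / (1 / real (Suc n))) \<longlonglongrightarrow> d"
    by (rule filterlim_compose)
  then show ?thesis by (simp add: diff_quot_def divide_inverse)
qed

lemma dir_deriv_eq:
  assumes "((\<lambda>t. f (x + t *\<^sub>R v)) has_real_derivative d) (at 0)"
  shows "dir_deriv f v x = d"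
  unfolding dir_deriv_def by (rule limI[OF diff_quot_tendsto[OF assms]])

lemma has_dir_deriv_scaleR:
  fixes f :: "'a::real_vector \<Rightarrow> real"
  assumes "((\<lambda>t. f (x + t *\<^sub>R v)) has_real_derivative d) (at 0)"
  shows "((\<lambda>t. f (x + t *\<^sub>R (c *\<^sub>R v))) has_real_derivative c * d) (at 0)"
proof -
  have "((\<lambda>t. f (x + (t * c) *\<^sub>R v)) has_real_derivative d * c) (at 0)"
    by (rule DERIV_chain2[where f = "\<lambda>t. f (x + t *\<^sub>R v)" and g = "\<lambda>t. t * c"])
       (use assms in \<open>auto intro!: derivative_eq_intros\<close>)
  then show ?thesis by (simp add: mult.commute[of d])
qed

lemma diff_quot_bound:
  assumes "L-lipschitz_on UNIV f"
  shows "\<bar>diff_quot f v n x\<bar> \<le> L * norm v"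
proof -
  have "\<bar>f (x + (1 / real (Suc n)) *\<^sub>R v) - f x\<bar> \<le> L * (norm v / real (Suc n))"
    using lipschitz_onD[OF assms, of "x + (1 / real (Suc n)) *\<^sub>R v" x] by (simp add: dist_norm)
  then have "\<bar>f (x + (1 / real (Suc n)) *\<^sub>R v) - f x\<bar> * real (Suc n) \<le> L * norm v"
    by (simp only: times_divide_eq_right pos_le_divide_eq of_nat_0_less_iff zero_less_Suc)
  then show ?thesis
    by (simp only: diff_quot_def abs_mult abs_of_nat)
qed

lemma borel_measurable_diff_quot[measurable]:
  fixes f :: "'a::euclidean_space \<Rightarrow> real"
  assumes [measurable]: "f \<in> borel_measurable borel"
  shows "diff_quot f v n \<in> borel_measurable borel"
  unfolding diff_quot_def by measurable

lemma borel_measurable_dir_deriv[measurable]: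
  fixes f :: "'a::euclidean_space \<Rightarrow> real"
  assumes [measurable]: "f \<in> borel_measurable borel"
  shows "dir_deriv f v \<in> borel_measurable borel"
  unfolding dir_deriv_def by measurable

text \<open>By Lebesgue differentiation \<open>D x\<close> is, for almost every \<open>x\<close>,
  the limit of averages over shrinking cubes, and all these averages are 0.\<close>

lemma AE_eq_0_if_cbox_integrals_0:
  fixes D :: "'a::euclidean_space \<Rightarrow> real"
  assumes "\<And>a b. (D has_integral 0) (cbox a b)"
  shows "AE x in lborel. D x = 0"
proof -
  obtain N where N: "negligible N" "\<And>x e. x \<notin> N \<Longrightarrow> 0 < e \<Longrightarrow>
       \<exists>d>0. \<forall>h. 0 < h \<and> h < d \<longrightarrow>
         norm (integral (cbox x (x + h *\<^sub>R One)) D /\<^sub>R h ^ DIM('a) - D x) < e"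
    by (rule integrable_ccontinuous_explicit[OF has_integral_integrable[OF assms]]) (rule that, assumption+)
  have "D x = 0" if x: "x \<notin> N" for x
  proof (rule ccontr)
    assume "D x \<noteq> 0"
    then obtain d where d: "d > 0" "\<And>h. 0 < h \<and> h < d \<Longrightarrow>
        norm (integral (cbox x (x + h *\<^sub>R One)) D /\<^sub>R h ^ DIM('a) - D x) < \<bar>D x\<bar>"
      using N(2)[OF x, of "\<bar>D x\<bar>"] by auto
    from d(2)[of "d/2"] d(1) show False
      by (simp add: integral_unique[OF assms])
  qed
  with negligible_imp_AE_lborel[OF N(1)] show ?thesis
    by (auto elim: eventually_mono)
qed

text \<open>Off the frontier \<open>indicator C\<close> is locally constant, so the difference is
  eventually 0. For a box the frontier is null, which covers almost every point.\<close>

lemma tendsto_indicator_translate: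
  fixes s :: "nat \<Rightarrow> 'a::euclidean_space"
  assumes "s \<longlonglongrightarrow> 0" "x \<notin> frontier C"
  shows "(\<lambda>n. indicator C (x - s n) - indicator C x :: real) \<longlonglongrightarrow> 0"
proof -
  have lim: "(\<lambda>n. x - s n) \<longlonglongrightarrow> x"
    using tendsto_diff[OF tendsto_const assms(1), of x] by simp
  have "x \<in> interior C \<or> x \<in> interior (- C)"
    using assms(2) by (auto simp: frontier_def interior_complement)
  then have "eventually (\<lambda>n. x - s n \<in> interior C) sequentially \<and> x \<in> C \<or>
      eventually (\<lambda>n. x - s n \<in> interior (- C)) sequentially \<and> x \<notin> C"
    using topological_tendstoD[OF lim] interior_subset by (metis ComplD open_interior subsetD)
  then have "eventually (\<lambda>n. indicator C (x - s n) - indicator C x = (0::real)) sequentially"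
    using interior_subset by (auto elim!: eventually_mono simp: indicator_def)
  then show ?thesis by (rule tendsto_eventually)
qed

lemma integrable_bounded_support:
  fixes g :: "'a::euclidean_space \<Rightarrow> real"
  assumes "g \<in> borel_measurable borel" "\<And>x. \<bar>g x\<bar> \<le> B * indicator (cball 0 R) x"
  shows "integrable lborel g"
proof (rule Bochner_Integration.integrable_bound)
  show "integrable lborel (\<lambda>x::'a. B * indicator (cball 0 R) x :: real)"
    using emeasure_bounded_finite[OF bounded_cball[of "0::'a" R]]
    by (intro integrable_mult_right integrable_real_indicator) auto
  show "AE x in lborel. norm (g (x::'a)) \<le> norm (B * indicator (cball 0 R) x :: real)"
    using assms(2) by (intro AE_I2) (metis abs_ge_self order_trans real_norm_def)
qed (use assms in simp)

text \<open>On a box \<open>C\<close>, the integral of the difference quotient of \<open>f\<close> in direction \<open>w\<close> and its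
  translate along \<open>v / n\<close> differ by at most a constant times the measure of the symmetric difference
  of \<open>C\<close> and its translate, which tends to \<open>0\<close>.\<close>

lemma AE_dir_deriv_add:
  fixes f :: "'a::euclidean_space \<Rightarrow> real"
  assumes lip: "L-lipschitz_on UNIV f"
  shows "AE x in lborel. dir_deriv f (v + w) x = dir_deriv f v x + dir_deriv f w x"
proof -
  have fm[measurable]: "f \<in> borel_measurable borel"
    by (intro borel_measurable_continuous_onI lipschitz_on_continuous_on[OF lip])
  have L0: "L \<ge> 0" using lip by (rule lipschitz_on_nonneg)
  define D where "D = (\<lambda>x. dir_deriv f (v + w) x - dir_deriv f v x - dir_deriv f w x)"
  define A where "A = (\<lambda>n x. diff_quot f (v + w) n x - diff_quot f v n x - diff_quot f w n x)"
  define s where "s = (\<lambda>n. (1 / real (Suc n)) *\<^sub>R v)"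
  define B where "B = L * norm (v + w) + L * norm v + L * norm w"
  have [measurable]: "D \<in> borel_measurable borel" "A n \<in> borel_measurable borel" for n
    unfolding D_def A_def by measurable
  have s0: "s \<longlonglongrightarrow> 0"
    using tendsto_scaleR[OF LIMSEQ_inverse_real_of_nat tendsto_const[of v]] by (simp add: s_def divide_inverse)
  have s_le: "norm (s n) \<le> norm v" for n
    by (simp add: s_def divide_simps mult_left_mono[of 1 "1 + real n" "norm v", simplified])
  \<comment> \<open>The quotients in directions \<open>v + w\<close> and \<open>v\<close> both start
    from \<open>f x\<close>; their difference is the quotient in direction \<open>w\<close> taken at
    \<open>x + s n\<close>.\<close>
  have A_shift: "A n x = diff_quot f w n (x + s n) - diff_quot f w n x" for n x
    by (simp add: A_def diff_quot_def s_def algebra_simps)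
  have A_bound: "\<bar>A n x\<bar> \<le> B" for n x
    using diff_quot_bound[OF lip, of "v+w" n x] diff_quot_bound[OF lip, of v n x] diff_quot_bound[OF lip, of w n x]
    unfolding A_def B_def by linarith
  have A_lim: "AE x in lborel. (\<lambda>n. A n x) \<longlonglongrightarrow> D x"
    using AE_directionally_differentiable[OF lip, of "v+w"] AE_directionally_differentiable[OF lip, of v]
      AE_directionally_differentiable[OF lip, of w]
    unfolding A_def D_def
    by eventually_elim (auto intro!: tendsto_diff simp: dir_deriv_eq diff_quot_tendsto)
  have D_bound: "AE x in lborel. \<bar>D x\<bar> \<le> B"
    using A_lim
  proof eventually_elim
    case (elim x)
    then have "(\<lambda>n. \<bar>A n x\<bar>) \<longlonglongrightarrow> \<bar>D x\<bar>" by (rule tendsto_rabs)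
    then show ?case
      by (rule tendsto_upperbound) (simp_all add: A_bound)
  qed
  have "(D has_integral 0) (cbox a b)" for a b
  proof -
    define C where "C = cbox a b"
    have [measurable]: "C \<in> sets borel" by (simp add: C_def)
    obtain R where R: "C \<subseteq> cball 0 R"
      using bounded_cbox[of a b] that unfolding bounded_iff C_def
      by (metis mem_cball_0 subsetI)
    \<comment> \<open>Radius of a ball that holds \<open>C\<close> and its translates by all
      \<open>s n\<close>, for one dominating function.\<close>
    define M where "M = R + norm v"
    have supp: "indicator C x \<le> (indicator (cball 0 M) x :: real)"
      "indicator C (x - s n) \<le> (indicator (cball 0 M) x :: real)" for x n
    proof -
      have "norm x \<le> M" if "x \<in> C"
      proof -
        have "norm x \<le> R" using R that by auto
        then show ?thesis using norm_ge_zero[of v] unfolding M_def by linarith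
      qed
      moreover have "norm x \<le> M" if "x - s n \<in> C"
      proof -
        have "norm (x - s n) \<le> R" using R that by auto
        then show ?thesis
          using s_le[of n] norm_triangle_ineq[of "x - s n" "s n"] by (simp add: M_def)
      qed
      ultimately show "indicator C x \<le> (indicator (cball 0 M) x :: real)"
        "indicator C (x - s n) \<le> (indicator (cball 0 M) x :: real)"
        by (auto simp: indicator_def)
    qed
    have B0: "B \<ge> 0" using L0 by (simp add: B_def)
    define E where "E = (\<lambda>n x. (indicator C (x - s n) - indicator C x) * diff_quot f w n x)"
    have intB: "integrable lborel (\<lambda>x::'a. c * indicator (cball 0 M) x :: real)" for c
      by (intro integrable_bounded_support[where B = "\<bar>c\<bar>" and R = M])
         (auto simp: abs_mult intro!: borel_measurable_times borel_measurable_indicator)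
    have lim1: "(\<lambda>n. \<integral>x. indicator C x * A n x \<partial>lborel) \<longlonglongrightarrow> (\<integral>x. indicator C x * D x \<partial>lborel)"
    proof (rule integral_dominated_convergence[where w = "\<lambda>x::'a. B * indicator (cball 0 M) x"])
      show "AE x in lborel. (\<lambda>n. indicator C x * A n x) \<longlonglongrightarrow> indicator C x * D x"
        using A_lim by eventually_elim (intro tendsto_mult tendsto_const)
      show "AE x in lborel. norm (indicator C x * A n x) \<le> B * indicator (cball 0 M) x" for n
        using A_bound[of n] supp(1) B0
        by (intro AE_I2) (simp add: abs_mult mult.commute[of B] mult_mono)
    qed (use intB in auto)
    have q_bound: "\<bar>diff_quot f w n x\<bar> \<le> B" for n x
      using diff_quot_bound[OF lip, of w n x] L0 by (simp add: B_def add_increasing)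
    have lim2: "(\<lambda>n. \<integral>x. E n x \<partial>lborel) \<longlonglongrightarrow> (\<integral>x. 0 \<partial>(lborel :: 'a measure))"
    proof (rule integral_dominated_convergence[where w = "\<lambda>x::'a. B * indicator (cball 0 M) x"])
      have "AE x in lborel. x \<notin> frontier C"
        by (intro negligible_imp_AE_lborel negligible_convex_frontier) (simp add: C_def)
      then show "AE x in lborel. (\<lambda>n. E n x) \<longlonglongrightarrow> 0"
      proof eventually_elim
        case (elim x)
        show "(\<lambda>n. E n x) \<longlonglongrightarrow> 0" unfolding E_def
          by (rule Lim_null_comparison[OF _ tendsto_mult_left_zero[OF tendsto_rabs_zero[OF tendsto_indicator_translate[OF s0 elim]], of B]])
             (simp add: abs_mult mult_left_mono q_bound)
      qed
      show "AE x in lborel. norm (E n x) \<le> B * indicator (cball 0 M) x" for n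
      proof (rule AE_I2)
        fix x
        have "\<bar>indicator C (x - s n) - indicator C x\<bar> \<le> (indicator (cball 0 M) x :: real)"
          using supp(1)[of x] supp(2)[of x n] by (auto simp: indicator_def split: if_splits)
        then show "norm (E n x) \<le> B * indicator (cball 0 M) x"
          using q_bound[of n x] by (simp add: E_def abs_mult mult.commute[of B] mult_mono)
      qed
      show "E n \<in> borel_measurable lborel" for n
        unfolding E_def by measurable
    qed (use intB in auto)
    have "(\<integral>x. indicator C x * A n x \<partial>lborel) = (\<integral>x. E n x \<partial>lborel)" for n
    proof -
      have i1: "integrable lborel (\<lambda>x. indicator C x * diff_quot f w n x)"
        using supp(1) q_bound B0
        by (intro integrable_bounded_support[where B = B and R = M])
           (measurable, simp add: abs_mult mult.commute[of B] mult_mono)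
      have i2: "integrable lborel (\<lambda>x. indicator C x * diff_quot f w n (x + s n))"
        using supp(1) q_bound B0
        by (intro integrable_bounded_support[where B = B and R = M])
           (measurable, simp add: abs_mult mult.commute[of B] mult_mono)
      have i3: "integrable lborel (\<lambda>x. indicator C (x - s n) * diff_quot f w n x)"
        using supp(2)[where n = n] q_bound B0
        by (intro integrable_bounded_support[where B = B and R = M])
           (measurable, simp add: abs_mult mult.commute[of B] mult_mono)
      have "(\<integral>x. indicator C x * A n x \<partial>lborel) =
          (\<integral>x. indicator C x * diff_quot f w n (x + s n) \<partial>lborel) - (\<integral>x. indicator C x * diff_quot f w n x \<partial>lborel)"
        by (subst Bochner_Integration.integral_diff[symmetric, OF i2 i1]) (simp add: A_shift right_diff_distrib)
      also have "(\<integral>x. indicator C x * diff_quot f w n (x + s n) \<partial>lborel) =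
          (\<integral>x. indicator C (x - s n) * diff_quot f w n x \<partial>lborel)"
        using lborel_integral_translate[of "\<lambda>x. indicator C (x - s n) * diff_quot f w n x" "s n"] by simp
      also have "\<dots> - (\<integral>x. indicator C x * diff_quot f w n x \<partial>lborel) = (\<integral>x. E n x \<partial>lborel)"
        by (subst Bochner_Integration.integral_diff[symmetric, OF i3 i1]) (simp add: E_def left_diff_distrib)
      finally show ?thesis .
    qed
    with lim1 lim2 have "(\<integral>x. indicator C x * D x \<partial>lborel) = 0"
      using LIMSEQ_unique by fastforce
    moreover have "integrable lborel (\<lambda>x. indicator C x * D x)"
    proof (rule Bochner_Integration.integrable_bound[OF intB[of B]])
      show "AE x in lborel. norm (indicator C x * D x) \<le> norm (B * indicator (cball 0 M) x)"
        using D_bound by eventually_elim (use supp(1) B0 in \<open>auto simp: abs_mult mult.commute[of B] intro!: mult_mono\<close>)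
    qed measurable
    ultimately have "((\<lambda>x. indicator C x * D x) has_integral 0) UNIV"
      using has_integral_integral_lborel[of "\<lambda>x. indicator C x * D x"] by simp
    then show ?thesis
      unfolding C_def[symmetric]
      by (subst has_integral_restrict_UNIV[symmetric])
         (auto simp: indicator_def of_bool_def if_distrib if_distribR cong: if_cong)
  qed
  then have "AE x in lborel. D x = 0" by (rule AE_eq_0_if_cbox_integrals_0)
  then show ?thesis by eventually_elim (simp add: D_def)
qed

lemma AE_dir_deriv_sum:
  fixes f :: "'a::euclidean_space \<Rightarrow> real"
  assumes lip: "L-lipschitz_on UNIV f" and "finite B"
  shows "AE x in lborel. dir_deriv f (\<Sum>b\<in>B. c b *\<^sub>R b) x = (\<Sum>b\<in>B. c b * dir_deriv f b x)"
  using assms(2)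
proof (induction B rule: finite_induct)
  case empty
  have "dir_deriv f 0 x = 0" for x
    by (rule dir_deriv_eq) simp
  then show ?case by simp
next
  case (insert b B)
  from insert.IH AE_dir_deriv_add[OF lip, of "c b *\<^sub>R b" "\<Sum>b\<in>B. c b *\<^sub>R b"]
    AE_directionally_differentiable[OF lip, of b]
  show ?case
  proof eventually_elim
    case (elim x)
    then obtain d where d: "((\<lambda>t. f (x + t *\<^sub>R b)) has_real_derivative d) (at 0)" by blast
    have "dir_deriv f (c b *\<^sub>R b) x = c b * dir_deriv f b x"
      using dir_deriv_eq[OF d] dir_deriv_eq[OF has_dir_deriv_scaleR[OF d]] by simp
    with elim insert.hyps show ?case by simp
  qed
qed

text \<open>Finitely many directions of \<open>S\<close> come within \<eta> of every unit vector.
  Over this finite net the one-dimensional expansions are uniform, and the Lipschitz bound carries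
  them to all directions.\<close>

lemma GDERIV_if_dense_directions:
  fixes f :: "'a::euclidean_space \<Rightarrow> real"
  assumes lip: "L-lipschitz_on UNIV f" and dense: "closure S = UNIV"
    and dir: "\<And>v. v \<in> S \<Longrightarrow> ((\<lambda>t. f (x + t *\<^sub>R v)) has_real_derivative v \<bullet> G) (at 0)"
  shows "GDERIV f x :> G"
  unfolding gderiv_def has_derivative_at_alt
proof (intro conjI allI impI)
  show "bounded_linear (\<lambda>h. h \<bullet> G)" by (rule bounded_linear_inner_left)
  fix e :: real assume e: "0 < e"
  have L0: "L \<ge> 0" using lip by (rule lipschitz_on_nonneg)
  \<comment> \<open>Replacing a unit direction by one within \<eta> costs \<open>L * \<eta>\<close>
    in \<open>f\<close> and \<open>norm G * \<eta>\<close> in the linear part, together at most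
    \<open>e / 2\<close>. The other half of \<open>e\<close> goes to the expansion along the
    net.\<close>
  define \<eta> where "\<eta> = e / 2 / (L + norm G + 1)"
  have \<eta>: "\<eta> > 0" "(L + norm G) * \<eta> \<le> e / 2"
  proof -
    have K: "0 < L + norm G + 1" using L0 norm_ge_zero[of G] by linarith
    then show "\<eta> > 0" using e by (simp add: \<eta>_def)
    then have "(L + norm G) * \<eta> \<le> (L + norm G + 1) * \<eta>" by (intro mult_right_mono) auto
    also have "\<dots> = e / 2"
      using nonzero_mult_div_cancel_left[OF less_imp_neq[OF K, symmetric], of "e / 2"]
      by (simp only: \<eta>_def times_divide_eq_right)
    finally show "(L + norm G) * \<eta> \<le> e / 2" .
  qed
  have "sphere 0 1 \<subseteq> (\<Union>v\<in>S. ball v \<eta>)"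
  proof
    fix u :: 'a
    have "u \<in> closure S" using dense by simp
    then show "u \<in> (\<Union>v\<in>S. ball v \<eta>)"
      using \<eta>(1) unfolding closure_approachable by auto
  qed
  then obtain T where T: "T \<subseteq> S" "finite T" "sphere 0 1 \<subseteq> (\<Union>v\<in>T. ball v \<eta>)"
    using compactE_image[OF compact_sphere, of S "\<lambda>v. ball v \<eta>" 0 1] by auto
  have "\<exists>d>0. \<forall>t. \<bar>t\<bar> < d \<longrightarrow> \<bar>f (x + t *\<^sub>R v) - f x - t * (v \<bullet> G)\<bar> \<le> e / 2 * \<bar>t\<bar>" if "v \<in> T" for v
  proof -
    have "((\<lambda>t. f (x + t *\<^sub>R v)) has_derivative (\<lambda>t. t * (v \<bullet> G))) (at 0)"
      using dir[of v] that T(1) by (auto simp: has_field_derivative_def mult_commute_abs)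
    then obtain d where "d > 0" "\<And>t. norm (t - 0) < d \<Longrightarrow>
        norm (f (x + t *\<^sub>R v) - f (x + 0 *\<^sub>R v) - (t - 0) * (v \<bullet> G)) \<le> e / 2 * norm (t - 0)"
      using e unfolding has_derivative_at_alt by (meson half_gt_zero)
    then show ?thesis by auto
  qed
  then obtain d where d: "\<And>v. v \<in> T \<Longrightarrow> d v > 0"
    "\<And>v t. v \<in> T \<Longrightarrow> \<bar>t\<bar> < d v \<Longrightarrow> \<bar>f (x + t *\<^sub>R v) - f x - t * (v \<bullet> G)\<bar> \<le> e / 2 * \<bar>t\<bar>"
    by metis
  define \<delta> where "\<delta> = Min (insert 1 (d ` T))"
  have \<delta>: "\<delta> > 0" "\<And>v. v \<in> T \<Longrightarrow> \<delta> \<le> d v"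
    using T(2) d(1) by (auto simp: \<delta>_def)
  show "\<exists>d>0. \<forall>y. norm (y - x) < d \<longrightarrow> norm (f y - f x - (y - x) \<bullet> G) \<le> e * norm (y - x)"
  proof (intro exI[of _ \<delta>] conjI allI impI \<delta>(1))
    fix y assume y: "norm (y - x) < \<delta>"
    show "norm (f y - f x - (y - x) \<bullet> G) \<le> e * norm (y - x)"
    proof (cases "y = x")
      case False
      define t where "t = norm (y - x)"
      define u where "u = (1 / t) *\<^sub>R (y - x)"
      have t: "t > 0" "t < \<delta>" and yx: "y = x + t *\<^sub>R u" and "u \<in> sphere 0 1"
        using False y by (auto simp: t_def u_def)
      then obtain v where v: "v \<in> T" "dist v u < \<eta>" using T(3) by auto
      have 1: "\<bar>f (x + t *\<^sub>R v) - f x - t * (v \<bullet> G)\<bar> \<le> e / 2 * t"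
        using d(2)[OF v(1), of t] t \<delta>(2)[OF v(1)] by auto
      have "\<bar>f (x + t *\<^sub>R u) - f (x + t *\<^sub>R v)\<bar> \<le> L * (t * norm (u - v))"
        using lipschitz_onD[OF lip, of "x + t *\<^sub>R u" "x + t *\<^sub>R v"] t
        by (simp add: dist_norm flip: scaleR_diff_right)
      moreover have "\<bar>t * (v \<bullet> G) - t * (u \<bullet> G)\<bar> \<le> t * (norm (u - v) * norm G)"
        using t Cauchy_Schwarz_ineq2[of "v - u" G]
        by (simp add: abs_mult norm_minus_commute flip: right_diff_distrib inner_diff_left)
      moreover have "L * (t * norm (u - v)) + t * (norm (u - v) * norm G) \<le> t * ((L + norm G) * \<eta>)"
      proof -
        have "(L + norm G) * norm (u - v) \<le> (L + norm G) * \<eta>"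
          using v(2) L0 by (intro mult_left_mono) (auto simp: dist_norm norm_minus_commute)
        then have "t * ((L + norm G) * norm (u - v)) \<le> t * ((L + norm G) * \<eta>)"
          using t(1) by (rule mult_left_mono[OF _ less_imp_le])
        then show ?thesis by (simp add: algebra_simps)
      qed
      moreover have "t * ((L + norm G) * \<eta>) \<le> t * (e / 2)"
        using \<eta>(2) t(1) by (rule mult_left_mono[OF _ less_imp_le])
      ultimately have "\<bar>f (x + t *\<^sub>R u) - f x - t * (u \<bullet> G)\<bar> \<le> e * t"
        using 1 by argo
      moreover have "f y - f x - (y - x) \<bullet> G = f (x + t *\<^sub>R u) - f x - t * (u \<bullet> G)"
        by (simp add: yx)
      ultimately show ?thesis by (simp only: t_def real_norm_def)
    qed simp
  qed
qed

text \<open>A countable dense set of directions lets one null set serve all of them. The gradient is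
  assembled from the partial derivatives, and additivity identifies each derivative in a direction
  of \<open>S\<close> with the inner product against it.\<close>

theorem rademacher:
  fixes f :: "'a::euclidean_space \<Rightarrow> real"
  assumes lip: "L-lipschitz_on UNIV f"
  shows "AE x in lborel. \<exists>G. GDERIV f x :> G"
proof -
  obtain S :: "'a set" where S: "countable S" "\<And>X. open X \<Longrightarrow> X \<noteq> {} \<Longrightarrow> \<exists>d\<in>S. d \<in> X"
    by (rule countable_dense_setE) (rule that, assumption, blast)
  have dense: "closure S = UNIV"
  proof (intro set_eqI iffI UNIV_I)
    fix x :: 'a
    have "\<exists>y\<in>S. dist y x < e" if "e > 0" for e
      using S(2)[of "ball x e"] that by (auto simp: dist_commute)
    then show "x \<in> closure S" by (simp add: closure_approachable)
  qed
  have "AE x in lborel. \<forall>v\<in>S. (\<exists>d. ((\<lambda>t. f (x + t *\<^sub>R v)) has_real_derivative d) (at 0)) \<and>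
     dir_deriv f (\<Sum>b\<in>Basis. (v \<bullet> b) *\<^sub>R b) x = (\<Sum>b\<in>Basis. (v \<bullet> b) * dir_deriv f b x)"
    using AE_directionally_differentiable[OF lip] AE_dir_deriv_sum[OF lip finite_Basis]
    by (simp add: AE_ball_countable[OF S(1)])
  then show ?thesis
  proof eventually_elim
    case (elim x)
    define G where "G = (\<Sum>b\<in>Basis. dir_deriv f b x *\<^sub>R b)"
    have "GDERIV f x :> G"
    proof (rule GDERIV_if_dense_directions[OF lip dense])
      fix v assume "v \<in> S"
      with elim obtain d where d: "((\<lambda>t. f (x + t *\<^sub>R v)) has_real_derivative d) (at 0)"
        and s: "dir_deriv f (\<Sum>b\<in>Basis. (v \<bullet> b) *\<^sub>R b) x = (\<Sum>b\<in>Basis. (v \<bullet> b) * dir_deriv f b x)"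
        by blast
      have "d = v \<bullet> G"
        using s dir_deriv_eq[OF d] by (simp add: euclidean_representation G_def inner_sum_right mult.commute)
      with d show "((\<lambda>t. f (x + t *\<^sub>R v)) has_real_derivative v \<bullet> G) (at 0)" by simp
    qed
    then show ?case by blast
  qed
qed

section \<open>A mean value inequality with gradients\<close>

lemma GDERIV_imp_line_derivative:
  assumes "GDERIV f (x + t *\<^sub>R u) :> D"
  shows "((\<lambda>t. f (x + t *\<^sub>R u)) has_real_derivative D \<bullet> u) (at t)"
proof -
  have "((\<lambda>t. x + t *\<^sub>R u) has_derivative (\<lambda>h. h *\<^sub>R u)) (at t)"
    by (auto intro!: derivative_eq_intros)
  then have "((\<lambda>t. f (x + t *\<^sub>R u)) has_derivative (\<lambda>h. (h *\<^sub>R u) \<bullet> D)) (at t)"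
    using assms unfolding gderiv_def by (rule has_derivative_compose)
  then show ?thesis
    by (simp add: has_field_derivative_def inner_commute mult_commute_abs)
qed

text \<open>The segment from \<open>a\<close> to \<open>b\<close> may miss every point of
  differentiability, but by Fubini almost every parallel segment has gradients almost everywhere. If
  all gradients near the original segment were too small, integrating along such a parallel segment
  would make the increment of \<open>f\<close> too small.\<close>

lemma lipschitz_mean_value_GDERIV:
  fixes f :: "'a::euclidean_space \<Rightarrow> real"
  assumes lip: "L-lipschitz_on UNIV f" and r: "r > 0" and \<eta>: "\<eta> > 0"
  obtains y z D where "y \<in> closed_segment a b" "dist y z < r" "GDERIV f z :> D"
    "f b - f a - \<eta> \<le> D \<bullet> (b - a)"
proof (rule ccontr)
  note * = that
  assume "\<not> thesis"
  define u where "u = b - a"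
  define c where "c = f b - f a - \<eta>"
  have small: "D \<bullet> u \<le> c" if "y \<in> closed_segment a b" "dist y z < r" "GDERIV f z :> D" for y z D
    using *[OF that] \<open>\<not> thesis\<close> by (force simp: u_def c_def)
  have L0: "L \<ge> 0" using lip by (rule lipschitz_on_nonneg)
  \<comment> \<open>Shifting both endpoints by less than \<delta> changes the increment by at most
    \<open>2 * (L * \<delta>)\<close>, hence by at most half of the slack \<eta>.\<close>
  define \<delta> where "\<delta> = min r (\<eta> / 4 / (L + 1))"
  have \<delta>: "\<delta> > 0" "\<delta> \<le> r" "2 * (L * \<delta>) \<le> \<eta> / 2"
  proof -
    show "\<delta> > 0" "\<delta> \<le> r" using r \<eta> L0 by (auto simp: \<delta>_def)
    have "L * \<delta> \<le> (L + 1) * (\<eta> / 4 / (L + 1))"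
      using L0 \<open>\<delta> > 0\<close> by (intro mult_mono) (auto simp: \<delta>_def)
    also have "\<dots> = \<eta> / 4"
      using L0 nonzero_mult_div_cancel_left[of "L + 1" "\<eta> / 4"] by (simp only: times_divide_eq_right)
    finally show "2 * (L * \<delta>) \<le> \<eta> / 2" by simp
  qed
  have AE: "AE x in lborel. AE t in lborel. \<exists>G. GDERIV f (x + t *\<^sub>R u) :> G"
    by (rule AE_lborel_imp_AE_lines[OF rademacher[OF lip]])
  \<comment> \<open>A ball has positive measure, so it contains a good starting point.\<close>
  have "\<exists>x\<in>ball a \<delta>. AE t in lborel. \<exists>G. GDERIV f (x + t *\<^sub>R u) :> G"
  proof (rule ccontr)
    assume "\<not> ?thesis"
    with AE have "AE x in lborel. x \<notin> ball a \<delta>" by (auto elim!: eventually_mono)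
    then have "emeasure lborel (ball a \<delta>) = 0"
      by (subst (asm) AE_iff_measurable[OF _ refl]) (auto simp: ball_def)
    then have "ball a \<delta> \<in> null_sets lborel" by (simp add: null_sets_def)
    then have "negligible (ball a \<delta>)"
      by (simp add: negligible_iff_null_sets null_sets_completionI)
    then show False using \<delta>(1) open_not_negligible[OF open_ball, of a \<delta>] by simp
  qed
  then obtain x where x: "dist a x < \<delta>" and "AE t in lborel. \<exists>G. GDERIV f (x + t *\<^sub>R u) :> G"
    by auto
  then obtain N2 where N2: "N2 \<in> null_sets lborel" "{t. \<not> (\<exists>G. GDERIV f (x + t *\<^sub>R u) :> G)} \<subseteq> N2"
    by (auto simp: eventually_ae_filter)
  obtain N1 h where N1: "negligible N1"
    and h: "\<And>t. t \<notin> N1 \<Longrightarrow> ((\<lambda>t. f (x + t *\<^sub>R u)) has_real_derivative h t) (at t)"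
    and int: "\<And>a b. a \<le> b \<Longrightarrow> (h has_integral (f (x + b *\<^sub>R u) - f (x + a *\<^sub>R u))) {a..b}"
    by (rule lipschitz_real_derivative_integral[OF lipschitz_on_line[OF lip, of u x]]) (rule that, assumption+)
  have "negligible (N1 \<union> N2)"
    using N1 null_sets_completionI[OF N2(1)] by (simp add: negligible_iff_null_sets null_sets.Un)
  \<comment> \<open>On the null set the derivative is overwritten with \<open>c\<close>, so that the
    bound by \<open>c\<close> holds at every point of the interval.\<close>
  then have "((\<lambda>t. if t \<in> N1 \<union> N2 then c else h t) has_integral (f (x + u) - f x)) {0..1}"
    by (rule has_integral_spike) (use int[of 0 1] in auto)
  moreover have "((\<lambda>t. c) has_integral c) {0..1::real}"
    using has_integral_const_real[of c 0 1] by simp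
  moreover have "(if t \<in> N1 \<union> N2 then c else h t) \<le> c" if t: "t \<in> {0..1}" for t
  proof (cases "t \<in> N1 \<union> N2")
    case False
    with N2(2) obtain D where D: "GDERIV f (x + t *\<^sub>R u) :> D" by blast
    have "h t = D \<bullet> u"
      using False h by (intro DERIV_unique[OF _ GDERIV_imp_line_derivative[OF D]]) auto
    moreover have "a + t *\<^sub>R u \<in> closed_segment a b"
      using t by (auto simp: u_def closed_segment_def algebra_simps intro!: exI[of _ t])
    moreover have "dist (a + t *\<^sub>R u) (x + t *\<^sub>R u) < r"
      using x \<delta>(2) by (simp add: dist_norm)
    ultimately show ?thesis using small[OF _ _ D] False by auto
  qed auto
  ultimately have "f (x + u) - f x \<le> c"
    by (rule has_integral_le)
  moreover have "\<bar>f (x + u) - f b\<bar> \<le> L * \<delta>" "\<bar>f x - f a\<bar> \<le> L * \<delta>"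
  proof -
    have "dist (x + u) b = dist a x" by (simp add: u_def dist_norm norm_minus_commute)
    then have "\<bar>f (x + u) - f b\<bar> \<le> L * dist a x" "\<bar>f x - f a\<bar> \<le> L * dist a x"
      using lipschitz_onD[OF lip, of "x + u" b] lipschitz_onD[OF lip, of x a]
      by (auto simp: dist_real_def dist_commute)
    moreover have "L * dist a x \<le> L * \<delta>" using x L0 by (intro mult_left_mono) auto
    ultimately show "\<bar>f (x + u) - f b\<bar> \<le> L * \<delta>" "\<bar>f x - f a\<bar> \<le> L * \<delta>" by auto
  qed
  ultimately show False using \<delta>(3) \<eta> unfolding c_def by linarith
qed

section \<open>Clarke and Goldstein subdifferentials of Lipschitz functions\<close>

definition limiting_gradients :: "('a::euclidean_space \<Rightarrow> real) \<Rightarrow> 'a \<Rightarrow> 'a set" where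
  "limiting_gradients f x = {v. \<exists>xs D. xs \<longlonglongrightarrow> x \<and> (\<forall>r. GDERIV f (xs r) :> D r) \<and> D \<longlonglongrightarrow> v}"

lemma clarke_subdiff_eq: "clarke_subdiff f x = closure (convex hull limiting_gradients f x)"
  by (simp add: clarke_subdiff_def limiting_gradients_def)

lemma limiting_gradients_subset: "limiting_gradients f x \<subseteq> clarke_subdiff f x"
  unfolding clarke_subdiff_eq using hull_subset closure_subset by (rule subset_trans)

lemma closed_clarke_subdiff: "closed (clarke_subdiff f x)"
  by (simp add: clarke_subdiff_eq)

lemma convex_clarke_subdiff: "convex (clarke_subdiff f x)"
  by (simp add: clarke_subdiff_eq convex_closure)

text \<open>Membership in a closed convex set passes from nearby gradients to their limits and then
  to the closed convex hull. Balls yield norm bounds, half-spaces bounds on inner products.\<close>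

lemma clarke_subdiff_subset_if_gradients:
  assumes "open U" "x \<in> U" "closed C" "convex C"
    and "\<And>z D. z \<in> U \<Longrightarrow> GDERIV f z :> D \<Longrightarrow> D \<in> C"
  shows "clarke_subdiff f x \<subseteq> C"
proof -
  have "v \<in> C" if "v \<in> limiting_gradients f x" for v
  proof -
  from that obtain xs D where xs: "xs \<longlonglongrightarrow> x" "\<And>r. GDERIV f (xs r) :> D r" "D \<longlonglongrightarrow> v"
      unfolding limiting_gradients_def by blast
    have "\<forall>\<^sub>F r in sequentially. D r \<in> C"
      using topological_tendstoD[OF xs(1) assms(1,2)] by eventually_elim (use assms(5) xs(2) in blast)
    then show "v \<in> C"
      using Lim_in_closed_set[OF assms(3) _ _ xs(3)] by auto
  qed
  then show ?thesis
    unfolding clarke_subdiff_eq using assms(3,4) by (intro closure_minimal hull_minimal) auto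
qed

text \<open>The derivative in the direction \<open>D\<close> itself is \<open>D \<bullet> D\<close>,
  and the difference quotients bound it by \<open>L * norm D\<close>.\<close>

lemma GDERIV_norm_le:
  assumes lip: "L-lipschitz_on U f" and "open U" "x \<in> U" and D: "GDERIV f x :> D"
  shows "norm D \<le> L"
proof -
  have "((\<lambda>t. f (x + t *\<^sub>R D)) has_real_derivative D \<bullet> D) (at 0)"
    using D by (intro GDERIV_imp_line_derivative) simp
  then have "(\<lambda>t. \<bar>(f (x + t *\<^sub>R D) - f x) / t\<bar>) \<midarrow>0\<rightarrow> \<bar>D \<bullet> D\<bar>"
    by (intro tendsto_rabs) (simp add: DERIV_def)
  moreover have "\<forall>\<^sub>F t in at 0. \<bar>(f (x + t *\<^sub>R D) - f x) / t\<bar> \<le> L * norm D"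
  proof -
    have "(\<lambda>t. x + t *\<^sub>R D) \<midarrow>0\<rightarrow> x + 0 *\<^sub>R D"
      by (intro tendsto_intros)
    then have "\<forall>\<^sub>F t in at 0. x + t *\<^sub>R D \<in> U"
      using assms(2,3) by (intro topological_tendstoD) auto
    moreover have "\<forall>\<^sub>F t in at (0::real). t \<noteq> 0"
      by (simp add: eventually_at_filter)
    ultimately show ?thesis
    proof eventually_elim
      case (elim t)
      have "\<bar>f (x + t *\<^sub>R D) - f x\<bar> \<le> L * norm D * \<bar>t\<bar>"
        using lipschitz_onD[OF lip elim(1) assms(3)] by (simp add: dist_norm mult_ac)
      then show ?case using elim(2) by (simp add: pos_divide_le_eq)
    qed
  qed
  ultimately have "\<bar>D \<bullet> D\<bar> \<le> L * norm D"
    by (intro tendsto_upperbound) auto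
  then have "norm D * norm D \<le> L * norm D"
    by (simp add: power2_norm_eq_inner[symmetric] power2_eq_square)
  then show ?thesis
    using lipschitz_on_nonneg[OF lip] by (cases "D = 0") auto
qed

text \<open>The Lipschitz bound is local. It is placed on a closed ball, onto which there is a
  projection, whereas subdifferentials are taken at points of the open ball, where all nearby
  gradients obey the bound.\<close>

locale lipschitz_on_cball =
  fixes f :: "'a::euclidean_space \<Rightarrow> real" and p :: 'a and R L :: real
  assumes lip: "L-lipschitz_on (cball p R) f"
begin

lemma lip_ball: "L-lipschitz_on (ball p R) f"
  using lip by (rule lipschitz_on_subset) auto

lemma gradient_le: "x \<in> ball p R \<Longrightarrow> GDERIV f x :> D \<Longrightarrow> norm D \<le> L"
  using GDERIV_norm_le[OF lip_ball open_ball] .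

lemma clarke_subdiff_le:
  assumes "x \<in> ball p R" "v \<in> clarke_subdiff f x"
  shows "norm v \<le> L"
proof -
  have "clarke_subdiff f x \<subseteq> cball 0 L"
    using gradient_le by (intro clarke_subdiff_subset_if_gradients[OF open_ball assms(1)]) auto
  with assms(2) show ?thesis by auto
qed

lemma gradient_subsequence_limit:
  assumes "y \<in> ball p R" "zs \<longlonglongrightarrow> y" "\<And>n. GDERIV f (zs n) :> D n"
  obtains v r where "strict_mono (r :: nat \<Rightarrow> nat)" "(D \<circ> r) \<longlonglongrightarrow> v" "v \<in> clarke_subdiff f y"
proof -
  obtain N where N: "\<And>n. n \<ge> N \<Longrightarrow> zs n \<in> ball p R"
    using topological_tendstoD[OF assms(2) open_ball assms(1)] by (auto simp: eventually_sequentially)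
  have "D (n + N) \<in> cball 0 L" for n
    using gradient_le[OF N assms(3), of "n + N"] by simp
  then obtain v r where r: "strict_mono r" "((\<lambda>n. D (n + N)) \<circ> r) \<longlonglongrightarrow> v"
    using compact_imp_seq_compact[OF compact_cball, of 0 L] unfolding seq_compact_def by (metis (no_types, lifting))
  define s where "s = (\<lambda>n. r n + N)"
  have s: "strict_mono s" using r(1) by (simp add: s_def strict_mono_def)
  moreover have Ds: "(D \<circ> s) \<longlonglongrightarrow> v" using r(2) by (simp add: s_def o_def)
  moreover have "v \<in> limiting_gradients f y"
    unfolding limiting_gradients_def
    using LIMSEQ_subseq_LIMSEQ[OF assms(2) s] Ds assms(3)
    by (intro CollectI exI[of _ "zs \<circ> s"] exI[of _ "D \<circ> s"]) auto
  ultimately show ?thesis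
    using that limiting_gradients_subset by blast
qed

text \<open>A limit \<open>v\<close> outside the subdifferential at \<open>y\<close> is cut off by a
  hyperplane. Gradients close to \<open>y\<close> lie on the side of that subdifferential, since
  otherwise some of them would converge to one of its elements across the hyperplane. The
  subdifferentials near \<open>y\<close> follow, and so does \<open>v\<close>, a
  contradiction.\<close>

lemma clarke_subdiff_closed_graph:
  assumes y: "y \<in> ball p R" and ys: "ys \<longlonglongrightarrow> y" and vs: "\<And>n. vs n \<in> clarke_subdiff f (ys n)" "vs \<longlonglongrightarrow> v"
  shows "v \<in> clarke_subdiff f y"
proof (rule ccontr)
  assume "v \<notin> clarke_subdiff f y"
  then obtain a b where ab: "a \<bullet> v < b" "\<And>w. w \<in> clarke_subdiff f y \<Longrightarrow> b < a \<bullet> w"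
    using separating_hyperplane_closed_point[OF convex_clarke_subdiff closed_clarke_subdiff] by blast
  have "\<exists>e>0. \<forall>z D. z \<in> ball y e \<longrightarrow> GDERIV f z :> D \<longrightarrow> b \<le> a \<bullet> D"
  proof (rule ccontr)
    assume "\<not> ?thesis"
    then have "\<exists>z D. z \<in> ball y (1 / Suc n) \<and> GDERIV f z :> D \<and> a \<bullet> D < b" for n
      by (metis not_le of_nat_0_less_iff zero_less_Suc zero_less_divide_1_iff)
    then obtain zs D where zs: "\<And>n. zs n \<in> ball y (1 / Suc n)" "\<And>n. GDERIV f (zs n) :> D n" "\<And>n. a \<bullet> D n < b"
      by metis
    have "(\<lambda>n. dist (zs n) y) \<longlonglongrightarrow> 0"
    proof (rule tendsto_sandwich[OF _ _ tendsto_const LIMSEQ_inverse_real_of_nat])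
      have "dist (zs n) y \<le> inverse (real (Suc n))" for n
        using zs(1)[of n] by (simp add: inverse_eq_divide dist_commute less_imp_le del: of_nat_Suc)
      then show "\<forall>\<^sub>F n in sequentially. dist (zs n) y \<le> inverse (real (Suc n))"
        by (intro always_eventually allI)
    qed simp
    then have "zs \<longlonglongrightarrow> y" by (rule tendsto_dist_iff[THEN iffD2])
    from gradient_subsequence_limit[OF y this zs(2)]
    obtain w r where w: "(D \<circ> r) \<longlonglongrightarrow> w" "w \<in> clarke_subdiff f y"
      by metis
    have "a \<bullet> w \<le> b"
      by (rule tendsto_upperbound[OF tendsto_inner[OF tendsto_const w(1)]])
         (use zs(3) in \<open>auto simp: less_imp_le\<close>)
    with ab(2)[OF w(2)] show False by simp
  qed
  then obtain e where e: "e > 0" "\<And>z D. z \<in> ball y e \<Longrightarrow> GDERIV f z :> D \<Longrightarrow> b \<le> a \<bullet> D" by blast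
  have sub: "clarke_subdiff f z \<subseteq> {w. a \<bullet> w \<ge> b}" if "z \<in> ball y e" for z
    using e(2) by (intro clarke_subdiff_subset_if_gradients[OF open_ball that] closed_halfspace_ge convex_halfspace_ge) auto
  have "\<forall>\<^sub>F n in sequentially. a \<bullet> vs n \<ge> b"
    using topological_tendstoD[OF ys open_ball, of y e] e(1) sub vs(1)
    by (auto elim!: eventually_mono)
  then have "a \<bullet> v \<ge> b"
    by (intro tendsto_lowerbound[OF tendsto_inner[OF tendsto_const vs(2)]]) auto
  with ab(1) show False by simp
qed

text \<open>Precomposing \<open>f\<close> with the projection onto the ball extends it to a globally Lipschitz
  function, to which the mean value theorem for gradients applies.\<close>

lemma clarke_mean_value:
  assumes seg: "closed_segment a b \<subseteq> ball p R"
  obtains z v where "z \<in> closed_segment a b" "v \<in> clarke_subdiff f z" "f b - f a \<le> v \<bullet> (b - a)"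
proof -
  have a: "a \<in> ball p R" and b: "b \<in> ball p R" using seg by auto
  have "a \<in> cball p R" using a by simp
  then have ne: "cball p R \<noteq> {}" by blast
  define F where "F = f \<circ> closest_point (cball p R)"
  have "(L * 1)-lipschitz_on UNIV F"
    unfolding F_def
  proof (rule lipschitz_on_compose)
    show "1-lipschitz_on UNIV (closest_point (cball p R))"
      using ne by (intro lipschitz_onI) (auto intro: closest_point_lipschitz)
    show "L-lipschitz_on (closest_point (cball p R) ` UNIV) f"
      using closest_point_in_set[OF closed_cball ne] by (intro lipschitz_on_subset[OF lip]) auto
  qed
  then have lipF: "L-lipschitz_on UNIV F" by simp
  have Ff: "F x = f x" if "x \<in> ball p R" for x
    using that by (simp add: F_def closest_point_self)
  \<comment> \<open>The inequality so far holds up to an error and at points near the segment. Both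
    tolerances are sent to 0; compactness of the segment and boundedness of gradients provide the
    limit point and the limit vector.\<close>
  have "\<exists>y z D. y \<in> closed_segment a b \<and> dist y z < 1 / Suc n \<and> GDERIV F z :> D \<and> F b - F a - 1 / Suc n \<le> D \<bullet> (b - a)" for n
    using lipschitz_mean_value_GDERIV[OF lipF, of "1 / Suc n" "1 / Suc n" a b]
    by (metis of_nat_0_less_iff zero_less_Suc zero_less_divide_1_iff)
  then obtain ys zs D where y: "\<And>n. ys n \<in> closed_segment a b" and z: "\<And>n. dist (ys n) (zs n) < 1 / Suc n"
    and D: "\<And>n. GDERIV F (zs n) :> D n" "\<And>n. F b - F a - 1 / Suc n \<le> D n \<bullet> (b - a)"
    by metis
  obtain y r where yr: "y \<in> closed_segment a b" "strict_mono r" "(ys \<circ> r) \<longlonglongrightarrow> y"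
    using compact_imp_seq_compact[OF compact_segment, of a b] y unfolding seq_compact_def by metis
  have yb: "y \<in> ball p R" using yr(1) seg by auto
  have inv0: "(\<lambda>n. 1 / real (Suc n)) \<longlonglongrightarrow> 0"
    using LIMSEQ_inverse_real_of_nat by (simp add: divide_inverse)
  have "(\<lambda>n. dist (ys n) (zs n)) \<longlonglongrightarrow> 0"
    by (rule tendsto_sandwich[OF _ _ tendsto_const inv0])
       (auto intro!: always_eventually less_imp_le z simp del: of_nat_Suc)
  then have "(\<lambda>n. dist ((ys \<circ> r) n) ((zs \<circ> r) n)) \<longlonglongrightarrow> 0"
    using LIMSEQ_subseq_LIMSEQ[OF _ yr(2)] by (fastforce simp: o_def)
  from tendsto_add[OF this tendsto_dist_iff[THEN iffD1, OF yr(3)]]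
  have "(\<lambda>n. dist ((ys \<circ> r) n) ((zs \<circ> r) n) + dist ((ys \<circ> r) n) y) \<longlonglongrightarrow> 0" by simp
  moreover have "\<forall>\<^sub>F n in sequentially. norm (dist ((zs \<circ> r) n) y) \<le>
      dist ((ys \<circ> r) n) ((zs \<circ> r) n) + dist ((ys \<circ> r) n) y"
    using dist_triangle3 by (intro always_eventually allI) (simp only: real_norm_def abs_of_nonneg zero_le_dist)
  ultimately have "(\<lambda>n. dist ((zs \<circ> r) n) y) \<longlonglongrightarrow> 0"
    by (rule Lim_null_comparison[rotated])
  then have zr: "(zs \<circ> r) \<longlonglongrightarrow> y" by (rule tendsto_dist_iff[THEN iffD2])
  obtain N where N: "\<And>n. n \<ge> N \<Longrightarrow> zs (r n) \<in> ball p R"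
    using topological_tendstoD[OF zr open_ball yb] by (auto simp: eventually_sequentially)
  \<comment> \<open>The shift by \<open>N\<close> keeps the points in the open ball, where
    \<open>F\<close> agrees with \<open>f\<close> and has the same gradients.\<close>
  define s where "s = (\<lambda>n. r (n + N))"
  have s: "strict_mono s" using yr(2) by (simp add: s_def strict_mono_def)
  have zs: "(\<lambda>n. zs (s n)) \<longlonglongrightarrow> y"
    using LIMSEQ_ignore_initial_segment[OF zr, of N] by (simp add: s_def o_def)
  have Df: "GDERIV f (zs (s n)) :> D (s n)" for n
    unfolding gderiv_def
  proof (rule has_derivative_transform_within_open[OF D(1)[of "s n", unfolded gderiv_def] open_ball])
    show "zs (s n) \<in> ball p R" using N[of "n + N"] by (simp add: s_def)
  qed (rule Ff)
  obtain v t where t: "strict_mono t" "((\<lambda>n. D (s n)) \<circ> t) \<longlonglongrightarrow> v" "v \<in> clarke_subdiff f y"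
    by (rule gradient_subsequence_limit[OF yb zs Df]) (rule that, assumption+)
  have "(\<lambda>n. F b - F a - 1 / real (Suc n)) \<longlonglongrightarrow> F b - F a - 0"
    by (intro tendsto_diff tendsto_const inv0)
  then have "(\<lambda>n. F b - F a - 1 / real (Suc (s (t n)))) \<longlonglongrightarrow> F b - F a"
    using LIMSEQ_subseq_LIMSEQ[OF LIMSEQ_subseq_LIMSEQ[OF _ s] t(1)] by (fastforce simp: o_def)
  then have "F b - F a \<le> v \<bullet> (b - a)"
    by (rule tendsto_le[OF sequentially_bot tendsto_inner[OF t(2) tendsto_const]])
       (use D(2) in \<open>auto simp: o_def\<close>)
  then show ?thesis
    using that[OF yr(1) t(3)] Ff a b by simp
qed

text \<open>The mean value theorem on the degenerate segment from \<open>x\<close> to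
  \<open>x\<close> already supplies an element.\<close>

lemma clarke_subdiff_nonempty:
  assumes "x \<in> ball p R"
  shows "clarke_subdiff f x \<noteq> {}"
  using clarke_mean_value[of x x] assms by auto

section \<open>The Goldstein subdifferential and its descent step\<close>

context
  fixes x :: 'a and \<epsilon> :: real
  assumes \<epsilon>: "0 \<le> \<epsilon>" "cball x \<epsilon> \<subseteq> ball p R"
begin

text \<open>The union over the ball is closed by the closed graph property and bounded by
  \<open>L\<close>; in finite dimension the convex hull of a compact set is compact. So the shortest
  vector exists without taking a closure.\<close>

lemma compact_goldstein_subdiff: "compact (goldstein_subdiff f \<epsilon> x)"
  unfolding goldstein_subdiff_def
proof (rule compact_convex_hull)
  let ?S = "\<Union>y\<in>cball x \<epsilon>. clarke_subdiff f y"
  have "closed ?S"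
    unfolding closed_sequential_limits
  proof (intro allI impI, elim conjE)
    fix vs v assume "\<forall>n. vs n \<in> ?S" and v: "vs \<longlonglongrightarrow> v"
    then have "\<forall>n. \<exists>y. y \<in> cball x \<epsilon> \<and> vs n \<in> clarke_subdiff f y" by blast
    then obtain ys where ys: "\<And>n. ys n \<in> cball x \<epsilon>" "\<And>n. vs n \<in> clarke_subdiff f (ys n)"
      by metis
    obtain y r where y: "y \<in> cball x \<epsilon>" "strict_mono r" "(ys \<circ> r) \<longlonglongrightarrow> y"
      using compact_imp_seq_compact[OF compact_cball, of x \<epsilon>] ys(1) unfolding seq_compact_def by metis
    have "v \<in> clarke_subdiff f y"
      by (rule clarke_subdiff_closed_graph[OF _ y(3) _ LIMSEQ_subseq_LIMSEQ[OF v y(2)]])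
         (use y(1) \<epsilon>(2) ys(2) in auto)
    with y(1) show "v \<in> ?S" by blast
  qed
  moreover have "?S \<subseteq> cball 0 L"
    using clarke_subdiff_le \<epsilon>(2) by auto
  ultimately show "compact ?S"
    by (meson bounded_cball bounded_subset compact_eq_bounded_closed)
qed

lemma goldstein_subdiff_nonempty: "goldstein_subdiff f \<epsilon> x \<noteq> {}"
proof -
  have "x \<in> cball x \<epsilon>" using \<epsilon>(1) by simp
  then show ?thesis
    using clarke_subdiff_nonempty[of x] \<epsilon>(2) unfolding goldstein_subdiff_def by fastforce
qed

lemma goldstein_subgrad_in: "goldstein_subgrad f \<epsilon> x \<in> goldstein_subdiff f \<epsilon> x"
  unfolding goldstein_subgrad_def
  using compact_imp_closed[OF compact_goldstein_subdiff] goldstein_subdiff_nonempty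
  by (rule closest_point_in_set)

lemma goldstein_subgrad_inner:
  assumes "v \<in> goldstein_subdiff f \<epsilon> x"
  shows "(norm (goldstein_subgrad f \<epsilon> x))\<^sup>2 \<le> v \<bullet> goldstein_subgrad f \<epsilon> x"
proof -
  have "convex (goldstein_subdiff f \<epsilon> x)" by (simp add: goldstein_subdiff_def)
  from closest_point_dot[OF this compact_imp_closed[OF compact_goldstein_subdiff] assms, of 0]
  show ?thesis
    by (simp add: goldstein_subgrad_def power2_norm_eq_inner inner_diff_right inner_commute)
qed

lemma goldstein_descent:
  "f (goldstein_step f \<epsilon> x) \<le> f x - \<epsilon> * norm (goldstein_subgrad f \<epsilon> x)"
proof (cases "goldstein_subgrad f \<epsilon> x = 0")
  \<comment> \<open>Division by 0 yields 0, so the step stays at \<open>x\<close>.\<close>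
  case True
  then show ?thesis by (simp add: goldstein_step_def)
next
  case False
  define g where "g = goldstein_subgrad f \<epsilon> x"
  define b where "b = goldstein_step f \<epsilon> x"
  have g: "norm g > 0" using False by (simp add: g_def)
  have bx: "b - x = - (\<epsilon> / norm g) *\<^sub>R g" by (simp add: b_def goldstein_step_def g_def)
  then have "norm (b - x) = \<epsilon>" using g \<epsilon>(1) by simp
  then have "b \<in> cball x \<epsilon>" by (simp add: dist_norm norm_minus_commute)
  then have seg: "closed_segment x b \<subseteq> cball x \<epsilon>"
    using \<epsilon>(1) by (intro closed_segment_subset) auto
  then obtain z v where z: "z \<in> closed_segment x b" "v \<in> clarke_subdiff f z" and fz: "f b - f x \<le> v \<bullet> (b - x)"
    using clarke_mean_value[of x b] \<epsilon>(2) by blast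
  \<comment> \<open>The step has length \<epsilon>, so the segment stays in the ball over which the
    Goldstein subdifferential is formed; this makes \<open>v\<close> comparable with the shortest
    vector.\<close>
  have "v \<in> goldstein_subdiff f \<epsilon> x"
    unfolding goldstein_subdiff_def using z seg by (intro hull_inc) auto
  then have "(norm g)\<^sup>2 \<le> v \<bullet> g" unfolding g_def by (rule goldstein_subgrad_inner)
  then have "(\<epsilon> / norm g) * (norm g)\<^sup>2 \<le> (\<epsilon> / norm g) * (v \<bullet> g)"
    using \<epsilon>(1) g by (intro mult_left_mono) auto
  then have "\<epsilon> * norm g \<le> (\<epsilon> / norm g) * (v \<bullet> g)"
    using g by (simp add: power2_eq_square)
  with fz show ?thesis
    unfolding bx by (simp add: b_def g_def)
qed

end

end

section \<open>Local geometry of a manifold\<close>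

text \<open>Continuity bounds the second derivative on a small ball by its norm at \<open>p\<close>
  plus 1. The mean value inequality for \<open>D\<close>, for \<open>g\<close>, and for
  \<open>g\<close> minus its linear part gives the rest.\<close>

lemma C2_on_local_estimates:
  fixes g :: "'a::real_normed_vector \<Rightarrow> 'b::real_normed_vector"
  assumes "C2_on S g" "open S" "p \<in> S"
  obtains D r \<Lambda> D2 where "r > 0" "\<Lambda> > 0" "ball p r \<subseteq> S"
    "\<And>x. x \<in> ball p r \<Longrightarrow> (g has_derivative blinfun_apply (D x)) (at x)"
    "\<And>x. x \<in> ball p r \<Longrightarrow> norm (D x) \<le> \<Lambda>"
    "\<And>x y. x \<in> ball p r \<Longrightarrow> y \<in> ball p r \<Longrightarrow> norm (D y - D x) \<le> \<Lambda> * norm (y - x)"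
    "\<And>x y. x \<in> ball p r \<Longrightarrow> y \<in> ball p r \<Longrightarrow> norm (g y - g x) \<le> \<Lambda> * norm (y - x)"
    "\<And>x y. x \<in> ball p r \<Longrightarrow> y \<in> ball p r \<Longrightarrow> norm (g y - g x - D x (y - x)) \<le> \<Lambda> * (norm (y - x))\<^sup>2"
    "(D has_derivative D2) (at p)"
proof -
  obtain D D2 where D: "\<And>x. x \<in> S \<Longrightarrow> (g has_derivative blinfun_apply (D x)) (at x)"
    and D2: "\<And>x. x \<in> S \<Longrightarrow> (D has_derivative blinfun_apply (D2 x)) (at x)" and cD2: "continuous_on S D2"
    using assms(1) unfolding C2_on_def by blast
  have "isCont D2 p"
    using cD2 assms(2,3) by (simp add: continuous_on_eq_continuous_at)
  then have "\<forall>\<^sub>F x in at p. norm (D2 x - D2 p) < 1"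
    unfolding isCont_def by (auto simp: tendsto_iff dist_norm)
  then obtain e where e: "e > 0" "\<And>x. dist x p < e \<Longrightarrow> norm (D2 x - D2 p) < 1"
    by (auto simp: eventually_at) (metis norm_zero diff_self zero_less_one)
  obtain e' where e': "e' > 0" "ball p e' \<subseteq> S" using assms(2,3) openE by blast
  define r where "r = min 1 (min e e')"
  define B where "B = norm (D2 p) + 1"
  define \<Lambda> where "\<Lambda> = max B (norm (D p) + B)"
  have r: "r > 0" "ball p r \<subseteq> S" "r \<le> 1" using e(1) e' by (auto simp: r_def)
  have B: "norm (D2 x) \<le> B" if "x \<in> ball p r" for x
    using e(2)[of x] that norm_triangle_sub[of "D2 x" "D2 p"] by (auto simp: r_def B_def dist_commute)
  have B0: "B > 0" by (simp add: B_def add_nonneg_pos)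
  have lipD: "norm (D y - D x) \<le> B * norm (y - x)" if "x \<in> ball p r" "y \<in> ball p r" for x y
  proof (rule differentiable_bound[OF convex_ball _ _ that(2,1)])
    show "(D has_derivative blinfun_apply (D2 z)) (at z within ball p r)" if "z \<in> ball p r" for z
      using that r(2) by (intro has_derivative_at_withinI[OF D2]) blast
  qed (use B in \<open>auto simp: norm_blinfun.rep_eq[symmetric]\<close>)
  have bD: "norm (D x) \<le> norm (D p) + B" if "x \<in> ball p r" for x
  proof -
    have "norm (D x - D p) \<le> B * norm (x - p)" using lipD[of p x] that r(1) by simp
    also have "\<dots> \<le> B * 1" using that r(3) B0 by (intro mult_left_mono) (auto simp: dist_norm norm_minus_commute)
    finally show ?thesis using norm_triangle_sub[of "D x" "D p"] by simp
  qed
  have lipg: "norm (g y - g x) \<le> (norm (D p) + B) * norm (y - x)" if "x \<in> ball p r" "y \<in> ball p r" for x y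
  proof (rule differentiable_bound[OF convex_ball _ _ that(2,1)])
    show "(g has_derivative blinfun_apply (D z)) (at z within ball p r)" if "z \<in> ball p r" for z
      using that r(2) by (intro has_derivative_at_withinI[OF D]) blast
  qed (use bD in \<open>auto simp: norm_blinfun.rep_eq[symmetric]\<close>)
  have taylor: "norm (g y - g x - D x (y - x)) \<le> B * (norm (y - x))\<^sup>2" if x: "x \<in> ball p r" and y: "y \<in> ball p r" for x y
  proof -
    \<comment> \<open>A convex set containing \<open>x\<close> and \<open>y\<close> on which
      \<open>D z - D x\<close> is at most \<open>B * norm (y - x)\<close>; this makes the remainder
      quadratic.\<close>
    define C where "C = ball p r \<inter> cball x (norm (y - x))"
    have "norm ((g y - D x y) - (g x - D x x)) \<le> (B * norm (y - x)) * norm (y - x)"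
    proof (rule differentiable_bound[where S = C and f' = "\<lambda>z. blinfun_apply (D z - D x)"])
      show "convex C" by (simp add: C_def convex_Int)
      show "((\<lambda>z. g z - D x z) has_derivative blinfun_apply (D z - D x)) (at z within C)" if "z \<in> C" for z
        using D[of z] that r(2) unfolding C_def blinfun.diff_left
        by (intro has_derivative_diff has_derivative_at_withinI[OF D] bounded_linear_imp_has_derivative[OF blinfun.bounded_linear_right]) auto
      show "onorm (blinfun_apply (D z - D x)) \<le> B * norm (y - x)" if "z \<in> C" for z
      proof -
        have "norm (D z - D x) \<le> B * norm (z - x)" using lipD[OF x, of z] that by (simp add: C_def)
        also have "\<dots> \<le> B * norm (y - x)"
          using that B0 by (intro mult_left_mono) (auto simp: C_def dist_norm norm_minus_commute)
        finally show ?thesis by (simp add: norm_blinfun.rep_eq)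
      qed
    qed (use x y in \<open>auto simp: C_def dist_norm norm_minus_commute\<close>)
    then show ?thesis by (simp add: blinfun.diff_right power2_eq_square algebra_simps)
  qed
  show ?thesis
  proof (rule that[of r \<Lambda> D "blinfun_apply (D2 p)"])
    show "\<Lambda> > 0" using B0 by (simp add: \<Lambda>_def add_nonneg_pos)
    show "(g has_derivative blinfun_apply (D x)) (at x)" if "x \<in> ball p r" for x
      using D that r(2) by auto
    show "norm (D x) \<le> \<Lambda>" if "x \<in> ball p r" for x
      using bD[OF that] by (simp add: \<Lambda>_def)
    show "norm (D y - D x) \<le> \<Lambda> * norm (y - x)" if "x \<in> ball p r" "y \<in> ball p r" for x y
      using lipD[OF that] by (rule order_trans) (simp add: \<Lambda>_def mult_right_mono)
    show "norm (g y - g x) \<le> \<Lambda> * norm (y - x)" if "x \<in> ball p r" "y \<in> ball p r" for x y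
      using lipg[OF that] by (rule order_trans) (simp add: \<Lambda>_def mult_right_mono)
    show "norm (g y - g x - D x (y - x)) \<le> \<Lambda> * (norm (y - x))\<^sup>2" if "x \<in> ball p r" "y \<in> ball p r" for x y
      using taylor[OF that] by (rule order_trans) (simp add: \<Lambda>_def mult_right_mono)
  qed (use r D2[OF assms(3)] in auto)
qed

text \<open>A chart with explicit radii and one constant \<Lambda> for every estimate.
  \<open>M\<close> is described only through the two balls, because it is arbitrary away from
  \<open>p\<close>.\<close>

locale C2_chart =
  fixes M :: "'a::euclidean_space set" and p :: 'a and \<Phi> \<Psi> :: "'a \<Rightarrow> 'a" and D\<Phi> D\<Psi> :: "'a \<Rightarrow> 'a \<Rightarrow>\<^sub>L 'a"
    and V :: "'a set" and s r \<Lambda> :: real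
  assumes p_in: "p \<in> M" and V: "subspace V" and pos: "s > 0" "r > 0" "\<Lambda> > 0"
    and into: "\<And>x. x \<in> ball p s \<Longrightarrow> \<Phi> x \<in> ball (\<Phi> p) r"
    and left_inv: "\<And>x. x \<in> ball p s \<Longrightarrow> \<Psi> (\<Phi> x) = x"
    and right_inv: "\<And>a. a \<in> ball (\<Phi> p) r \<Longrightarrow> \<Phi> (\<Psi> a) = a"
    and M_iff: "\<And>x. x \<in> ball p s \<Longrightarrow> x \<in> M \<longleftrightarrow> \<Phi> x \<in> V"
    and in_M: "\<And>a. a \<in> ball (\<Phi> p) r \<Longrightarrow> a \<in> V \<Longrightarrow> \<Psi> a \<in> M"
    and D\<Phi>: "\<And>x. x \<in> ball p s \<Longrightarrow> (\<Phi> has_derivative blinfun_apply (D\<Phi> x)) (at x)"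
    and D\<Psi>: "\<And>a. a \<in> ball (\<Phi> p) r \<Longrightarrow> (\<Psi> has_derivative blinfun_apply (D\<Psi> a)) (at a)"
    and D\<Phi>_le: "\<And>x. x \<in> ball p s \<Longrightarrow> norm (D\<Phi> x) \<le> \<Lambda>"
    and D\<Psi>_lip: "\<And>a b. a \<in> ball (\<Phi> p) r \<Longrightarrow> b \<in> ball (\<Phi> p) r \<Longrightarrow> norm (D\<Psi> b - D\<Psi> a) \<le> \<Lambda> * norm (b - a)"
    and \<Phi>_lip: "\<And>x y. x \<in> ball p s \<Longrightarrow> y \<in> ball p s \<Longrightarrow> norm (\<Phi> y - \<Phi> x) \<le> \<Lambda> * norm (y - x)"
    and \<Psi>_lip: "\<And>a b. a \<in> ball (\<Phi> p) r \<Longrightarrow> b \<in> ball (\<Phi> p) r \<Longrightarrow> norm (\<Psi> b - \<Psi> a) \<le> \<Lambda> * norm (b - a)"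
    and \<Psi>_taylor: "\<And>a b. a \<in> ball (\<Phi> p) r \<Longrightarrow> b \<in> ball (\<Phi> p) r \<Longrightarrow>
      norm (\<Psi> b - \<Psi> a - D\<Psi> a (b - a)) \<le> \<Lambda> * (norm (b - a))\<^sup>2"
    and D\<Psi>_diff: "D\<Psi> differentiable (at (\<Phi> p))"

lemma C2_manifold_around_chart:
  fixes M :: "'a::euclidean_space set"
  assumes "C2_manifold_around M p"
  obtains \<Phi> \<Psi> D\<Phi> D\<Psi> V s r \<Lambda> where "C2_chart M p \<Phi> \<Psi> D\<Phi> D\<Psi> V s r \<Lambda>"
proof -
  obtain U and \<Phi> \<Psi> :: "'a \<Rightarrow> 'a" and V where "p \<in> M" and U: "open U" "p \<in> U" and W: "open (\<Phi> ` U)"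
    and C: "C2_on U \<Phi>" "C2_on (\<Phi> ` U) \<Psi>" and inv': "\<forall>x\<in>U. \<Psi> (\<Phi> x) = x"
    and V: "subspace V" "\<Phi> ` (M \<inter> U) = V \<inter> \<Phi> ` U"
    using assms unfolding C2_manifold_around_def by (elim conjE exE) (rule that, assumption+)
  then have inv: "\<Psi> (\<Phi> x) = x" if "x \<in> U" for x using that by blast
  obtain D\<Psi> r \<Lambda>1 D2 where \<Psi>: "r > 0" "\<Lambda>1 > 0" "ball (\<Phi> p) r \<subseteq> \<Phi> ` U"
    "\<And>x. x \<in> ball (\<Phi> p) r \<Longrightarrow> (\<Psi> has_derivative blinfun_apply (D\<Psi> x)) (at x)"
    "\<And>x. x \<in> ball (\<Phi> p) r \<Longrightarrow> norm (D\<Psi> x) \<le> \<Lambda>1"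
    "\<And>x y. x \<in> ball (\<Phi> p) r \<Longrightarrow> y \<in> ball (\<Phi> p) r \<Longrightarrow> norm (D\<Psi> y - D\<Psi> x) \<le> \<Lambda>1 * norm (y - x)"
    "\<And>x y. x \<in> ball (\<Phi> p) r \<Longrightarrow> y \<in> ball (\<Phi> p) r \<Longrightarrow> norm (\<Psi> y - \<Psi> x) \<le> \<Lambda>1 * norm (y - x)"
    "\<And>x y. x \<in> ball (\<Phi> p) r \<Longrightarrow> y \<in> ball (\<Phi> p) r \<Longrightarrow> norm (\<Psi> y - \<Psi> x - D\<Psi> x (y - x)) \<le> \<Lambda>1 * (norm (y - x))\<^sup>2"
    "(D\<Psi> has_derivative D2) (at (\<Phi> p))"
    using U(2) by (rule C2_on_local_estimates[OF C(2) W imageI]) (rule that, assumption+)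
  obtain D\<Phi> s0 \<Lambda>2 D2' where \<Phi>: "s0 > 0" "\<Lambda>2 > 0" "ball p s0 \<subseteq> U"
    "\<And>x. x \<in> ball p s0 \<Longrightarrow> (\<Phi> has_derivative blinfun_apply (D\<Phi> x)) (at x)"
    "\<And>x. x \<in> ball p s0 \<Longrightarrow> norm (D\<Phi> x) \<le> \<Lambda>2"
    "\<And>x y. x \<in> ball p s0 \<Longrightarrow> y \<in> ball p s0 \<Longrightarrow> norm (D\<Phi> y - D\<Phi> x) \<le> \<Lambda>2 * norm (y - x)"
    "\<And>x y. x \<in> ball p s0 \<Longrightarrow> y \<in> ball p s0 \<Longrightarrow> norm (\<Phi> y - \<Phi> x) \<le> \<Lambda>2 * norm (y - x)"
    "\<And>x y. x \<in> ball p s0 \<Longrightarrow> y \<in> ball p s0 \<Longrightarrow> norm (\<Phi> y - \<Phi> x - D\<Phi> x (y - x)) \<le> \<Lambda>2 * (norm (y - x))\<^sup>2"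
    "(D\<Phi> has_derivative D2') (at p)"
    by (rule C2_on_local_estimates[OF C(1) U]) (rule that, assumption+)
  \<comment> \<open>The entry \<open>r / \<Lambda>2\<close> makes \<Phi> map the ball into the one
    on which \<Psi> is estimated.\<close>
  define s where "s = min s0 (r / \<Lambda>2)"
  define \<Lambda> where "\<Lambda> = max \<Lambda>1 \<Lambda>2"
  have sub: "x \<in> ball p s0" "x \<in> U" if "x \<in> ball p s" for x
    using that \<Phi>(3) by (auto simp: s_def)
  have into: "\<Phi> x \<in> ball (\<Phi> p) r" if "x \<in> ball p s" for x
  proof -
    have "norm (\<Phi> x - \<Phi> p) \<le> \<Lambda>2 * norm (x - p)" using \<Phi>(7)[of p x] sub[OF that] \<Phi>(1) by auto
    also have "\<dots> < \<Lambda>2 * (r / \<Lambda>2)"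
      using that \<Phi>(2) by (intro mult_strict_left_mono) (auto simp: s_def dist_norm norm_minus_commute)
    finally show ?thesis using \<Phi>(2) by (simp add: dist_norm norm_minus_commute)
  qed
  have mono: "a \<le> \<Lambda>1 * b \<Longrightarrow> 0 \<le> b \<Longrightarrow> a \<le> \<Lambda> * b" "a \<le> \<Lambda>2 * b \<Longrightarrow> 0 \<le> b \<Longrightarrow> a \<le> \<Lambda> * b" for a b
    by (rule order_trans, assumption, simp add: \<Lambda>_def mult_right_mono)+
  have "C2_chart M p \<Phi> \<Psi> D\<Phi> D\<Psi> V s r \<Lambda>"
  proof
    show "p \<in> M" "subspace V" "r > 0" by fact+
    show "s > 0" "\<Lambda> > 0" using \<Phi>(1,2) \<Psi>(1) by (auto simp: s_def \<Lambda>_def)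
    show "\<Phi> x \<in> ball (\<Phi> p) r" if "x \<in> ball p s" for x by (rule into[OF that])
    show "\<Psi> (\<Phi> x) = x" if "x \<in> ball p s" for x using inv sub(2)[OF that] .
    show "\<Phi> (\<Psi> a) = a" if "a \<in> ball (\<Phi> p) r" for a
      using that \<Psi>(3) inv by force
    show "x \<in> M \<longleftrightarrow> \<Phi> x \<in> V" if "x \<in> ball p s" for x
    proof
      show "\<Phi> x \<in> V" if "x \<in> M" using that sub(2)[OF \<open>x \<in> ball p s\<close>] V(2) by blast
      assume "\<Phi> x \<in> V"
      then have "\<Phi> x \<in> \<Phi> ` (M \<inter> U)" using sub(2)[OF that] V(2) by blast
      then obtain m where "m \<in> M" "m \<in> U" "\<Phi> x = \<Phi> m" by blast
      then show "x \<in> M" using inv sub(2)[OF that] by metis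
    qed
    show "\<Psi> a \<in> M" if "a \<in> ball (\<Phi> p) r" "a \<in> V" for a
    proof -
      have "a \<in> \<Phi> ` (M \<inter> U)" using that \<Psi>(3) V(2) by blast
      then show ?thesis using inv by auto
    qed
    show "(\<Phi> has_derivative blinfun_apply (D\<Phi> x)) (at x)" if "x \<in> ball p s" for x
      using \<Phi>(4) sub(1)[OF that] .
    show "(\<Psi> has_derivative blinfun_apply (D\<Psi> a)) (at a)" if "a \<in> ball (\<Phi> p) r" for a
      using \<Psi>(4) that .
    show "norm (D\<Phi> x) \<le> \<Lambda>" if "x \<in> ball p s" for x
      using \<Phi>(5)[OF sub(1)[OF that]] by (simp add: \<Lambda>_def)
    show "norm (D\<Psi> b - D\<Psi> a) \<le> \<Lambda> * norm (b - a)" if "a \<in> ball (\<Phi> p) r" "b \<in> ball (\<Phi> p) r" for a b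
      using \<Psi>(6)[OF that] by (rule mono) simp
    show "norm (\<Phi> y - \<Phi> x) \<le> \<Lambda> * norm (y - x)" if "x \<in> ball p s" "y \<in> ball p s" for x y
      using \<Phi>(7)[OF sub(1)[OF that(1)] sub(1)[OF that(2)]] by (rule mono) simp
    show "norm (\<Psi> b - \<Psi> a) \<le> \<Lambda> * norm (b - a)" if "a \<in> ball (\<Phi> p) r" "b \<in> ball (\<Phi> p) r" for a b
      using \<Psi>(7)[OF that] by (rule mono) simp
    show "norm (\<Psi> b - \<Psi> a - D\<Psi> a (b - a)) \<le> \<Lambda> * (norm (b - a))\<^sup>2" if "a \<in> ball (\<Phi> p) r" "b \<in> ball (\<Phi> p) r" for a b
      using \<Psi>(8)[OF that] by (rule mono) simp
    show "D\<Psi> differentiable (at (\<Phi> p))" using \<Psi>(9) by (rule differentiableI)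
  qed
  then show ?thesis by (rule that)
qed

text \<open>Along a curve in \<open>M\<close> through \<open>y\<close> the squared distance to
  \<open>x\<close> is minimal at parameter 0, so its derivative vanishes there.\<close>

lemma nearest_point_normal:
  assumes near: "\<And>z. z \<in> M \<Longrightarrow> dist x y \<le> dist x z" and w: "w \<in> tangent_space M y"
  shows "(x - y) \<bullet> w = 0"
proof -
  obtain c \<eta> where c: "\<eta> > 0" "c ` {-\<eta><..<\<eta>} \<subseteq> M" "c 0 = y" "(c has_vector_derivative w) (at 0)"
    using w unfolding tangent_space_def C1_curve_in_def by blast
  have der: "((\<lambda>t. (x - c t) \<bullet> (x - c t)) has_derivative (\<lambda>t. (x - c 0) \<bullet> (0 - t *\<^sub>R w) + (0 - t *\<^sub>R w) \<bullet> (x - c 0))) (at 0)"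
    by (intro derivative_intros c(4)[unfolded has_vector_derivative_def])
  have eq: "(\<lambda>t. (x - c 0) \<bullet> (0 - t *\<^sub>R w) + (0 - t *\<^sub>R w) \<bullet> (x - c 0)) = (*) (- 2 * ((x - y) \<bullet> w))"
    by (rule ext) (simp add: c(3) inner_commute algebra_simps)
  have "((\<lambda>t. (x - c t) \<bullet> (x - c t)) has_real_derivative - 2 * ((x - y) \<bullet> w)) (at 0)"
    unfolding has_field_derivative_def using der unfolding eq .
  moreover have "(x - c 0) \<bullet> (x - c 0) \<le> (x - c t) \<bullet> (x - c t)" if "\<bar>0 - t\<bar> < \<eta>" for t
  proof -
    have "c t \<in> M" using c(2) that by (auto simp: abs_less_iff)
    from near[OF this] show ?thesis
      by (simp add: c(3) dist_norm norm_le)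
  qed
  ultimately have "- 2 * ((x - y) \<bullet> w) = 0"
    using c(1) by (intro DERIV_local_min[of _ _ 0 \<eta>]) auto
  then show ?thesis by simp
qed

section \<open>Tangent spaces and nearest points in a chart\<close>

context C2_chart begin

lemma \<Psi>_p: "\<Psi> (\<Phi> p) = p"
  using left_inv pos(1) by simp

lemma D\<Psi>_D\<Phi>:
  assumes "x \<in> ball p s"
  shows "D\<Psi> (\<Phi> x) (D\<Phi> x w) = w"
proof -
  have "((\<lambda>x. \<Psi> (\<Phi> x)) has_derivative (\<lambda>w. D\<Psi> (\<Phi> x) (D\<Phi> x w))) (at x)"
    by (rule has_derivative_compose[OF D\<Phi>[OF assms] D\<Psi>[OF into[OF assms]]])
  then have "((\<lambda>x. x) has_derivative (\<lambda>w. D\<Psi> (\<Phi> x) (D\<Phi> x w))) (at x)"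
    by (rule has_derivative_transform_within_open[OF _ open_ball assms]) (rule left_inv)
  from has_derivative_unique[OF this has_derivative_ident] show ?thesis by metis
qed

text \<open>The difference quotients of \<Phi> along a curve in \<open>M\<close> lie in
  \<open>V\<close>, and \<open>V\<close> is closed, so their limit lies in \<open>V\<close>
  too.\<close>

lemma tangent_space_subset:
  assumes y: "y \<in> M" "y \<in> ball p s" and w: "w \<in> tangent_space M y"
  shows "D\<Phi> y w \<in> V"
proof -
  obtain c \<eta> where c: "\<eta> > 0" "c ` {-\<eta><..<\<eta>} \<subseteq> M" "c 0 = y" "(c has_vector_derivative w) (at 0)"
    using w unfolding tangent_space_def C1_curve_in_def by blast
  have "(\<Phi> has_derivative blinfun_apply (D\<Phi> y)) (at (c 0))" using D\<Phi>[OF y(2)] by (simp add: c(3))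
  from has_derivative_compose[OF c(4)[unfolded has_vector_derivative_def] this]
  have "(\<lambda>t. norm (\<Phi> (c (0 + t)) - \<Phi> (c 0) - D\<Phi> y (t *\<^sub>R w)) / norm t) \<midarrow>0\<rightarrow> 0"
    unfolding has_derivative_at by blast
  then have "(\<lambda>t. norm (\<Phi> (c t) - \<Phi> y - t *\<^sub>R D\<Phi> y w) / norm t) \<midarrow>0\<rightarrow> 0"
    by (simp add: c(3) blinfun.scaleR_right)
  moreover have "\<forall>\<^sub>F t in at 0. norm (\<Phi> (c t) - \<Phi> y - t *\<^sub>R D\<Phi> y w) / norm t =
      norm ((1 / t) *\<^sub>R (\<Phi> (c t) - \<Phi> y) - D\<Phi> y w)"
  proof (rule eventually_mono[of "\<lambda>t. t \<noteq> 0"])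
    fix t :: real assume t: "t \<noteq> 0"
    have "\<Phi> (c t) - \<Phi> y - t *\<^sub>R D\<Phi> y w = t *\<^sub>R ((1 / t) *\<^sub>R (\<Phi> (c t) - \<Phi> y) - D\<Phi> y w)"
      using t by (simp add: scaleR_diff_right)
    then show "norm (\<Phi> (c t) - \<Phi> y - t *\<^sub>R D\<Phi> y w) / norm t =
      norm ((1 / t) *\<^sub>R (\<Phi> (c t) - \<Phi> y) - D\<Phi> y w)" using t by simp
  qed (simp add: eventually_at_filter)
  ultimately have "(\<lambda>t. norm ((1 / t) *\<^sub>R (\<Phi> (c t) - \<Phi> y) - D\<Phi> y w)) \<midarrow>0\<rightarrow> 0"
    by (rule Lim_transform_eventually)
  then have lim: "(\<lambda>t. (1 / t) *\<^sub>R (\<Phi> (c t) - \<Phi> y)) \<midarrow>0\<rightarrow> D\<Phi> y w"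
    by (rule Lim_null[THEN iffD2, OF tendsto_norm_zero_cancel])
  have "isCont c 0" using has_vector_derivative_continuous[OF c(4)] .
  then have "\<forall>\<^sub>F t in at 0. c t \<in> ball p s"
    unfolding isCont_def using y(2) c(3) by (intro topological_tendstoD) auto
  moreover have "\<forall>\<^sub>F t in at 0. c t \<in> M"
    using c(1,2) unfolding eventually_at by (intro exI[of _ \<eta>]) (auto simp: dist_real_def abs_less_iff)
  ultimately have "\<forall>\<^sub>F t in at 0. (1 / t) *\<^sub>R (\<Phi> (c t) - \<Phi> y) \<in> V"
  proof eventually_elim
    case (elim t)
    then show ?case
      using M_iff y V by (intro subspace_scale subspace_diff) auto
  qed
  then show ?thesis
    by (rule Lim_in_closed_set[OF closed_subspace[OF V] _ _ lim]) simp
qed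

text \<open>Straight lines in \<open>V\<close>, pulled back by \<Psi>, realize every image of a
  vector of \<open>V\<close> as a tangent vector.\<close>

lemma chart_curve:
  assumes y: "y \<in> M" "y \<in> ball p s" and b: "b \<in> V"
  shows "C1_curve_in M y (D\<Psi> (\<Phi> y) b) (\<lambda>t. \<Psi> (\<Phi> y + t *\<^sub>R b))"
proof -
  define a where "a = \<Phi> y"
  have a: "a \<in> V" "a \<in> ball (\<Phi> p) r" using M_iff[OF y(2)] y(1) into[OF y(2)] by (auto simp: a_def)
  define \<eta> where "\<eta> = (r - dist (\<Phi> p) a) / (norm b + 1)"
  have \<eta>: "\<eta> > 0" using a(2) by (simp add: \<eta>_def add_nonneg_pos)
  have ball: "a + t *\<^sub>R b \<in> ball (\<Phi> p) r" if "t \<in> {-\<eta><..<\<eta>}" for t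
  proof -
    have "\<bar>t\<bar> * norm b \<le> \<bar>t\<bar> * (norm b + 1)" by (intro mult_left_mono) auto
    also have "\<dots> < \<eta> * (norm b + 1)"
      using that by (intro mult_strict_right_mono) (auto simp: abs_less_iff add_nonneg_pos)
    also have "\<dots> = r - dist (\<Phi> p) a"
    proof -
      have "norm b + 1 \<noteq> 0" using norm_ge_zero[of b] by linarith
      then show ?thesis by (simp add: \<eta>_def)
    qed
    finally show ?thesis
      using dist_triangle[of "\<Phi> p" "a + t *\<^sub>R b" a] by (simp add: dist_norm[of a])
  qed
  have der: "((\<lambda>t. \<Psi> (a + t *\<^sub>R b)) has_vector_derivative D\<Psi> (a + t *\<^sub>R b) b) (at t)" if "t \<in> {-\<eta><..<\<eta>}" for t
  proof -
    have "((\<lambda>t. a + t *\<^sub>R b) has_derivative (\<lambda>h. h *\<^sub>R b)) (at t)"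
      by (auto intro!: derivative_eq_intros)
    from has_derivative_compose[OF this D\<Psi>[OF ball[OF that]]] show ?thesis
      by (simp add: has_vector_derivative_def blinfun.scaleR_right)
  qed
  have "\<Lambda>-lipschitz_on (ball (\<Phi> p) r) D\<Psi>"
    using D\<Psi>_lip pos(3) by (intro lipschitz_onI) (auto simp: dist_norm)
  then have "continuous_on (ball (\<Phi> p) r) D\<Psi>" by (rule lipschitz_on_continuous_on)
  then have "continuous_on {-\<eta><..<\<eta>} (\<lambda>t. D\<Psi> (a + t *\<^sub>R b))"
    by (rule continuous_on_compose2) (use ball in \<open>auto intro!: continuous_intros\<close>)
  then have "continuous_on {-\<eta><..<\<eta>} (\<lambda>t. D\<Psi> (a + t *\<^sub>R b) b)"
    by (intro continuous_intros)
  then have "(\<lambda>t. \<Psi> (a + t *\<^sub>R b)) C1_differentiable_on {-\<eta><..<\<eta>}"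
    unfolding C1_differentiable_on_def using der by (intro exI[of _ "\<lambda>t. D\<Psi> (a + t *\<^sub>R b) b"]) auto
  moreover have "(\<lambda>t. \<Psi> (a + t *\<^sub>R b)) ` {-\<eta><..<\<eta>} \<subseteq> M"
  proof (intro image_subsetI in_M)
    show "a + t *\<^sub>R b \<in> ball (\<Phi> p) r" if "t \<in> {-\<eta><..<\<eta>}" for t by (rule ball[OF that])
    show "a + t *\<^sub>R b \<in> V" for t using a(1) b V by (intro subspace_add subspace_scale)
  qed
  ultimately show ?thesis
    unfolding C1_curve_in_def a_def[symmetric] using \<eta> der[of 0] left_inv[OF y(2)]
    by (auto simp: a_def)
qed

lemma tangent_space_eq:
  assumes y: "y \<in> M" "y \<in> ball p s"
  shows "tangent_space M y = blinfun_apply (D\<Psi> (\<Phi> y)) ` V"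
proof
  show "tangent_space M y \<subseteq> blinfun_apply (D\<Psi> (\<Phi> y)) ` V"
    using tangent_space_subset[OF y] D\<Psi>_D\<Phi>[OF y(2)] by (metis image_iff subsetI)
  show "blinfun_apply (D\<Psi> (\<Phi> y)) ` V \<subseteq> tangent_space M y"
    using chart_curve[OF y] unfolding tangent_space_def by blast
qed

lemma subspace_tangent_space:
  assumes "y \<in> M" "y \<in> ball p s"
  shows "subspace (tangent_space M y)"
  unfolding tangent_space_eq[OF assms]
  by (rule linear_subspace_image[OF bounded_linear.linear[OF blinfun.bounded_linear_right] V])

text \<open>\<open>M\<close> need not be closed, but its part in the closed ball of radius
  \<open>s / 2\<close> is. Points of \<open>M\<close> outside that ball lose against
  \<open>p\<close> itself, as \<open>x\<close> is within \<open>s / 4\<close> of \<open>p\<close>.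
  Hence the choice in \<open>closest_point\<close> has a witness.\<close>

lemma nearest_point:
  assumes x: "x \<in> ball p (s / 4)"
  shows "closest_point M x \<in> M" "z \<in> M \<Longrightarrow> dist x (closest_point M x) \<le> dist x z"
proof -
  define K where "K = cball p (s/2) \<inter> \<Phi> -` V"
  have sub: "cball p (s/2) \<subseteq> ball p s" using pos(1) by auto
  have "\<Lambda>-lipschitz_on (ball p s) \<Phi>"
    using \<Phi>_lip pos(3) by (intro lipschitz_onI) (auto simp: dist_norm)
  then have "continuous_on (cball p (s/2)) \<Phi>"
    using lipschitz_on_continuous_on continuous_on_subset sub by blast
  then have "closed K"
    unfolding K_def by (rule continuous_closed_preimage[OF _ closed_cball closed_subspace[OF V]])
  have KM: "K \<subseteq> M" "z \<in> M \<Longrightarrow> z \<in> cball p (s/2) \<Longrightarrow> z \<in> K" for z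
    using sub M_iff unfolding K_def by blast+
  then have pK: "p \<in> K" using p_in pos(1) by auto
  with \<open>closed K\<close> obtain y where y: "y \<in> K" "\<And>z. z \<in> K \<Longrightarrow> dist x y \<le> dist x z"
    using distance_attains_inf[of K x] by blast
  have "dist x y \<le> dist x z" if "z \<in> M" for z
  proof (cases "z \<in> cball p (s/2)")
    case False
    have "dist x y \<le> dist x p" by (rule y(2)[OF pK])
    moreover have "dist p z \<le> dist x p + dist x z"
      using dist_triangle[of p z x] by (simp add: dist_commute)
    ultimately show ?thesis using False x by (simp add: dist_commute)
  qed (use KM(2) that y(2) in blast)
  then have ex: "\<exists>y. y \<in> M \<and> (\<forall>z\<in>M. dist x y \<le> dist x z)" using y(1) KM(1) by blast
  show "closest_point M x \<in> M" "z \<in> M \<Longrightarrow> dist x (closest_point M x) \<le> dist x z"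
    using someI_ex[OF ex] unfolding closest_point_def by blast+
qed

lemma infdist_nearest_point:
  assumes "x \<in> ball p (s / 4)"
  shows "infdist x M = dist x (closest_point M x)"
proof (rule antisym)
  show "infdist x M \<le> dist x (closest_point M x)"
    using nearest_point(1)[OF assms] by (rule infdist_le)
  show "dist x (closest_point M x) \<le> infdist x M"
    using nearest_point(2)[OF assms] p_in unfolding infdist_def by (auto intro!: cINF_greatest)
qed

lemma nearest_point_dist:
  assumes "x \<in> ball p (s / 4)"
  shows "dist x (closest_point M x) \<le> dist p x" "dist p (closest_point M x) \<le> 2 * dist p x"
    "closest_point M x \<in> ball p s"
proof -
  show 1: "dist x (closest_point M x) \<le> dist p x"
    using nearest_point(2)[OF assms p_in] by (simp add: dist_commute)
  then show 2: "dist p (closest_point M x) \<le> 2 * dist p x"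
    using dist_triangle[of p "closest_point M x" x] by simp
  then show "closest_point M x \<in> ball p s"
    using assms zero_le_dist[of p x] unfolding mem_ball by linarith
qed

text \<open>A normal vector at \<open>y\<close> sees only the deviation of \<open>M\<close> from its
  tangent space, which is quadratic: one factor \<Lambda> comes from the Taylor bound of \<Psi>, two
  from the squared Lipschitz bound of \<Phi>.\<close>

lemma normal_inner_le:
  assumes y: "y \<in> M" "y \<in> ball p s" and y': "y' \<in> M" "y' \<in> ball p s"
    and n: "\<And>w. w \<in> tangent_space M y \<Longrightarrow> n \<bullet> w = 0"
  shows "n \<bullet> (y' - y) \<le> \<Lambda> ^ 3 * norm n * (norm (y' - y))\<^sup>2"
proof -
  define u where "u = \<Phi> y' - \<Phi> y"
  define e where "e = y' - y - D\<Psi> (\<Phi> y) u"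
  have "u \<in> V" unfolding u_def using M_iff y y' V by (intro subspace_diff) auto
  then have "n \<bullet> D\<Psi> (\<Phi> y) u = 0" using n tangent_space_eq[OF y] by blast
  then have "n \<bullet> (y' - y) = n \<bullet> e" by (simp add: e_def inner_diff_right)
  also have "\<dots> \<le> norm n * norm e" by (rule norm_cauchy_schwarz)
  also have "norm n * norm e \<le> norm n * (\<Lambda> * (\<Lambda> * norm (y' - y))\<^sup>2)"
  proof (rule mult_left_mono[OF _ norm_ge_zero])
    have "norm e \<le> \<Lambda> * (norm u)\<^sup>2"
      using \<Psi>_taylor[OF into[OF y(2)] into[OF y'(2)]] left_inv[OF y(2)] left_inv[OF y'(2)]
      by (simp add: e_def u_def)
    also have "\<dots> \<le> \<Lambda> * (\<Lambda> * norm (y' - y))\<^sup>2"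
      using \<Phi>_lip[OF y(2) y'(2)] pos(3) by (intro mult_left_mono power_mono) (auto simp: u_def)
    finally show "norm e \<le> \<Lambda> * (\<Lambda> * norm (y' - y))\<^sup>2" .
  qed
  finally show ?thesis
    by (simp add: power_mult_distrib power3_eq_cube power2_eq_square mult_ac)
qed

text \<open>Each point minus its projection is normal to \<open>M\<close>. Adding the two estimates
  for normals, each with constant 1/4, bounds half the squared distance between the projections by
  an inner product with \<open>z - x\<close>.\<close>

lemma closest_point_lipschitz_near:
  obtains s1 where "s1 > 0" "s1 \<le> s / 4"
    "\<And>x z. x \<in> ball p s1 \<Longrightarrow> z \<in> ball p s1 \<Longrightarrow> norm (closest_point M x - closest_point M z) \<le> 2 * norm (x - z)"
proof -
  \<comment> \<open>The second entry offsets the curvature constant \<open>\<Lambda> ^ 3\<close> of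
    \<open>normal_inner_le\<close> and leaves 1/4.\<close>
  define s1 where "s1 = min (s / 4) (1 / (4 * \<Lambda> ^ 3))"
  have s1: "s1 > 0" "s1 \<le> s / 4" "\<Lambda> ^ 3 * s1 \<le> 1 / 4"
  proof -
    show "s1 > 0" "s1 \<le> s / 4" using pos by (auto simp: s1_def)
    have "\<Lambda> ^ 3 * s1 \<le> \<Lambda> ^ 3 * (1 / (4 * \<Lambda> ^ 3))"
      using pos(3) by (intro mult_left_mono) (auto simp: s1_def)
    then show "\<Lambda> ^ 3 * s1 \<le> 1 / 4" using pos(3) by simp
  qed
  have half: "(x - closest_point M x) \<bullet> (closest_point M z - closest_point M x)
      \<le> 1 / 4 * (norm (closest_point M z - closest_point M x))\<^sup>2"
    if "x \<in> ball p s1" "z \<in> ball p s1" for x z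
  proof -
    have x: "x \<in> ball p (s/4)" and z: "z \<in> ball p (s/4)" using that s1(2) by auto
    have "(x - closest_point M x) \<bullet> (closest_point M z - closest_point M x)
      \<le> \<Lambda> ^ 3 * norm (x - closest_point M x) * (norm (closest_point M z - closest_point M x))\<^sup>2"
      using nearest_point_normal[OF nearest_point(2)[OF x]]
      by (intro normal_inner_le nearest_point(1) nearest_point_dist(3) x z) auto
    also have "\<Lambda> ^ 3 * norm (x - closest_point M x) \<le> \<Lambda> ^ 3 * s1"
      using nearest_point_dist(1)[OF x] that(1) pos(3) by (intro mult_left_mono) (auto simp: dist_norm)
    also have "\<dots> \<le> 1 / 4" by (rule s1(3))
    finally show ?thesis by (simp add: mult_right_mono)
  qed
  show ?thesis
  proof (rule that[OF s1(1,2)])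
    fix x z assume xz: "x \<in> ball p s1" "z \<in> ball p s1"
    define y y' where "y = closest_point M x" and "y' = closest_point M z"
    have "(x - y) \<bullet> (y' - y) \<le> 1 / 4 * (norm (y' - y))\<^sup>2" "(z - y') \<bullet> (y - y') \<le> 1 / 4 * (norm (y' - y))\<^sup>2"
      using half[OF xz] half[OF xz(2,1)] by (simp_all add: y_def y'_def norm_minus_commute)
    moreover have "(x - y) \<bullet> (y' - y) + (z - y') \<bullet> (y - y') = (norm (y' - y))\<^sup>2 - (z - x) \<bullet> (y' - y)"
      by (simp add: power2_norm_eq_inner algebra_simps inner_commute)
    ultimately have "(norm (y' - y))\<^sup>2 \<le> 2 * ((z - x) \<bullet> (y' - y))" by linarith
    also have "\<dots> \<le> 2 * (norm (z - x) * norm (y' - y))" using norm_cauchy_schwarz by simp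
    finally have "norm (y' - y) * norm (y' - y) \<le> (2 * norm (z - x)) * norm (y' - y)"
      by (simp add: power2_eq_square)
    then have "norm (y' - y) \<le> 2 * norm (z - x)"
      by (cases "norm (y' - y) = 0") auto
    then show "norm (closest_point M x - closest_point M z) \<le> 2 * norm (x - z)"
      by (simp add: y_def y'_def norm_minus_commute)
  qed
qed

text \<open>The gradient of a local extension \<open>h\<close> splits into a tangential and a normal
  part, and curves in \<open>M\<close> see only the former. Testing a candidate against its
  difference from this part, again a tangent vector, gives the uniqueness that the definite
  description needs.\<close>

lemma riemannian_grad_inner:
  assumes y: "y \<in> M" "y \<in> ball p s" and N: "open N" "y \<in> N" "\<And>x. x \<in> M \<Longrightarrow> x \<in> N \<Longrightarrow> h x = f x"
    and Dh: "(h has_derivative Dh) (at y)"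
  shows "riemannian_grad M f y \<in> tangent_space M y"
    and "w \<in> tangent_space M y \<Longrightarrow> riemannian_grad M f y \<bullet> w = Dh w"
proof -
  define T where "T = tangent_space M y"
  have T: "subspace T" unfolding T_def by (rule subspace_tangent_space[OF y])
  interpret Dh: bounded_linear Dh using Dh by (rule has_derivative_bounded_linear)
  \<comment> \<open>\<open>adjoint Dh 1\<close> is the gradient of \<open>h\<close> at
    \<open>y\<close>.\<close>
  have "Dh v = v \<bullet> adjoint Dh 1" for v
    using adjoint_works[OF Dh.linear_axioms, of v 1] by simp
  then obtain g where g: "\<And>v. Dh v = v \<bullet> g" by blast
  obtain G n where G: "G \<in> span T" and n: "\<And>w. w \<in> span T \<Longrightarrow> orthogonal n w" and gGn: "g = G + n"
    using orthogonal_subspace_decomp_exists[of T g] by blast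
  have spanT: "span T = T" using T by (rule span_eq_iff[THEN iffD2])
  have Gw: "Dh w = G \<bullet> w" if "w \<in> T" for w
    using n[of w] that unfolding spanT g gGn by (simp add: inner_commute inner_add_right orthogonal_def)
  have curve: "((\<lambda>t. f (c t)) has_real_derivative Dh w) (at 0)" if c: "C1_curve_in M y w c" for w c
  proof -
    obtain \<eta> where \<eta>: "\<eta> > 0" "c ` {-\<eta><..<\<eta>} \<subseteq> M" and c0: "c 0 = y" and cw: "(c has_vector_derivative w) (at 0)"
      using c unfolding C1_curve_in_def by blast
    have "(h has_derivative Dh) (at (c 0))" using Dh c0 by simp
    from has_derivative_compose[OF cw[unfolded has_vector_derivative_def] this]
    have hc: "((\<lambda>t. h (c t)) has_real_derivative Dh w) (at 0)"
      unfolding has_field_derivative_def by (simp add: Dh.scaleR mult_commute_abs)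
    have "isCont c 0" using has_vector_derivative_continuous[OF cw] .
    then have "\<forall>\<^sub>F t in nhds 0. c t \<in> N"
      unfolding isCont_def tendsto_at_iff_tendsto_nhds
      by (rule topological_tendstoD[OF _ N(1)]) (simp add: c0 N(2))
    moreover have "\<forall>\<^sub>F t in nhds 0. c t \<in> M"
      using \<eta> unfolding eventually_nhds_metric by (intro exI[of _ \<eta>]) (auto simp: dist_real_def abs_less_iff)
    ultimately have "\<forall>\<^sub>F t in nhds 0. h (c t) = f (c t)"
      by eventually_elim (rule N(3))
    then show ?thesis
      using hc by (simp add: DERIV_cong_ev[OF refl _ refl])
  qed
  have "riemannian_grad M f y = G"
    unfolding riemannian_grad_def T_def[symmetric]
  proof (rule the_equality)
    show "G \<in> T \<and> (\<forall>w c. C1_curve_in M y w c \<longrightarrow> ((\<lambda>t. f (c t)) has_real_derivative G \<bullet> w) (at 0))"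
    proof (intro conjI allI impI)
      show "G \<in> T" using G spanT by simp
      fix w c assume c: "C1_curve_in M y w c"
      then have "w \<in> T" unfolding T_def tangent_space_def by blast
      then show "((\<lambda>t. f (c t)) has_real_derivative G \<bullet> w) (at 0)"
        using curve[OF c] Gw by simp
    qed
  next
    fix v assume v: "v \<in> T \<and> (\<forall>w c. C1_curve_in M y w c \<longrightarrow> ((\<lambda>t. f (c t)) has_real_derivative v \<bullet> w) (at 0))"
    have "v - G \<in> T" using v G spanT T by (auto intro: subspace_diff)
    then obtain c where c: "C1_curve_in M y (v - G) c" unfolding T_def tangent_space_def by blast
    then have "v \<bullet> (v - G) = Dh (v - G)"
      using v curve[OF c] DERIV_unique by blast
    also have "\<dots> = G \<bullet> (v - G)" using Gw \<open>v - G \<in> T\<close> by simp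
    finally have "(v - G) \<bullet> (v - G) = 0" by (simp add: inner_diff_left)
    then show "v = G" by simp
  qed
  then show "riemannian_grad M f y \<in> tangent_space M y"
    and "w \<in> tangent_space M y \<Longrightarrow> riemannian_grad M f y \<bullet> w = Dh w"
    using G[unfolded spanT] Gw by (simp_all add: T_def)
qed

end

section \<open>The Riemannian gradient under quadratic growth\<close>

context C2_chart begin

text \<open>In the chart, \<open>f\<close> on \<open>M\<close> becomes \<open>q\<close> on the
  linear space \<open>V\<close>, with quadratic growth at \<open>a0\<close>. There \<open>Dq\<close>
  vanishes on \<open>V\<close> and growth forces a positive second-order part, so
  \<open>Dq a\<close> pairs with \<open>a - a0\<close> quadratically. Returning to \<open>M\<close>
  adds only a curvature term of third order.\<close>

lemma riemannian_grad_growth: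
  assumes h: "C2_on U h" "open U" "p \<in> U" "\<And>x. x \<in> M \<Longrightarrow> x \<in> U \<Longrightarrow> h x = f x"
    and \<delta>: "\<delta> > 0" "\<forall>\<^sub>F x in nhds p. f x - f p \<ge> \<delta> / 2 * (norm (x - p))\<^sup>2"
  obtains c C s1 where "c > 0" "C > 0" "s1 > 0" "s1 \<le> s"
    "\<And>y. y \<in> M \<Longrightarrow> y \<in> ball p s1 \<Longrightarrow> riemannian_grad M f y \<in> tangent_space M y"
    "\<And>y. y \<in> M \<Longrightarrow> y \<in> ball p s1 \<Longrightarrow> norm (riemannian_grad M f y) \<le> C * norm (y - p)"
    "\<And>y. y \<in> M \<Longrightarrow> y \<in> ball p s1 \<Longrightarrow> c * (norm (y - p))\<^sup>2 \<le> riemannian_grad M f y \<bullet> (y - p)"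
proof -
  define a0 where "a0 = \<Phi> p"
  have pM: "p \<in> ball p s" using pos(1) by simp
  have a0V: "a0 \<in> V" using M_iff[OF pM] p_in by (simp add: a0_def)
  obtain Dh \<rho>1 D2 where \<rho>1: "\<rho>1 > 0" "ball p \<rho>1 \<subseteq> U"
    and Dh: "\<And>x. x \<in> ball p \<rho>1 \<Longrightarrow> (h has_derivative blinfun_apply (Dh x)) (at x)"
    and D2: "(Dh has_derivative D2) (at p)"
    using C2_on_local_estimates[OF h(1-3)] by metis
  obtain \<rho>2 where \<rho>2: "\<rho>2 > 0" "\<And>x. x \<in> ball p \<rho>2 \<Longrightarrow> f x - f p \<ge> \<delta> / 2 * (norm (x - p))\<^sup>2"
    using \<delta>(2) unfolding eventually_nhds_metric by (auto simp: dist_commute)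
  define \<rho> where "\<rho> = min r (min s (min \<rho>1 \<rho>2) / \<Lambda>)"
  have \<rho>: "\<rho> > 0" "\<rho> \<le> r" using pos \<rho>1(1) \<rho>2(1) by (auto simp: \<rho>_def)
  have in_r: "a \<in> ball (\<Phi> p) r" if "a \<in> ball a0 \<rho>" for a
    using that \<rho>(2) by (auto simp: a0_def)
  have \<Psi>_in: "\<Psi> a \<in> ball p (min s (min \<rho>1 \<rho>2))" if a: "a \<in> ball a0 \<rho>" for a
  proof -
    have "norm (\<Psi> a - \<Psi> a0) \<le> \<Lambda> * norm (a - a0)"
      using in_r[OF a] pos(2) by (intro \<Psi>_lip) (auto simp: a0_def)
    also have "\<dots> < \<Lambda> * (min s (min \<rho>1 \<rho>2) / \<Lambda>)"
      using a pos(3) by (intro mult_strict_left_mono) (auto simp: \<rho>_def dist_norm norm_minus_commute)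
    also have "\<dots> = min s (min \<rho>1 \<rho>2)" using pos(3) by simp
    finally show ?thesis by (simp add: a0_def \<Psi>_p dist_norm norm_minus_commute)
  qed
  define q where "q = h \<circ> \<Psi>"
  define Dq where "Dq a = Dh (\<Psi> a) o\<^sub>L D\<Psi> a" for a
  have q: "(q has_derivative blinfun_apply (Dq a)) (at a)" if a: "a \<in> ball a0 \<rho>" for a
  proof -
    have "(h has_derivative blinfun_apply (Dh (\<Psi> a))) (at (\<Psi> a))"
      using \<Psi>_in[OF a] by (intro Dh) auto
    from has_derivative_compose[OF D\<Psi>[OF in_r[OF a]] this] show ?thesis
      by (simp add: q_def Dq_def comp_def blinfun_compose.rep_eq)
  qed
  have line: "((\<lambda>t. q (a0 + t *\<^sub>R u)) has_real_derivative Dq (a0 + t *\<^sub>R u) u) (at t)"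
    if "a0 + t *\<^sub>R u \<in> ball a0 \<rho>" for t u
  proof -
    have "((\<lambda>t. a0 + t *\<^sub>R u) has_derivative (\<lambda>h. h *\<^sub>R u)) (at t)"
      by (auto intro!: derivative_eq_intros)
    from has_derivative_compose[OF this q[OF that]] show ?thesis
      by (simp add: has_field_derivative_def blinfun.scaleR_right mult_commute_abs)
  qed
  have qf: "q a = f (\<Psi> a)" if "a \<in> ball a0 \<rho>" "a \<in> V" for a
    using \<Psi>_in[OF that(1)] in_M[OF in_r[OF that(1)] that(2)] \<rho>1(2) h(4) by (auto simp: q_def)
  have a0b: "a0 \<in> ball a0 \<rho>" using \<rho>(1) by simp
  have q0: "q a0 = f p" using qf[OF a0b a0V] by (simp add: a0_def \<Psi>_p)
  \<comment> \<open>The growth constant \<open>\<delta> / 2\<close> loses the factor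
    \<open>\<Lambda>\<^sup>2\<close> when distances are measured in the chart.\<close>
  define \<kappa> where "\<kappa> = \<delta> / (2 * \<Lambda>\<^sup>2)"
  have \<kappa>: "\<kappa> > 0" using \<delta>(1) pos(3) by (simp add: \<kappa>_def)
  have norm_le: "norm (a - a0) \<le> \<Lambda> * norm (\<Psi> a - p)" if a: "a \<in> ball a0 \<rho>" for a
    using \<Phi>_lip[OF pM, of "\<Psi> a"] \<Psi>_in[OF a] right_inv[OF in_r[OF a]] by (simp add: a0_def)
  have q_growth: "\<kappa> * (norm (a - a0))\<^sup>2 \<le> q a - q a0" if a: "a \<in> ball a0 \<rho>" "a \<in> V" for a
  proof -
    have "(norm (a - a0))\<^sup>2 \<le> (\<Lambda> * norm (\<Psi> a - p))\<^sup>2"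
      by (rule power_mono[OF norm_le[OF a(1)] norm_ge_zero])
    then have "\<kappa> * (norm (a - a0))\<^sup>2 \<le> \<kappa> * (\<Lambda> * norm (\<Psi> a - p))\<^sup>2"
      using \<kappa> by (intro mult_left_mono) auto
    also have "\<dots> = \<delta> / 2 * (norm (\<Psi> a - p))\<^sup>2"
      using pos(3) by (simp add: \<kappa>_def power_mult_distrib)
    also have "\<dots> \<le> f (\<Psi> a) - f p" using \<Psi>_in[OF a(1)] by (intro \<rho>2(2)) auto
    finally show ?thesis by (simp add: qf[OF a] q0)
  qed
  have Dq0: "Dq a0 b = 0" if b: "b \<in> V" for b
  proof -
    define \<eta> where "\<eta> = \<rho> / (norm b + 1)"
    have nb: "norm b + 1 > 0" by (simp add: add_nonneg_pos)
    have \<eta>: "\<eta> > 0" using \<rho>(1) nb by (simp add: \<eta>_def)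
    have in_ball: "a0 + t *\<^sub>R b \<in> ball a0 \<rho>" if "\<bar>t\<bar> < \<eta>" for t
    proof -
      have "\<bar>t\<bar> * norm b \<le> \<bar>t\<bar> * (norm b + 1)" by (intro mult_left_mono) auto
      also have "\<dots> < \<eta> * (norm b + 1)" using that nb by (rule mult_strict_right_mono)
      also have "\<dots> = \<rho>" using nb by (simp add: \<eta>_def)
      finally show ?thesis by (simp add: dist_norm)
    qed
    have "q (a0 + 0 *\<^sub>R b) \<le> q (a0 + t *\<^sub>R b)" if "\<bar>0 - t\<bar> < \<eta>" for t
    proof -
      have "a0 + t *\<^sub>R b \<in> V" using a0V b V by (intro subspace_add subspace_scale)
      then have "\<kappa> * (norm (a0 + t *\<^sub>R b - a0))\<^sup>2 \<le> q (a0 + t *\<^sub>R b) - q a0"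
        using that by (intro q_growth in_ball) simp_all
      moreover have "0 \<le> \<kappa> * (norm (a0 + t *\<^sub>R b - a0))\<^sup>2" using \<kappa> by simp
      ultimately show ?thesis by simp
    qed
    then have "Dq (a0 + 0 *\<^sub>R b) b = 0"
      using \<eta> in_ball[of 0] by (intro DERIV_local_min[OF line, of 0 b \<eta>]) auto
    then show ?thesis by simp
  qed
  have "Dq differentiable (at a0)"
  proof -
    have "(\<Psi> has_derivative blinfun_apply (D\<Psi> a0)) (at a0)" using D\<Psi>[OF in_r[OF a0b]] .
    moreover have "(Dh has_derivative D2) (at (\<Psi> a0))" using D2 by (simp add: a0_def \<Psi>_p)
    ultimately have "((\<lambda>a. Dh (\<Psi> a)) has_derivative (\<lambda>x. D2 (D\<Psi> a0 x))) (at a0)"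
      by (rule has_derivative_compose)
    moreover obtain E where "(D\<Psi> has_derivative E) (at a0)"
      using D\<Psi>_diff unfolding differentiable_def a0_def by blast
    ultimately show ?thesis
      unfolding Dq_def using bounded_bilinear.FDERIV[OF bounded_bilinear_blinfun_compose]
      by (intro differentiableI) blast
  qed
  then obtain A where A: "(Dq has_derivative A) (at a0)" unfolding differentiable_def by blast
  \<comment> \<open>The tolerance makes \<open>second\<close> come out with \<kappa>. In units of
    \<open>(norm u)\<^sup>2\<close>, doubling the estimate for \<open>q\<close> gives
    \<open>A u u\<close> at least \<open>2 * \<kappa> - 2 * \<kappa> / 3\<close>, and passing from
    \<open>A u u\<close> to \<open>Dq a u\<close> loses another \<open>\<kappa> / 3\<close>.\<close>
  have "\<kappa> / 3 > 0" using \<kappa> by simp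
  with A obtain \<rho>3 where \<rho>3: "\<rho>3 > 0"
    "\<And>a. norm (a - a0) < \<rho>3 \<Longrightarrow> norm (Dq a - Dq a0 - A (a - a0)) \<le> \<kappa> / 3 * norm (a - a0)"
    unfolding has_derivative_at_alt by blast
  obtain K where K: "K > 0" "\<And>u. norm (A u) \<le> norm u * K"
    using bounded_linear.pos_bounded[OF has_derivative_bounded_linear[OF A]] by blast
  \<comment> \<open>\<open>K + \<kappa> / 3\<close> bounds \<open>Dq a\<close> on \<open>V\<close>
    relative to \<open>norm (a - a0)\<close>; \<Lambda> bounds the chart vector that represents the
    gradient.\<close>
  define C0 where "C0 = (K + \<kappa> / 3) * \<Lambda>"
  have C0: "C0 > 0" using K(1) \<kappa> pos(3) by (simp add: C0_def)
  \<comment> \<open>The last entry keeps the curvature error \<open>G \<bullet> e\<close> within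
    half of the growth \<open>\<kappa> * (norm u)\<^sup>2\<close>.\<close>
  define \<tau> where "\<tau> = min \<rho> (min \<rho>3 (\<kappa> / (2 * C0 * \<Lambda>)))"
  have \<tau>: "\<tau> > 0" "\<tau> \<le> \<rho>" "\<tau> \<le> \<rho>3" "C0 * \<Lambda> * \<tau> \<le> \<kappa> / 2"
  proof -
    show "\<tau> > 0" "\<tau> \<le> \<rho>" "\<tau> \<le> \<rho>3" using \<rho>(1) \<rho>3(1) \<kappa> C0 pos(3) by (auto simp: \<tau>_def)
    have "C0 * \<Lambda> * \<tau> \<le> C0 * \<Lambda> * (\<kappa> / (2 * C0 * \<Lambda>))"
      using C0 pos(3) by (intro mult_left_mono) (auto simp: \<tau>_def)
    also have "\<dots> = \<kappa> / 2" using C0 pos(3) by simp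
    finally show "C0 * \<Lambda> * \<tau> \<le> \<kappa> / 2" .
  qed
  have Dq_A: "\<bar>Dq a b - A (a - a0) b\<bar> \<le> \<kappa> / 3 * norm (a - a0) * norm b"
    if "a \<in> ball a0 \<tau>" "b \<in> V" for a b
  proof -
    have "norm ((Dq a - Dq a0 - A (a - a0)) b) \<le> norm (Dq a - Dq a0 - A (a - a0)) * norm b"
      by (rule norm_blinfun)
    also have "\<dots> \<le> \<kappa> / 3 * norm (a - a0) * norm b"
      using that(1) \<tau>(3) by (intro mult_right_mono \<rho>3(2)) (auto simp: dist_norm norm_minus_commute)
    finally show ?thesis using Dq0[OF that(2)] by (simp add: blinfun.diff_left)
  qed
  note Dq_A1 = Dq_A[THEN abs_le_D1] and Dq_A2 = Dq_A[THEN abs_le_D2]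
  have second: "\<kappa> * (norm (a - a0))\<^sup>2 \<le> Dq a (a - a0)" if a: "a \<in> ball a0 \<tau>" "a \<in> V" for a
  proof -
    define u where "u = a - a0"
    have uV: "u \<in> V" using a(2) a0V V by (auto simp: u_def intro: subspace_diff)
    have in_ball: "a0 + t *\<^sub>R u \<in> ball a0 \<tau>" if "0 \<le> t" "t \<le> 1" for t
    proof -
      have "\<bar>t\<bar> * norm u \<le> 1 * norm u" using that by (intro mult_right_mono) auto
      then show ?thesis using a(1) by (simp add: u_def dist_norm norm_minus_commute)
    qed
    \<comment> \<open>Subtracting the quadratic term before using the mean value theorem gives a
      second-order expansion from differentiability of \<open>Dq\<close> at the single point
      \<open>a0\<close>.\<close>
    define \<psi> where "\<psi> t = q (a0 + t *\<^sub>R u) - t\<^sup>2 / 2 * A u u" for t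
    have \<psi>: "(\<psi> has_real_derivative Dq (a0 + t *\<^sub>R u) u - t * A u u) (at t)" if "0 \<le> t" "t \<le> 1" for t
      unfolding \<psi>_def using in_ball[OF that] \<tau>(2)
      by (intro DERIV_diff line) (auto intro!: derivative_eq_intros)
    obtain t where t: "0 < t" "t < 1" "\<psi> 1 - \<psi> 0 = (1 - 0) * (Dq (a0 + t *\<^sub>R u) u - t * A u u)"
      using MVT2[of 0 1 \<psi>, OF _ \<psi>] by auto
    have At: "A (t *\<^sub>R u) = t *\<^sub>R A u"
      using linear_simps(5)[OF has_derivative_bounded_linear[OF A]] .
    have "Dq (a0 + t *\<^sub>R u) u - t * A u u \<le> \<kappa> / 3 * norm (t *\<^sub>R u) * norm u"
      using Dq_A1[OF in_ball[of t] uV] t by (simp add: At blinfun.scaleR_left)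
    also have "\<dots> \<le> \<kappa> / 3 * (norm u * norm u)"
    proof -
      have "\<kappa> / 3 * (t * (norm u * norm u)) \<le> \<kappa> / 3 * (1 * (norm u * norm u))"
        using t \<kappa> by (intro mult_left_mono mult_right_mono) auto
      then show ?thesis using t by (simp add: mult.assoc)
    qed
    finally have "q a - q a0 - A u u / 2 \<le> \<kappa> / 3 * (norm u * norm u)"
      using t(3) by (simp add: \<psi>_def u_def)
    moreover have "\<kappa> * (norm u * norm u) \<le> q a - q a0"
      using q_growth[of a] a \<tau>(2) by (auto simp: u_def power2_eq_square)
    moreover have "A u u - Dq a u \<le> \<kappa> / 3 * (norm u * norm u)"
      using Dq_A2[OF a(1) uV] by (simp add: u_def mult.assoc)
    ultimately show ?thesis unfolding u_def[symmetric] power2_eq_square by linarith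
  qed
  define s1 where "s1 = min s (min \<rho>1 (\<tau> / \<Lambda>))"
  show ?thesis
  proof (rule that[of "\<kappa> / (2 * \<Lambda>\<^sup>2)" "C0 * \<Lambda>" s1])
    show "\<kappa> / (2 * \<Lambda>\<^sup>2) > 0" "C0 * \<Lambda> > 0" "s1 > 0" "s1 \<le> s"
      using \<kappa> C0 pos \<tau>(1) \<rho>1(1) by (auto simp: s1_def)
    fix y assume y: "y \<in> M" "y \<in> ball p s1"
    define G where "G = riemannian_grad M f y"
    define a where "a = \<Phi> y"
    define u where "u = a - a0"
    have ys: "y \<in> ball p s" and y1: "y \<in> ball p \<rho>1" using y(2) by (auto simp: s1_def)
    have aV: "a \<in> V" using M_iff[OF ys] y(1) by (simp add: a_def)
    have u_le: "norm u \<le> \<Lambda> * norm (y - p)"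
      using \<Phi>_lip[OF pM ys] by (simp add: u_def a_def a0_def)
    also have "\<dots> < \<Lambda> * (\<tau> / \<Lambda>)"
      using y(2) pos(3) by (intro mult_strict_left_mono) (auto simp: s1_def dist_norm norm_minus_commute)
    finally have a: "a \<in> ball a0 \<tau>" using pos(3) by (simp add: u_def dist_norm norm_minus_commute)
    have \<Psi>a: "\<Psi> a = y" using left_inv[OF ys] by (simp add: a_def)
    have uV: "u \<in> V" using aV a0V V by (auto simp: u_def intro: subspace_diff)
    note grad = riemannian_grad_inner[OF y(1) ys open_ball y1 _ Dh[OF y1], of f]
    have hf: "h x = f x" if "x \<in> M" "x \<in> ball p \<rho>1" for x using h(4) that \<rho>1(2) by auto
    show GT: "G \<in> tangent_space M y" unfolding G_def using hf by (rule grad(1))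
    have Gw: "G \<bullet> w = Dh y w" if "w \<in> tangent_space M y" for w
      unfolding G_def using hf that by (rule grad(2))
    have Gb: "G \<bullet> D\<Psi> a b = Dq a b" if "b \<in> V" for b
    proof -
      have "D\<Psi> a b \<in> tangent_space M y" using that tangent_space_eq[OF y(1) ys] by (auto simp: a_def)
      from Gw[OF this] show ?thesis by (simp add: Dq_def \<Psi>a)
    qed
    have normG: "norm G \<le> C0 * norm u"
    proof -
      \<comment> \<open>Being tangent, \<open>G\<close> is the image under \<open>D\<Psi> a\<close>
        of some \<open>b\<close> in \<open>V\<close>, so it can be tested against itself.\<close>
      define b where "b = D\<Phi> y G"
      have b: "b \<in> V" "D\<Psi> a b = G"
        using tangent_space_subset[OF y(1) ys GT] D\<Psi>_D\<Phi>[OF ys] by (auto simp: b_def a_def)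
      have "norm b \<le> norm (D\<Phi> y) * norm G" unfolding b_def by (rule norm_blinfun)
      also have "\<dots> \<le> \<Lambda> * norm G" using D\<Phi>_le[OF ys] by (intro mult_right_mono) auto
      finally have nb: "norm b \<le> \<Lambda> * norm G" .
      have "\<bar>A u b\<bar> \<le> norm (A u) * norm b" using norm_blinfun[of "A u" b] by simp
      also have "\<dots> \<le> norm u * K * norm b" using K(2) by (intro mult_right_mono) auto
      finally have Ab: "\<bar>A u b\<bar> \<le> norm u * K * norm b" .
      have "norm G * norm G = G \<bullet> D\<Psi> a b"
        by (simp add: b(2) power2_norm_eq_inner[symmetric] power2_eq_square)
      also have "\<dots> = Dq a b" by (rule Gb[OF b(1)])
      also have "\<dots> \<le> \<kappa> / 3 * norm u * norm b + norm u * K * norm b"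
        using Dq_A1[OF a b(1)] abs_le_D1[OF Ab] by (simp add: u_def)
      also have "\<dots> = (K + \<kappa> / 3) * norm u * norm b" by (simp add: algebra_simps)
      also have "\<dots> \<le> (K + \<kappa> / 3) * norm u * (\<Lambda> * norm G)"
        using nb K(1) \<kappa> by (intro mult_left_mono) auto
      also have "\<dots> = (C0 * norm u) * norm G" by (simp add: C0_def mult_ac)
      finally show ?thesis
        using C0 by (cases "norm G = 0") auto
    qed
    also have "\<dots> \<le> C0 * (\<Lambda> * norm (y - p))" using u_le C0 by (intro mult_left_mono) auto
    finally show "norm G \<le> C0 * \<Lambda> * norm (y - p)" by (simp add: mult.assoc)
    \<comment> \<open>Deviation of the chord from \<open>p\<close> to \<open>y\<close> from the
      tangent vector \<open>D\<Psi> a u\<close>.\<close>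
    define e where "e = y - p - D\<Psi> a u"
    have e: "norm e \<le> \<Lambda> * (norm u)\<^sup>2"
    proof -
      have ar: "a \<in> ball (\<Phi> p) r" "\<Phi> p \<in> ball (\<Phi> p) r" using into[OF ys] pos(2) by (auto simp: a_def)
      have "norm (\<Psi> a0 - \<Psi> a - D\<Psi> a (a0 - a)) \<le> \<Lambda> * (norm (a0 - a))\<^sup>2"
        unfolding a0_def by (rule \<Psi>_taylor[OF ar])
      moreover have "\<Psi> a0 - \<Psi> a - D\<Psi> a (a0 - a) = - e"
        by (simp add: e_def u_def \<Psi>a a0_def \<Psi>_p blinfun.diff_right)
      ultimately show ?thesis by (simp add: u_def norm_minus_commute)
    qed
    have "\<bar>G \<bullet> e\<bar> \<le> norm G * norm e" by (rule Cauchy_Schwarz_ineq2)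
    also have "\<dots> \<le> (C0 * norm u) * (\<Lambda> * (norm u)\<^sup>2)"
      using normG e C0 by (intro mult_mono) auto
    also have "\<dots> = (C0 * \<Lambda> * norm u) * (norm u)\<^sup>2" by (simp add: mult_ac)
    also have "\<dots> \<le> (\<kappa> / 2) * (norm u)\<^sup>2"
    proof (rule mult_right_mono)
      have "C0 * \<Lambda> * norm u \<le> C0 * \<Lambda> * \<tau>"
        using a C0 pos(3) by (intro mult_left_mono) (auto simp: u_def dist_norm norm_minus_commute)
      then show "C0 * \<Lambda> * norm u \<le> \<kappa> / 2" using \<tau>(4) by linarith
    qed simp
    finally have Ge: "\<bar>G \<bullet> e\<bar> \<le> \<kappa> / 2 * (norm u)\<^sup>2" .
    have "G \<bullet> (y - p) = G \<bullet> D\<Psi> a u + G \<bullet> e" by (simp add: e_def inner_diff_right)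
    also have "G \<bullet> D\<Psi> a u = Dq a u" by (rule Gb[OF uV])
    finally have "G \<bullet> (y - p) \<ge> \<kappa> / 2 * (norm u)\<^sup>2"
      using second[OF a aV] Ge by (simp add: u_def abs_le_iff)
    moreover have "\<kappa> / (2 * \<Lambda>\<^sup>2) * (norm (y - p))\<^sup>2 \<le> \<kappa> / 2 * (norm u)\<^sup>2"
    proof -
      have "norm (y - p) \<le> \<Lambda> * norm u"
        using \<Psi>_lip[of a0 a] into[OF ys] into[OF pM] by (simp add: \<Psi>a u_def a_def[symmetric] a0_def \<Psi>_p)
      then have "(norm (y - p))\<^sup>2 \<le> (\<Lambda> * norm u)\<^sup>2" by (rule power_mono) simp
      then have "\<kappa> / (2 * \<Lambda>\<^sup>2) * (norm (y - p))\<^sup>2 \<le> \<kappa> / (2 * \<Lambda>\<^sup>2) * (\<Lambda> * norm u)\<^sup>2"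
        using \<kappa> by (intro mult_left_mono) auto
      also have "\<dots> = \<kappa> / 2 * (norm u)\<^sup>2" using pos(3) by (simp add: power_mult_distrib)
      finally show ?thesis .
    qed
    ultimately show "\<kappa> / (2 * \<Lambda>\<^sup>2) * (norm (y - p))\<^sup>2 \<le> G \<bullet> (y - p)" by linarith
  qed
qed

end

section \<open>Goldstein steps near the manifold\<close>

text \<open>Chord against arc: unit vectors at angle \<open>t\<close> are at distance
  \<open>2 * sin (t / 2)\<close>.\<close>

lemma norm_sgn_diff_le_vec_angle:
  fixes u v :: "'a::real_inner"
  assumes "u \<noteq> 0" "v \<noteq> 0"
  shows "norm (sgn u - sgn v) \<le> vec_angle u v"
proof -
  define x where "x = u \<bullet> v / (norm u * norm v)"
  have "\<bar>x\<bar> \<le> 1"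
    using Cauchy_Schwarz_ineq2[of u v] assms by (simp add: x_def abs_mult divide_le_eq)
  then have x: "- 1 \<le> x" "x \<le> 1" by (auto simp: abs_le_iff)
  define t where "t = arccos x"
  have t: "0 \<le> t" "cos t = x" using x by (auto simp: t_def arccos_lbound)
  have "(norm (sgn u - sgn v))\<^sup>2 = (norm (sgn u))\<^sup>2 + (norm (sgn v))\<^sup>2 - 2 * (sgn u \<bullet> sgn v)"
    by (simp add: power2_norm_eq_inner inner_diff_left inner_diff_right inner_commute)
  also have "sgn u \<bullet> sgn v = x" by (simp add: sgn_div_norm x_def divide_inverse)
  also have "(norm (sgn u))\<^sup>2 + (norm (sgn v))\<^sup>2 - 2 * x = 4 * (sin (t / 2))\<^sup>2"
    using assms cos_double_sin[of "t / 2"] t(2) by (simp add: norm_sgn)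
  also have "\<dots> \<le> 4 * (t / 2)\<^sup>2"
    using abs_sin_x_le_abs_x[of "t / 2"] by (simp only: abs_le_square_iff mult_le_cancel_left) simp
  also have "\<dots> = t\<^sup>2" by (simp add: power2_eq_square)
  finally have "(norm (sgn u - sgn v))\<^sup>2 \<le> t\<^sup>2" .
  then show ?thesis
    using t(1) by (simp add: vec_angle_def x_def[symmetric] t_def[symmetric] power2_le_iff_abs_le)
qed

lemma goldstein_step_eq_sgn: "goldstein_step f \<epsilon> x = x - \<epsilon> *\<^sub>R sgn (goldstein_subgrad f \<epsilon> x)"
  by (simp add: goldstein_step_def sgn_div_norm divide_inverse)

lemma norm_goldstein_step_le: "0 \<le> \<epsilon> \<Longrightarrow> norm (goldstein_step f \<epsilon> x - x) \<le> \<epsilon>"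
  by (simp add: goldstein_step_eq_sgn norm_sgn)

text \<open>In the expanded square, \<open>\<epsilon> \<le> c0 * D\<close> lets the term quadratic
  in \<epsilon> use up at most half of the gain \<open>2 * \<epsilon> * (c0 * D)\<close>; the lower
  bound on \<epsilon> turns the rest into a factor.\<close>

lemma goldstein_step_contracts:
  assumes D: "0 < norm (x - p)" and c0: "0 < c0" "c0 \<le> 1" and \<beta>: "0 < \<beta>" "\<beta> \<le> c0" and \<gamma>: "0 < \<gamma>" "\<gamma> < 1"
    and \<epsilon>: "\<beta> * \<gamma> * norm (x - p) \<le> \<epsilon>" "\<epsilon> \<le> \<beta> * norm (x - p)"
    and inner: "c0 * norm (x - p) \<le> sgn (goldstein_subgrad f \<epsilon> x) \<bullet> (x - p)"
  shows "norm (goldstein_step f \<epsilon> x - p) \<le> sqrt (1 - c0 * \<beta> * \<gamma>) * norm (x - p)"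
proof -
  define D where "D = norm (x - p)"
  define e where "e = sgn (goldstein_subgrad f \<epsilon> x)"
  have "0 < \<beta> * \<gamma> * D" using D \<beta>(1) \<gamma>(1) by (simp add: D_def)
  then have \<epsilon>0: "0 < \<epsilon>" using \<epsilon>(1) unfolding D_def by linarith
  have "norm e \<le> 1" by (simp add: e_def norm_sgn)
  then have ee: "e \<bullet> e \<le> 1" using power_mono[of "norm e" 1 2] by (simp add: power2_norm_eq_inner)
  have "\<beta> * D \<le> c0 * D" using \<beta>(2) by (intro mult_right_mono) (auto simp: D_def)
  then have "\<epsilon> \<le> c0 * D" using \<epsilon>(2) unfolding D_def by linarith
  have "(norm (goldstein_step f \<epsilon> x - p))\<^sup>2 = D\<^sup>2 - 2 * \<epsilon> * (e \<bullet> (x - p)) + \<epsilon> * \<epsilon> * (e \<bullet> e)"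
    by (simp add: goldstein_step_eq_sgn e_def[symmetric] D_def power2_norm_eq_inner inner_diff_left inner_diff_right
        inner_commute algebra_simps)
  also have "\<dots> \<le> D\<^sup>2 - 2 * \<epsilon> * (c0 * D) + \<epsilon> * (c0 * D) * 1"
    using inner ee \<epsilon>0 \<open>\<epsilon> \<le> c0 * D\<close> c0 D
    by (intro add_mono diff_mono mult_mono) (auto simp: D_def e_def)
  also have "\<dots> = D\<^sup>2 - c0 * D * \<epsilon>" by (simp add: algebra_simps)
  also have "\<dots> \<le> D\<^sup>2 - c0 * D * (\<beta> * \<gamma> * D)"
    using \<epsilon>(1) c0(1) D by (intro diff_mono mult_left_mono) (auto simp: D_def)
  also have "\<dots> = (1 - c0 * \<beta> * \<gamma>) * D\<^sup>2" by (simp add: algebra_simps power2_eq_square)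
  finally have "norm (goldstein_step f \<epsilon> x - p) \<le> sqrt ((1 - c0 * \<beta> * \<gamma>) * D\<^sup>2)"
    by (rule real_le_rsqrt)
  then show ?thesis by (simp add: real_sqrt_mult D_def)
qed

text \<open>If \<epsilon> were below \<kappa> times the distance \<open>d\<close> to
  \<open>M\<close>, every subgradient in the ball would have inner product at least
  \<open>\<mu> / 2 * d\<close> with the vector \<open>n\<close> of length \<open>d\<close>. The
  convex hull inherits this, so its shortest vector would have norm at least
  \<open>\<mu> / 2\<close>.\<close>

lemma (in lipschitz_on_cball) goldstein_subgrad_small_imp_near:
  assumes chart: "C2_chart M p \<Phi> \<Psi> D\<Phi> D\<Psi> V s r \<Lambda>" and R: "R > 0" and L: "L > 0" and \<mu>: "\<mu> > 0"
    and grow: "\<forall>\<^sub>F x in nhds p. \<forall>v\<in>clarke_subdiff f x. v \<bullet> (x - closest_point M x) \<ge> \<mu> * infdist x M"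
  obtains \<kappa> e where "\<kappa> > 0" "e > 0"
    "\<And>x \<epsilon>. x \<in> ball p e \<Longrightarrow> 0 \<le> \<epsilon> \<Longrightarrow> \<epsilon> \<le> norm (x - p) \<Longrightarrow> norm (goldstein_subgrad f \<epsilon> x) < \<mu> / 2 \<Longrightarrow>
      \<kappa> * infdist x M \<le> \<epsilon>"
proof -
  interpret C2_chart M p \<Phi> \<Psi> D\<Phi> D\<Psi> V s r \<Lambda> by (rule chart)
  obtain s2 where s2: "s2 > 0" "s2 \<le> s / 4"
    "\<And>x z. x \<in> ball p s2 \<Longrightarrow> z \<in> ball p s2 \<Longrightarrow> norm (closest_point M x - closest_point M z) \<le> 2 * norm (x - z)"
    using closest_point_lipschitz_near by metis
  obtain s3 where s3: "s3 > 0" "\<And>x v. x \<in> ball p s3 \<Longrightarrow> v \<in> clarke_subdiff f x \<Longrightarrow> v \<bullet> (x - closest_point M x) \<ge> \<mu> * infdist x M"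
    using grow unfolding eventually_nhds_metric by (auto simp: dist_commute)
  \<comment> \<open>The halving leaves room for a ball of radius up to \<open>norm (x - p)\<close>
    around \<open>x\<close>.\<close>
  define e where "e = min R (min s2 s3) / 2"
  \<comment> \<open>Passing from \<open>x\<close> to \<open>z\<close> costs
    \<open>\<mu> * \<epsilon>\<close> through the distance to \<open>M\<close> and
    \<open>3 * L * \<epsilon>\<close> through the normal vector, one part for the point and two for
    its projection. \<kappa> keeps the sum within half of \<open>\<mu> * d\<close>.\<close>
  define \<kappa> where "\<kappa> = \<mu> / 2 / (\<mu> + 3 * L)"
  have e: "e > 0" using R s2(1) s3(1) by (simp add: e_def)
  have K: "\<mu> + 3 * L > 0" using \<mu> L by simp
  have \<kappa>: "\<kappa> > 0" "(\<mu> + 3 * L) * \<kappa> = \<mu> / 2"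
  proof -
    show "\<kappa> > 0" using K \<mu> by (simp add: \<kappa>_def)
    show "(\<mu> + 3 * L) * \<kappa> = \<mu> / 2"
      using nonzero_mult_div_cancel_left[OF less_imp_neq[OF K, symmetric], of "\<mu> / 2"]
      by (simp only: \<kappa>_def times_divide_eq_right)
  qed
  show ?thesis
  proof (rule that[OF \<kappa>(1) e], rule ccontr)
    fix x \<epsilon> assume x: "x \<in> ball p e" and \<epsilon>: "0 \<le> \<epsilon>" "\<epsilon> \<le> norm (x - p)"
      and g: "norm (goldstein_subgrad f \<epsilon> x) < \<mu> / 2" and "\<not> \<kappa> * infdist x M \<le> \<epsilon>"
    then have \<epsilon>\<kappa>: "\<epsilon> < \<kappa> * infdist x M" by simp
    define d where "d = infdist x M"
    have d: "d > 0"
      using order_le_less_trans[OF \<epsilon>(1) \<epsilon>\<kappa>] \<kappa>(1) by (simp add: d_def zero_less_mult_iff)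
    have sub: "z \<in> ball p R \<and> z \<in> ball p s2 \<and> z \<in> ball p s3" if "z \<in> cball x \<epsilon>" for z
    proof -
      have "dist p z \<le> dist p x + dist x z" by (rule dist_triangle)
      also have "\<dots> < 2 * e" using that x \<epsilon>(2) by (simp add: dist_norm norm_minus_commute)
      finally show ?thesis by (simp add: e_def)
    qed
    have xs2: "x \<in> ball p s2" using sub[of x] \<epsilon>(1) by simp
    define n where "n = x - closest_point M x"
    have norm_n: "norm n = d"
      using infdist_nearest_point[of x] xs2 s2(2) by (simp add: n_def d_def dist_norm)
    have "(\<Union>z\<in>cball x \<epsilon>. clarke_subdiff f z) \<subseteq> {v. n \<bullet> v \<ge> \<mu> / 2 * d}"
    proof clarify
      fix z v assume z: "z \<in> cball x \<epsilon>" and v: "v \<in> clarke_subdiff f z"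
      have "\<mu> * infdist z M \<le> v \<bullet> (z - closest_point M z)" using s3(2) v sub[OF z] by blast
      moreover have "\<mu> * (d - \<epsilon>) \<le> \<mu> * infdist z M"
        using infdist_triangle[of x M z] z \<mu> by (intro mult_left_mono) (auto simp: d_def)
      moreover have "\<bar>v \<bullet> (n - (z - closest_point M z))\<bar> \<le> L * (3 * \<epsilon>)"
      proof -
        have "norm (n - (z - closest_point M z)) \<le> norm (x - z) + norm (closest_point M x - closest_point M z)"
          using norm_triangle_ineq4[of "x - z" "closest_point M x - closest_point M z"]
          by (simp add: n_def algebra_simps)
        also have "\<dots> \<le> 3 * norm (x - z)" using s2(3)[OF xs2, of z] sub[OF z] by simp
        also have "\<dots> \<le> 3 * \<epsilon>" using z by (simp add: dist_norm)
        finally have "norm v * norm (n - (z - closest_point M z)) \<le> L * (3 * \<epsilon>)"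
          using clarke_subdiff_le[of z v] sub[OF z] v L by (intro mult_mono) auto
        then show ?thesis using Cauchy_Schwarz_ineq2[of v "n - (z - closest_point M z)"] by linarith
      qed
      moreover have "v \<bullet> n = v \<bullet> (z - closest_point M z) + v \<bullet> (n - (z - closest_point M z))"
        by (simp add: inner_diff_right)
      moreover have "\<mu> * d - (\<mu> + 3 * L) * \<epsilon> = \<mu> * (d - \<epsilon>) - L * (3 * \<epsilon>)"
        by (simp add: algebra_simps)
      ultimately have "\<mu> * d - (\<mu> + 3 * L) * \<epsilon> \<le> v \<bullet> n" by linarith
      moreover have "(\<mu> + 3 * L) * \<epsilon> \<le> (\<mu> + 3 * L) * (\<kappa> * d)"
        using \<epsilon>\<kappa> K by (intro mult_left_mono) (auto simp: d_def)
      moreover have "(\<mu> + 3 * L) * (\<kappa> * d) = \<mu> / 2 * d" using \<kappa>(2) by (simp flip: mult.assoc)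
      ultimately show "\<mu> / 2 * d \<le> n \<bullet> v" by (simp add: inner_commute)
    qed
    then have "goldstein_subdiff f \<epsilon> x \<subseteq> {v. n \<bullet> v \<ge> \<mu> / 2 * d}"
      unfolding goldstein_subdiff_def by (rule hull_minimal) (rule convex_halfspace_ge)
    moreover have "goldstein_subgrad f \<epsilon> x \<in> goldstein_subdiff f \<epsilon> x"
      using sub \<epsilon>(1) by (intro goldstein_subgrad_in) auto
    ultimately have "\<mu> / 2 * d \<le> n \<bullet> goldstein_subgrad f \<epsilon> x" by blast
    also have "\<dots> \<le> norm n * norm (goldstein_subgrad f \<epsilon> x)" by (rule norm_cauchy_schwarz)
    also have "\<dots> < d * (\<mu> / 2)" unfolding norm_n using g d by (rule mult_strict_left_mono)
    finally show False by simp
  qed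
qed

text \<open>Makes a statement about sequences uniform: violations at every scale
  \<open>1 / Suc n\<close> would form a sequence to which it applies. As \<beta> is fixed, \<eta>
  may depend on it.\<close>

lemma tempered_growth_small_subgrad:
  assumes tempered: "\<And>xs \<epsilon>. (\<forall>r. xs r \<noteq> p) \<Longrightarrow> xs \<longlonglongrightarrow> p \<Longrightarrow>
        (\<forall>r. 0 \<le> \<epsilon> r \<and> \<epsilon> r \<le> \<beta> * norm (xs r - p)) \<Longrightarrow>
        (\<lambda>r. goldstein_subgrad f (\<epsilon> r) (xs r)) \<longlonglongrightarrow> 0 \<Longrightarrow>
        \<forall>\<^sub>F r in sequentially. P (\<epsilon> r) (xs r)"
  obtains \<eta> where "\<eta> > 0"
    "\<And>x \<epsilon>. x \<noteq> p \<Longrightarrow> norm (x - p) < \<eta> \<Longrightarrow> 0 \<le> \<epsilon> \<Longrightarrow> \<epsilon> \<le> \<beta> * norm (x - p) \<Longrightarrow>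
       norm (goldstein_subgrad f \<epsilon> x) < \<eta> \<Longrightarrow> P \<epsilon> x"
proof (rule ccontr)
  note * = that
  assume "\<not> thesis"
  define Q where "Q n x \<epsilon> \<longleftrightarrow> x \<noteq> p \<and> norm (x - p) < 1 / Suc n \<and> 0 \<le> \<epsilon> \<and> \<epsilon> \<le> \<beta> * norm (x - p) \<and>
       norm (goldstein_subgrad f \<epsilon> x) < 1 / Suc n \<and> \<not> P \<epsilon> x" for n :: nat and x \<epsilon>
  have "\<exists>x \<epsilon>. Q n x \<epsilon>" for n
  proof (rule ccontr)
    assume "\<nexists>x \<epsilon>. Q n x \<epsilon>"
    then have "thesis" by (intro *[of "1 / Suc n"]) (auto simp: Q_def)
    with \<open>\<not> thesis\<close> show False by blast
  qed
  then obtain xs \<epsilon> where Q: "\<And>n. Q n (xs n) (\<epsilon> n)" by metis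
  have inv0: "(\<lambda>n. 1 / real (Suc n)) \<longlonglongrightarrow> 0"
    using LIMSEQ_inverse_real_of_nat by (simp add: divide_inverse)
  have "(\<lambda>n. xs n - p) \<longlonglongrightarrow> 0"
    by (rule Lim_null_comparison[OF always_eventually inv0]) (use Q in \<open>auto simp: Q_def less_imp_le simp del: of_nat_Suc\<close>)
  then have "xs \<longlonglongrightarrow> p" by (rule Lim_null[THEN iffD2])
  moreover have "(\<lambda>n. goldstein_subgrad f (\<epsilon> n) (xs n)) \<longlonglongrightarrow> 0"
    by (rule Lim_null_comparison[OF always_eventually inv0]) (use Q in \<open>auto simp: Q_def less_imp_le simp del: of_nat_Suc\<close>)
  ultimately have "\<forall>\<^sub>F r in sequentially. P (\<epsilon> r) (xs r)"
    using Q by (intro tempered) (auto simp: Q_def)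
  then obtain r where "P (\<epsilon> r) (xs r)"
    by (auto simp: eventually_sequentially)
  with Q[of r] show False by (simp add: Q_def)
qed

section \<open>Nearly linear convergence\<close>

text \<open>A step either contracts the function gap \<open>u\<close> or the distance \<open>d\<close>. A block of \<open>n + 1\<close> steps
  contains a contraction of \<open>u\<close>, or contracts \<open>d\<close>, and with it \<open>u \<le> L d\<close>, by \<open>\<theta>\<^sup>n\<^sup>+\<^sup>1\<close>; so \<open>n\<^sup>2\<close>
  steps reduce \<open>u\<close> by the factor \<open>\<theta>\<^sup>n\<close>.\<close>

lemma alternating_contraction_squares:
  fixes u d :: "nat \<Rightarrow> real"
  assumes \<theta>: "0 < \<theta>" "\<theta> < 1" and L: "0 \<le> L"
    and dec: "\<And>r. u (Suc r) \<le> u r" and ud: "\<And>r. u r \<le> L * d r" and dB: "\<And>r. d r \<le> B"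
    and step: "\<And>r. u (Suc r) \<le> \<theta> * u r \<or> d (Suc r) \<le> \<theta> * d r"
  shows "u (n\<^sup>2) \<le> max (u 0) (L * B) * \<theta> ^ n"
proof (induction n)
  case 0
  then show ?case by simp
next
  case (Suc n)
  define C where "C = max (u 0) (L * B)"
  have "decseq u" using dec by (simp add: decseq_Suc_iff)
  then have anti: "u j \<le> u i" if "i \<le> j" for i j using that by (rule decseqD)
  have block: "u (m + k) \<le> \<theta> * u m \<or> d (m + k) \<le> \<theta> ^ k * d m" for m k
  proof (induction k)
    case (Suc k)
    show ?case
    proof (cases "u (m + k) \<le> \<theta> * u m")
      case True
      then show ?thesis using dec[of "m + k"] by simp
    next
      case False
      with Suc.IH have IH: "d (m + k) \<le> \<theta> ^ k * d m" by blast
      show ?thesis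
      proof (cases "u (Suc (m + k)) \<le> \<theta> * u (m + k)")
        case True
        have "\<theta> * u (m + k) \<le> \<theta> * u m"
          using anti[of m "m + k"] \<theta>(1) by (intro mult_left_mono) auto
        with True show ?thesis by simp
      next
        case False
        then have "d (Suc (m + k)) \<le> \<theta> * d (m + k)" using step by blast
        also have "\<dots> \<le> \<theta> * (\<theta> ^ k * d m)" using IH \<theta>(1) by (intro mult_left_mono) auto
        finally show ?thesis by simp
      qed
    qed
  qed simp
  \<comment> \<open>The block after step \<open>n\<^sup>2\<close> ends no later than step
    \<open>(Suc n)\<^sup>2\<close>, and \<open>u\<close> does not grow in between.\<close>
  have sq: "n\<^sup>2 + Suc n \<le> (Suc n)\<^sup>2" by (simp add: power2_eq_square)
  from block[of "n\<^sup>2" "Suc n"] have "u (n\<^sup>2 + Suc n) \<le> C * \<theta> ^ Suc n"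
  proof
    assume "u (n\<^sup>2 + Suc n) \<le> \<theta> * u (n\<^sup>2)"
    also have "\<dots> \<le> \<theta> * (C * \<theta> ^ n)"
      using Suc.IH \<theta>(1) by (intro mult_left_mono) (auto simp: C_def)
    finally show ?thesis by (simp add: mult_ac)
  next
    \<comment> \<open>At the start of the block only \<open>d \<le> B\<close> is known, since
      contractions of \<open>u\<close> may have let \<open>d\<close> grow. The whole power of
      \<theta> must be earned within the block, so the blocks have to lengthen.\<close>
    assume d: "d (n\<^sup>2 + Suc n) \<le> \<theta> ^ Suc n * d (n\<^sup>2)"
    have "u (n\<^sup>2 + Suc n) \<le> L * d (n\<^sup>2 + Suc n)" by (rule ud)
    also have "\<dots> \<le> L * (\<theta> ^ Suc n * B)"
    proof (rule mult_left_mono[OF _ L])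
      have "\<theta> ^ Suc n * d (n\<^sup>2) \<le> \<theta> ^ Suc n * B"
        using dB \<theta>(1) by (intro mult_left_mono) auto
      with d show "d (n\<^sup>2 + Suc n) \<le> \<theta> ^ Suc n * B" by linarith
    qed
    also have "\<dots> = (L * B) * \<theta> ^ Suc n" by (simp add: mult_ac)
    also have "\<dots> \<le> C * \<theta> ^ Suc n" using \<theta>(1) by (intro mult_right_mono) (auto simp: C_def)
    finally show ?thesis .
  qed
  with anti[OF sq] show ?case by (simp add: C_def)
qed

text \<open>\<open>u\<close> does not increase between squares, so step \<open>r\<close> inherits
  the bound at the square of the integer part of \<open>sqrt r\<close>. Rounding down costs the
  factor \<open>exp b\<close>.\<close>

lemma alternating_contraction_rate:
  fixes u d :: "nat \<Rightarrow> real"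
  assumes \<theta>: "0 < \<theta>" "\<theta> < 1" and L: "0 \<le> L" and u0: "\<And>r. 0 \<le> u r"
    and dec: "\<And>r. u (Suc r) \<le> u r" and ud: "\<And>r. u r \<le> L * d r" and dB: "\<And>r. d r \<le> B"
    and step: "\<And>r. u (Suc r) \<le> \<theta> * u r \<or> d (Suc r) \<le> \<theta> * d r"
  obtains a b where "a > 0" "b > 0" "\<And>r. u r \<le> a * exp (- b * sqrt (real r))"
proof -
  define C where "C = max (u 0) (L * B) + 1"
  define b where "b = - ln \<theta>"
  have C: "C > 0" using u0[of 0] by (simp add: C_def)
  have b: "b > 0" using \<theta> by (simp add: b_def)
  have pow: "\<theta> ^ n = exp (- b * real n)" for n
    using \<theta>(1) by (simp add: b_def exp_of_nat_mult[symmetric] mult.commute exp_of_nat2_mult flip: ln_realpow)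
  show ?thesis
  proof (rule that[of "C * exp b" b])
    show "C * exp b > 0" "b > 0" using C b by auto
    fix r
    define n where "n = nat \<lfloor>sqrt (real r)\<rfloor>"
    have n: "real n \<le> sqrt (real r)" "sqrt (real r) \<le> real n + 1"
      by (simp_all add: n_def)
    then have "(real n)\<^sup>2 \<le> (sqrt (real r))\<^sup>2" by (intro power_mono) auto
    then have nr: "n\<^sup>2 \<le> r" by (simp flip: of_nat_power)
    have "decseq u" using dec by (simp add: decseq_Suc_iff)
    then have "u r \<le> u (n\<^sup>2)" using nr by (rule decseqD)
    also have "\<dots> \<le> max (u 0) (L * B) * \<theta> ^ n"
      by (rule alternating_contraction_squares[where u = u and d = d]) (fact assms)+
    also have "\<dots> \<le> C * \<theta> ^ n" using \<theta>(1) by (intro mult_right_mono) (auto simp: C_def)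
    also have "\<dots> \<le> C * exp (b - b * sqrt (real r))"
    proof -
      have "b * sqrt (real r) \<le> b * (real n + 1)" using n(2) b by (intro mult_left_mono) auto
      then show ?thesis unfolding pow using C by (intro mult_left_mono) (auto simp: algebra_simps)
    qed
    also have "\<dots> = C * exp b * exp (- b * sqrt (real r))"
      by (simp add: exp_diff exp_minus divide_inverse)
    finally show "u r \<le> C * exp b * exp (- b * sqrt (real r))" .
  qed
qed

section \<open>The proportionality bracket\<close>

lemma goldstein_bracket:
  fixes f :: "'a::euclidean_space \<Rightarrow> real"
  assumes lipb: "L-lipschitz_on (cball p R) f" and R: "R > 0" and L: "L > 0"
    and manifold: "C2_manifold_around M p"
    and robust: "grows_robustly f M p" and tempered: "tempered_growth f M p" and \<gamma>: "0 < \<gamma>" "\<gamma> < 1"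
  shows "\<forall>\<^sub>F \<beta> in at_right 0. proportionality_bracket f p (\<beta> * \<gamma>) \<beta>"
proof -
  interpret lipschitz_on_cball f p R L by unfold_locales (rule lipb)
  obtain \<Phi> \<Psi> D\<Phi> D\<Psi> V s r \<Lambda> where chart: "C2_chart M p \<Phi> \<Psi> D\<Phi> D\<Psi> V s r \<Lambda>"
    using C2_manifold_around_chart[OF manifold] by metis
  then interpret C2_chart M p \<Phi> \<Psi> D\<Phi> D\<Psi> V s r \<Lambda> .
  obtain \<delta> where \<delta>: "\<delta> > 0" "\<forall>\<^sub>F x in nhds p. f x - f p \<ge> \<delta> / 2 * (norm (x - p))\<^sup>2"
    using robust unfolding grows_robustly_def by blast
  obtain U h where U: "open U" "p \<in> U" "C2_on U h" "\<forall>x\<in>M \<inter> U. h x = f x"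
    using robust unfolding grows_robustly_def C2_restriction_around_def by blast
  obtain \<mu> where \<mu>: "\<mu> > 0"
    "\<forall>\<^sub>F x in nhds p. \<forall>v\<in>clarke_subdiff f x. v \<bullet> (x - closest_point M x) \<ge> \<mu> * infdist x M"
    using robust unfolding grows_robustly_def by blast
  have hf: "h x = f x" if "x \<in> M" "x \<in> U" for x using U(4) that by blast
  obtain c C s1 where c: "c > 0" "C > 0" and s1: "s1 > 0" "s1 \<le> s"
    and grad: "\<And>y. y \<in> M \<Longrightarrow> y \<in> ball p s1 \<Longrightarrow> riemannian_grad M f y \<in> tangent_space M y"
    "\<And>y. y \<in> M \<Longrightarrow> y \<in> ball p s1 \<Longrightarrow> norm (riemannian_grad M f y) \<le> C * norm (y - p)"
    "\<And>y. y \<in> M \<Longrightarrow> y \<in> ball p s1 \<Longrightarrow> c * (norm (y - p))\<^sup>2 \<le> riemannian_grad M f y \<bullet> (y - p)"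
    using riemannian_grad_growth[OF U(3,1,2) hf \<delta>] by metis
  obtain \<kappa> e1 where \<kappa>: "\<kappa> > 0" and e1: "e1 > 0"
    "\<And>x \<epsilon>. x \<in> ball p e1 \<Longrightarrow> 0 \<le> \<epsilon> \<Longrightarrow> \<epsilon> \<le> norm (x - p) \<Longrightarrow> norm (goldstein_subgrad f \<epsilon> x) < \<mu> / 2 \<Longrightarrow>
      \<kappa> * infdist x M \<le> \<epsilon>"
    using goldstein_subgrad_small_imp_near[OF chart R L \<mu>] by metis
  obtain e2 where e2: "e2 > 0" "\<And>x. x \<in> ball p e2 \<Longrightarrow> f x - f p \<ge> \<delta> / 2 * (norm (x - p))\<^sup>2"
    using \<delta>(2) unfolding eventually_nhds_metric by (auto simp: dist_commute)
  \<comment> \<open>When \<open>g\<close> is small, the unit Riemannian gradient has inner product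
    at least \<open>c / C / 2 * D\<close> with \<open>x - p\<close>, where
    \<open>D = norm (x - p)\<close>; this is at least \<open>2 * c0 * D\<close>. An angle below
    \<open>c0\<close> removes at most \<open>c0 * D\<close> and leaves \<open>c0 * D\<close>. The
    same \<open>c0\<close> caps \<beta>, as the contraction lemma asks.\<close>
  define c0 where "c0 = min 1 (c / (4 * C))"
  have c0: "0 < c0" "c0 \<le> 1" "2 * c0 \<le> c / C / 2" using c by (auto simp: c0_def)
  \<comment> \<open>With \<open>\<beta> \<le> \<kappa> / 2\<close> a small \<open>g\<close> puts
    \<open>x\<close> within half of \<open>norm (x - p)\<close> of \<open>M\<close>.\<close>
  have "\<forall>\<^sub>F \<beta> in at_right 0. \<beta> \<le> min c0 (\<kappa> / 2)"
    using c0(1) \<kappa> by (intro eventually_at_rightI[of 0 "min c0 (\<kappa> / 2)"]) auto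
  moreover have "\<forall>\<^sub>F \<beta> in at_right 0. (0::real) < \<beta>" by (rule eventually_at_right_less)
  moreover note tempered[unfolded tempered_growth_def, rule_format, OF c0(1)]
  ultimately show ?thesis
  proof eventually_elim
    case (elim \<beta>)
    note \<beta> = elim(2)
    have \<beta>_le: "\<beta> \<le> c0" "\<beta> \<le> \<kappa> / 2" "\<beta> \<le> 1" using elim(1) c0(2) by auto
    obtain \<eta> where \<eta>: "\<eta> > 0"
      "\<And>x \<epsilon>. x \<noteq> p \<Longrightarrow> norm (x - p) < \<eta> \<Longrightarrow> 0 \<le> \<epsilon> \<Longrightarrow> \<epsilon> \<le> \<beta> * norm (x - p) \<Longrightarrow>
       norm (goldstein_subgrad f \<epsilon> x) < \<eta> \<Longrightarrow>
       goldstein_subgrad f \<epsilon> x \<noteq> 0 \<and> riemannian_grad M f (closest_point M x) \<noteq> 0 \<and>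
       vec_angle (goldstein_subgrad f \<epsilon> x) (riemannian_grad M f (closest_point M x)) < c0"
      by (rule tempered_growth_small_subgrad[where \<beta> = \<beta> and f = f and p = p and
            P = "\<lambda>\<epsilon> x. goldstein_subgrad f \<epsilon> x \<noteq> 0 \<and> riemannian_grad M f (closest_point M x) \<noteq> 0 \<and>
              vec_angle (goldstein_subgrad f \<epsilon> x) (riemannian_grad M f (closest_point M x)) < c0"])
         (use elim(3) in blast)+
    define m where "m = min \<eta> (\<mu> / 2)"
    have m: "m > 0" "m \<le> \<eta>" "m \<le> \<mu> / 2" using \<eta>(1) \<mu>(1) by (auto simp: m_def)
    define \<theta>1 where "\<theta>1 = sqrt (1 - c0 * \<beta> * \<gamma>)"
    \<comment> \<open>For \<open>norm g \<ge> m\<close> the descent is at least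
      \<open>\<beta> * \<gamma> * m * norm (x - p)\<close> and the gap at most
      \<open>L * norm (x - p)\<close>; their ratio is the relative decrease.\<close>
    define \<theta>2 where "\<theta>2 = 1 - \<beta> * \<gamma> * m / L"
    define \<theta> where "\<theta> = max (1/2) (max \<theta>1 \<theta>2)"
    have "c0 * \<beta> * \<gamma> > 0" using c0(1) \<beta> \<gamma>(1) by simp
    moreover have "\<beta> * \<gamma> * m / L > 0" using \<beta> \<gamma>(1) m(1) L by simp
    ultimately have \<theta>: "0 < \<theta>" "\<theta> < 1" "\<theta>1 \<le> \<theta>" "\<theta>2 \<le> \<theta>"
      by (auto simp: \<theta>_def \<theta>1_def \<theta>2_def less_max_iff_disj)
    \<comment> \<open>The halving serves two doublings: the ball of radius \<epsilon> around
      \<open>x\<close>, and the nearest point, which may lie twice as far from \<open>p\<close> as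
      \<open>x\<close>.\<close>
    define e where "e = min (min e1 e2) (min (min R s1) (min \<eta> (s / 4))) / 2"
    have e0: "e > 0" using e1(1) e2(1) R s1(1) \<eta>(1) pos(1) by (simp add: e_def)
    have main: "goldstein_subgrad f \<epsilon> x \<noteq> 0 \<and>
           (f (goldstein_step f \<epsilon> x) - f p \<le> \<theta> * (f x - f p) \<or>
            norm (goldstein_step f \<epsilon> x - p) \<le> \<theta> * norm (x - p))"
      if x: "x \<noteq> p" "dist x p < e" and \<epsilon>': "\<beta> * \<gamma> \<le> \<epsilon> / norm (x - p)" "\<epsilon> / norm (x - p) \<le> \<beta>" for x \<epsilon>
    proof -
      define g where "g = goldstein_subgrad f \<epsilon> x"
      define D where "D = norm (x - p)"
      have D: "D > 0" using x(1) by (simp add: D_def)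
      have \<epsilon>: "\<beta> * \<gamma> * D \<le> \<epsilon>" "\<epsilon> \<le> \<beta> * D"
        using \<epsilon>' D by (simp_all add: D_def pos_le_divide_eq pos_divide_le_eq)
      have \<epsilon>0: "0 \<le> \<epsilon>" using \<epsilon>(1) \<beta> \<gamma>(1) D by (intro order_trans[OF _ \<epsilon>(1)]) simp
      have "\<beta> * D \<le> 1 * D" using \<beta>_le(3) D by (intro mult_right_mono) auto
      then have \<epsilon>D: "\<epsilon> \<le> D" using \<epsilon>(2) by simp
      have De: "D < e" using x(2) by (simp add: D_def dist_norm)
      have xb: "x \<in> ball p e1" "x \<in> ball p e2" "x \<in> ball p R" "x \<in> ball p (s / 4)" "2 * D < s1" "D < \<eta>"
        using De e0 by (simp_all add: e_def D_def dist_norm norm_minus_commute)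
      have sub: "cball x \<epsilon> \<subseteq> ball p R"
      proof
        fix z assume "z \<in> cball x \<epsilon>"
        then have "dist p z \<le> 2 * D"
          using dist_triangle[of p z x] \<epsilon>D by (simp add: D_def dist_norm norm_minus_commute)
        also have "\<dots> < R" using De by (simp add: e_def)
        finally show "z \<in> ball p R" by simp
      qed
      show ?thesis
      proof (cases "norm g < m")
        case True
        have xD: "norm (x - p) < \<eta>" using xb(6) by (simp add: D_def)
        have "\<epsilon> \<le> \<beta> * norm (x - p)" using \<epsilon>(2) by (simp add: D_def)
        moreover have "norm (goldstein_subgrad f \<epsilon> x) < \<eta>" using True m(2) by (simp add: g_def)
        ultimately have temp: "g \<noteq> 0" "riemannian_grad M f (closest_point M x) \<noteq> 0"
          "vec_angle g (riemannian_grad M f (closest_point M x)) < c0"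
          using \<eta>(2)[OF x(1) xD \<epsilon>0] unfolding g_def by blast+
        define y where "y = closest_point M x"
        define G where "G = riemannian_grad M f y"
        have y: "y \<in> M" "y \<in> ball p s1"
          using nearest_point(1)[OF xb(4)] nearest_point_dist(2)[OF xb(4)] xb(5)
          by (simp_all add: y_def D_def dist_norm norm_minus_commute)
        have G0: "G \<noteq> 0" using temp(2) by (simp add: G_def y_def)
        have "\<kappa> * infdist x M \<le> \<epsilon>"
          using True m(3) \<epsilon>D by (intro e1(2)[OF xb(1) \<epsilon>0]) (auto simp: D_def g_def)
        then have "\<kappa> * norm (x - y) \<le> \<epsilon>"
          by (simp add: infdist_nearest_point[OF xb(4)] y_def dist_norm)
        also have "\<dots> \<le> \<kappa> / 2 * D"
          using \<epsilon>(2) mult_right_mono[OF \<beta>_le(2) less_imp_le[OF D]] by linarith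
        finally have "\<kappa> * norm (x - y) \<le> \<kappa> * (D / 2)" by simp
        then have xy: "norm (x - y) \<le> D / 2" using \<kappa> by (simp only: mult_le_cancel_left_pos)
        then have yD: "D / 2 \<le> norm (y - p)"
          using norm_triangle_ineq[of "x - y" "y - p"] by (simp add: D_def)
        have "(x - y) \<bullet> G = 0"
          unfolding y_def G_def
          by (rule nearest_point_normal[OF nearest_point(2)[OF xb(4)]]) (use grad(1)[OF y] in \<open>simp_all add: y_def\<close>)
        then have "G \<bullet> (x - p) = G \<bullet> (y - p)"
          by (simp add: inner_diff_right inner_diff_left inner_commute)
        then have "c * (norm (y - p))\<^sup>2 \<le> G \<bullet> (x - p)" using grad(3)[OF y] by (simp add: G_def)
        \<comment> \<open>Cancelling \<open>norm G\<close>, at most \<open>C * norm (y - p)\<close>,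
          against growth quadratic in \<open>norm (y - p)\<close> leaves a bound linear in it, that
          is, a bound on the angle.\<close>
        moreover have "norm G * (c / C * norm (y - p)) \<le> (C * norm (y - p)) * (c / C * norm (y - p))"
          using grad(2)[OF y] c by (intro mult_right_mono) (auto simp: G_def)
        moreover have "(C * norm (y - p)) * (c / C * norm (y - p)) = c * (norm (y - p))\<^sup>2"
          using c(2) by (simp add: power2_eq_square)
        moreover have "norm G * (sgn G \<bullet> (x - p)) = G \<bullet> (x - p)"
          using G0 by (simp add: sgn_div_norm)
        ultimately have "norm G * (c / C * norm (y - p)) \<le> norm G * (sgn G \<bullet> (x - p))"
          by linarith
        then have "c / C * norm (y - p) \<le> sgn G \<bullet> (x - p)"
          by (rule mult_left_le_imp_le) (simp add: G0)
        moreover have "c / C * (D / 2) \<le> c / C * norm (y - p)"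
          using yD c by (intro mult_left_mono) auto
        moreover have "2 * c0 * D \<le> c / C / 2 * D" using c0(3) D by (intro mult_right_mono) auto
        ultimately have 1: "2 * c0 * D \<le> sgn G \<bullet> (x - p)" by simp
        have "norm (sgn g - sgn G) \<le> c0"
          using norm_sgn_diff_le_vec_angle[OF temp(1) G0] temp(3) by (simp add: G_def y_def)
        then have "norm (sgn g - sgn G) * norm (x - p) \<le> c0 * D"
          unfolding D_def by (intro mult_right_mono) auto
        then have "\<bar>(sgn g - sgn G) \<bullet> (x - p)\<bar> \<le> c0 * D"
          using Cauchy_Schwarz_ineq2[of "sgn g - sgn G" "x - p"] by linarith
        then have 2: "sgn g \<bullet> (x - p) \<ge> sgn G \<bullet> (x - p) - c0 * D"
          by (simp add: inner_diff_left abs_le_iff)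
        have "c0 * norm (x - p) \<le> sgn (goldstein_subgrad f \<epsilon> x) \<bullet> (x - p)"
          using 1 2 by (simp add: D_def g_def)
        then have "norm (goldstein_step f \<epsilon> x - p) \<le> \<theta>1 * norm (x - p)"
          unfolding \<theta>1_def using D \<epsilon> unfolding D_def
          by (intro goldstein_step_contracts c0(1,2) \<beta> \<beta>_le(1) \<gamma>)
        also have "\<dots> \<le> \<theta> * norm (x - p)" using \<theta>(3) by (intro mult_right_mono) auto
        finally show ?thesis using temp(1) by (simp add: g_def)
      next
        case False
        have "f x - f p \<le> L * D"
          using lipschitz_onD[OF lipb, of x p] xb(3) R by (simp add: dist_norm D_def)
        then have "\<beta> * \<gamma> * m / L * (f x - f p) \<le> \<beta> * \<gamma> * m / L * (L * D)"
          using \<beta> \<gamma>(1) m(1) L by (intro mult_left_mono) auto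
        also have "\<dots> = (\<beta> * \<gamma> * D) * m" using L by simp
        also have "\<dots> \<le> \<epsilon> * norm g" using \<epsilon>(1) \<epsilon>0 False m(1) by (intro mult_mono) auto
        finally have "f (goldstein_step f \<epsilon> x) - f p \<le> \<theta>2 * (f x - f p)"
          using goldstein_descent[OF \<epsilon>0 sub] by (simp add: \<theta>2_def g_def left_diff_distrib)
        \<comment> \<open>Enlarging the factor needs a nonnegative gap, which quadratic growth
          provides.\<close>
        also have "\<dots> \<le> \<theta> * (f x - f p)"
        proof (rule mult_right_mono[OF \<theta>(4)])
          have "0 \<le> \<delta> / 2 * (norm (x - p))\<^sup>2" using \<delta>(1) by simp
          then show "0 \<le> f x - f p" using e2(2)[OF xb(2)] by linarith
        qed
        finally show ?thesis using False m(1) by (auto simp: g_def)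
      qed
    qed
    have "\<forall>\<^sub>F x in at p. \<forall>\<epsilon>. \<beta> * \<gamma> \<le> \<epsilon> / norm (x - p) \<and> \<epsilon> / norm (x - p) \<le> \<beta> \<longrightarrow>
           goldstein_subgrad f \<epsilon> x \<noteq> 0 \<and>
           (f (goldstein_step f \<epsilon> x) - f p \<le> \<theta> * (f x - f p) \<or>
            norm (goldstein_step f \<epsilon> x - p) \<le> \<theta> * norm (x - p))"
      unfolding eventually_at using main e0 by blast
    moreover have "0 < \<beta> * \<gamma>" "\<beta> * \<gamma> < \<beta>" using \<beta> \<gamma> by simp_all
    ultimately show ?case
      unfolding proportionality_bracket_def using \<theta>(1,2) by blast
  qed
qed

text \<open>The bracket speaks only of points near \<open>p\<close>, and a step that merely lowers
  the gap may lead away from \<open>p\<close>. Quadratic growth keeps the run in place: the gap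
  never increases, and a small gap confines the iterate.\<close>

lemma goldstein_iterates_rate:
  fixes f :: "'a::euclidean_space \<Rightarrow> real"
  assumes lipb: "L-lipschitz_on (cball p R) f" and R: "R > 0" and L: "L > 0"
    and \<delta>: "\<delta> > 0" "\<forall>\<^sub>F x in nhds p. f x - f p \<ge> \<delta> / 2 * (norm (x - p))\<^sup>2"
    and bracket: "proportionality_bracket f p (\<beta> * \<gamma>) \<beta>" and \<beta>: "0 < \<beta>" "\<beta> \<le> 1" and \<gamma>: "0 < \<gamma>"
  shows "\<forall>\<^sub>F x0 in nhds p. \<forall>xs. xs 0 = x0 \<and> goldstein_iterates f p \<gamma> \<beta> xs \<longrightarrow> nearly_linear_convergence xs p"
proof -
  interpret lipschitz_on_cball f p R L by unfold_locales (rule lipb)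
  obtain \<theta> e1 where \<theta>: "0 < \<theta>" "\<theta> < 1" and e1: "e1 > 0"
    "\<And>x \<epsilon>. x \<noteq> p \<Longrightarrow> dist x p < e1 \<Longrightarrow> \<beta> * \<gamma> \<le> \<epsilon> / norm (x - p) \<Longrightarrow> \<epsilon> / norm (x - p) \<le> \<beta> \<Longrightarrow>
           f (goldstein_step f \<epsilon> x) - f p \<le> \<theta> * (f x - f p) \<or>
            norm (goldstein_step f \<epsilon> x - p) \<le> \<theta> * norm (x - p)"
    using bracket unfolding proportionality_bracket_def eventually_at by blast
  obtain e2 where e2: "e2 > 0" "\<And>x. dist x p < e2 \<Longrightarrow> f x - f p \<ge> \<delta> / 2 * (norm (x - p))\<^sup>2"
    using \<delta>(2) unfolding eventually_nhds_metric by blast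
  define e where "e = min R (min e1 e2)"
  have e: "e > 0" "e \<le> R" "e \<le> e1" "e \<le> e2" using R e1(1) e2(1) by (auto simp: e_def)
  \<comment> \<open>Then the initial gap is at most \<open>\<delta> * e\<^sup>2 / 16\<close>, and
    growth gives squared distance at most \<open>e\<^sup>2 / 8\<close>, below
    \<open>(e / 2)\<^sup>2\<close>.\<close>
  define \<sigma> where "\<sigma> = min (e / 4) (\<delta> * e\<^sup>2 / (16 * L))"
  have \<sigma>: "\<sigma> > 0" "\<sigma> \<le> e / 4" "L * \<sigma> \<le> \<delta> * e\<^sup>2 / 16"
  proof -
    show "\<sigma> > 0" "\<sigma> \<le> e / 4" using e(1) \<delta>(1) L by (auto simp: \<sigma>_def)
    have "L * \<sigma> \<le> L * (\<delta> * e\<^sup>2 / (16 * L))" using L by (intro mult_left_mono) (auto simp: \<sigma>_def)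
    then show "L * \<sigma> \<le> \<delta> * e\<^sup>2 / 16" using L by simp
  qed
  have "nearly_linear_convergence xs p"
    if x0: "dist (xs 0) p < \<sigma>" and it: "goldstein_iterates f p \<gamma> \<beta> xs" for xs
  proof -
    define u where "u r = f (xs r) - f p" for r
    define d where "d r = norm (xs r - p)" for r
    \<comment> \<open>From within \<open>e / 2\<close> a step at most doubles the distance, because
      \<open>\<beta> \<le> 1\<close> gives \<open>\<epsilon> \<le> d r\<close>. The next iterate is
      thus still in the range where growth applies, which brings it back within
      \<open>e / 2\<close>.\<close>
    have one: "u (Suc r) \<le> u r \<and> d (Suc r) < e \<and> (u (Suc r) \<le> \<theta> * u r \<or> d (Suc r) \<le> \<theta> * d r)"
      if d: "d r < e / 2" for r
    proof (cases "xs r = p")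
      case True
      then have "xs (Suc r) = p" using it unfolding goldstein_iterates_def by presburger
      with True e(1) show ?thesis by (simp add: u_def d_def)
    next
      case False
      then obtain \<epsilon> where \<epsilon>: "\<gamma> \<le> \<epsilon> / (\<beta> * d r)" "\<epsilon> / (\<beta> * d r) \<le> 1"
        and step: "xs (Suc r) = goldstein_step f \<epsilon> (xs r)"
        using it[unfolded goldstein_iterates_def, rule_format, of r] unfolding d_def by auto
      have d0: "d r > 0" using False by (simp add: d_def)
      have \<epsilon>': "\<gamma> * (\<beta> * d r) \<le> \<epsilon>" "\<epsilon> \<le> \<beta> * d r"
        using \<epsilon> d0 \<beta>(1) by (simp_all add: pos_le_divide_eq pos_divide_le_eq)
      have \<epsilon>0: "0 \<le> \<epsilon>" using \<epsilon>'(1) \<gamma> \<beta>(1) d0 by (intro order_trans[OF _ \<epsilon>'(1)]) simp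
      have "\<beta> * d r \<le> 1 * d r" using \<beta>(2) d0 by (intro mult_right_mono) auto
      then have \<epsilon>d: "\<epsilon> \<le> d r" using \<epsilon>'(2) by simp
      have sub: "cball (xs r) \<epsilon> \<subseteq> ball p R"
      proof
        fix z assume "z \<in> cball (xs r) \<epsilon>"
        then have "dist p z \<le> 2 * d r"
          using dist_triangle[of p z "xs r"] \<epsilon>d by (simp add: d_def dist_norm norm_minus_commute)
        then show "z \<in> ball p R" using d e(2) by simp
      qed
      have "0 \<le> \<epsilon> * norm (goldstein_subgrad f \<epsilon> (xs r))" using \<epsilon>0 by simp
      then have "u (Suc r) \<le> u r"
        using goldstein_descent[OF \<epsilon>0 sub] by (simp add: u_def step)
      moreover have "d (Suc r) < e"
        using norm_goldstein_step_le[OF \<epsilon>0, of f "xs r"] norm_triangle_ineq[of "xs (Suc r) - xs r" "xs r - p"] \<epsilon>d d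
        by (simp add: d_def step)
      moreover have "u (Suc r) \<le> \<theta> * u r \<or> d (Suc r) \<le> \<theta> * d r"
        unfolding u_def d_def step
      proof (rule e1(2)[OF False])
        show "dist (xs r) p < e1" using d e(1,3) by (simp add: d_def dist_norm)
        show "\<beta> * \<gamma> \<le> \<epsilon> / norm (xs r - p)" "\<epsilon> / norm (xs r - p) \<le> \<beta>"
          using \<epsilon>' d0 by (simp_all add: d_def pos_le_divide_eq pos_divide_le_eq mult_ac)
      qed
      ultimately show ?thesis by blast
    qed
    have growth: "\<delta> / 2 * (d r)\<^sup>2 \<le> u r" if "d r < e" for r
      using e2(2)[of "xs r"] that e(4) by (simp add: u_def d_def dist_norm)
    have lipu: "u r \<le> L * d r" if "d r < e" for r
    proof -
      have "xs r \<in> cball p R" using that e(2) by (simp add: d_def dist_norm norm_minus_commute)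
      then show ?thesis
        using lipschitz_onD[OF lipb, of "xs r" p] R by (simp add: u_def d_def dist_norm)
    qed
    have d_init: "d 0 < \<sigma>" using x0 by (simp add: d_def dist_norm)
    have "u 0 \<le> L * d 0" using d_init \<sigma>(2) e(1) by (intro lipu) simp
    also have "\<dots> \<le> L * \<sigma>" using d_init L by (intro mult_left_mono) auto
    finally have u_init: "u 0 \<le> \<delta> * e\<^sup>2 / 16" using \<sigma>(3) by linarith
    have inv: "d r < e / 2 \<and> u r \<le> \<delta> * e\<^sup>2 / 16" for r
    proof (induction r)
      case 0
      then show ?case using d_init \<sigma>(2) e(1) u_init by simp
    next
      case (Suc r)
      then have us: "u (Suc r) \<le> \<delta> * e\<^sup>2 / 16" and de: "d (Suc r) < e" using one[of r] by auto
      have "\<delta> / 2 * (d (Suc r))\<^sup>2 \<le> \<delta> / 2 * (e\<^sup>2 / 8)" using growth[OF de] us by simp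
      then have "(d (Suc r))\<^sup>2 \<le> e\<^sup>2 / 8" using \<delta>(1) by (simp only: mult_le_cancel_left_pos half_gt_zero)
      also have "\<dots> < (e / 2)\<^sup>2" using e(1) by (simp add: power2_eq_square)
      finally have "d (Suc r) < e / 2" by (rule power2_less_imp_less) (use e(1) in simp)
      with us show ?case by blast
    qed
    then have dhalf: "d r < e / 2" for r by blast
    have de: "d r < e" for r using dhalf[of r] e(1) by linarith
    have u0: "0 \<le> u r" for r
    proof -
      have "0 \<le> \<delta> / 2 * (d r)\<^sup>2" using \<delta>(1) by simp
      then show ?thesis using growth[OF de[of r]] by linarith
    qed
    obtain a b where ab: "a > 0" "b > 0" "\<And>r. u r \<le> a * exp (- b * sqrt (real r))"
    proof (rule alternating_contraction_rate[where u = u and d = d and L = L and B = e, OF \<theta>])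
      show "u (Suc r) \<le> u r" "u (Suc r) \<le> \<theta> * u r \<or> d (Suc r) \<le> \<theta> * d r" for r
        using one[OF dhalf[of r]] by simp_all
      show "u r \<le> L * d r" "d r \<le> e" for r using lipu[OF de] less_imp_le[OF de] .
    qed (use L u0 in simp_all)
    \<comment> \<open>The distance is at most a multiple of the square root of the gap, so
      \<open>b\<close> is halved.\<close>
    have "norm (xs r - p) \<le> sqrt (2 * a / \<delta>) * exp (- (b / 2) * sqrt (real r))" for r
    proof -
      have "\<delta> / 2 * (d r)\<^sup>2 \<le> a * exp (- b * sqrt (real r))"
        using growth[OF de[of r]] ab(3)[of r] by linarith
      then have "(d r)\<^sup>2 \<le> 2 * a / \<delta> * exp (- b * sqrt (real r))"
        using \<delta>(1) by (simp add: field_simps)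
      also have "exp (- b * sqrt (real r)) = (exp (- (b / 2) * sqrt (real r)))\<^sup>2"
        by (simp add: exp_double[symmetric])
      finally have "d r \<le> sqrt (2 * a / \<delta> * (exp (- (b / 2) * sqrt (real r)))\<^sup>2)"
        by (rule real_le_rsqrt)
      then show "norm (xs r - p) \<le> sqrt (2 * a / \<delta>) * exp (- (b / 2) * sqrt (real r))"
        unfolding real_sqrt_mult real_sqrt_abs d_def by simp
    qed
    moreover have "sqrt (2 * a / \<delta>) > 0" "b / 2 > 0" using ab \<delta>(1) by auto
    ultimately show ?thesis unfolding nearly_linear_convergence_def by blast
  qed
  then have "\<forall>x0. dist x0 p < \<sigma> \<longrightarrow> (\<forall>xs. xs 0 = x0 \<and> goldstein_iterates f p \<gamma> \<beta> xs \<longrightarrow> nearly_linear_convergence xs p)"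
    by simp
  with \<sigma>(1) show ?thesis
    unfolding eventually_nhds_metric by (intro exI[of _ \<sigma>] conjI)
qed

theorem theorem7p3:
  fixes f :: "'a::euclidean_space \<Rightarrow> real" and M :: "'a set" and xbar :: 'a
  assumes "xbar \<in> M"
    and "C2_manifold_around M xbar"
    and "locally_lipschitz f"
    and "grows_robustly f M xbar"
    and "tempered_growth f M xbar"
  shows "goldstein_property f xbar \<and>
    (\<forall>\<gamma>. 0 < \<gamma> \<and> \<gamma> < 1 \<longrightarrow>
       (\<forall>\<^sub>F \<beta> in at_right 0. proportionality_bracket f xbar (\<beta> * \<gamma>) \<beta>)) \<and>
    (\<forall>\<gamma>. 0 < \<gamma> \<and> \<gamma> < 1 \<longrightarrow>
       (\<forall>\<^sub>F \<beta> in at_right 0. \<forall>\<^sub>F x0 in nhds xbar. \<forall>xs.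
          xs 0 = x0 \<and> goldstein_iterates f xbar \<gamma> \<beta> xs \<longrightarrow> nearly_linear_convergence xs xbar))"
proof -
  obtain r L0 where r: "r > 0" and lip0: "L0-lipschitz_on (ball xbar r) f"
    using assms(3) unfolding locally_lipschitz_def by blast
  \<comment> \<open>The closed ball of half the radius lies in the open ball; adding 1 makes the
    constant positive.\<close>
  from lip0 have lip: "(L0 + 1)-lipschitz_on (cball xbar (r / 2)) f"
    by (rule lipschitz_on_mono) (use r in auto)
  have L: "L0 + 1 > 0" using lipschitz_on_nonneg[OF lip0] by simp
  have R: "r / 2 > 0" using r by simp
  have bracket: "\<forall>\<^sub>F \<beta> in at_right 0. proportionality_bracket f xbar (\<beta> * \<gamma>) \<beta>" if "0 < \<gamma>" "\<gamma> < 1" for \<gamma>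
    using goldstein_bracket[OF lip R L assms(2,4,5) that] .
  have "\<exists>\<beta>. proportionality_bracket f xbar (\<beta> * (1 / 2)) \<beta>"
    using eventually_happens'[OF trivial_limit_at_right_real bracket[of "1 / 2"]] by auto
  then have "goldstein_property f xbar"
    using assms(3) unfolding goldstein_property_def by blast
  moreover have "\<forall>\<^sub>F \<beta> in at_right 0. \<forall>\<^sub>F x0 in nhds xbar. \<forall>xs.
          xs 0 = x0 \<and> goldstein_iterates f xbar \<gamma> \<beta> xs \<longrightarrow> nearly_linear_convergence xs xbar"
    if \<gamma>: "0 < \<gamma>" "\<gamma> < 1" for \<gamma>
  proof -
    obtain \<delta> where \<delta>: "\<delta> > 0" "\<forall>\<^sub>F x in nhds xbar. f x - f xbar \<ge> \<delta> / 2 * (norm (x - xbar))\<^sup>2"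
      using assms(4) unfolding grows_robustly_def by blast
    have "\<forall>\<^sub>F \<beta> in at_right 0. \<beta> \<le> (1::real)"
      by (intro eventually_at_rightI[of 0 1]) auto
    moreover have "\<forall>\<^sub>F \<beta> in at_right 0. (0::real) < \<beta>" by (rule eventually_at_right_less)
    ultimately show ?thesis
      using bracket[OF \<gamma>]
      by eventually_elim (rule goldstein_iterates_rate[OF lip R L \<delta> _ _ _ \<gamma>(1)])
  qed
  ultimately show ?thesis using bracket by blast
qed

end
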